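(* Assume that $\mathbb E\exp(a_0K)<\infty$ for some $a_0>0$. Then the sequence $\big(n^{-1}(N_n(\tau_n),\tau_n);\ n\ge1\big)$, with values in $\mathbb R_+^2$, obeys a large deviation principle with rate function $\mathcal F$ and speed $n$.
   Context: $\mathbb N=\{0,1,2,\dots\}$; $K$ is a generic random variable with law $\mu$ on $\mathbb N$, with $\mu(0)<1$ and $\mu(1)<1$. For each $n\ge1$, $(N_n(t),S_n(t))_{t\in\mathbb N}$ is the Markov chain with $N_n(0)=1$, $S_n(0)\sim\mu$, absorbed when $S_n=0$, and such that, as long as $S_n(t)>0$, conditionally on the past up to time $t$: with probability $N_n(t)/n$, $(N_n(t+1),S_n(t+1))=(N_n(t),S_n(t)-1)$; with probability $1-N_n(t)/n$, $(N_n(t+1),S_n(t+1))=(N_n(t)+1,S_n(t)+K(t+1)-1)$, where $K(t+1)\sim\mu$ is independent of the past up to time $t$. $\tau_n=\min\{t\in\mathbb N:S_n(t)=0\}$. A sequence $(Z_n)$ with values in a Polish space $\mathcal Z$ obeys a large deviation principle with rate function $\mathcal I$ and speed $n$ if $\mathcal I:\mathcal Z\to[0,\infty]$ is lower semi-continuous, $\limsup n^{-1}\ln\mathbb P(Z_n\in F)\le-\inf_F\mathcal I$ for all closed $F$, and $\liminf n^{-1}\ln\mathbb P(Z_n\in O)\ge-\inf_O\mathcal I$ for all open $O$. Define $I(u)=\sup_{a\in\mathbb R}\{au-\ln\mathbb E\exp(aK)\}$ for $u\ge0$. For $t>0$ and $r\in(0,t\wedge1)$ let $\rho(r,t)\in(0,\infty)$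 be the unique solution $\rho$ of $\frac{1-e^{-t\rho}}{\rho}=r$ and $$J_t(r)=(1-r)\ln(1-r)+(t-r)\ln\rho(r,t)+te^{-t\rho(r,t)};$$ for $r=t\wedge1>0$, $J_t(r)$ is the (finite) limit $\lim_{r'\nearrow t\wedge1}J_t(r')$; and $J_t(r)=\infty$ if $r\notin(0,t\wedge1]$. Then $\mathcal F:\mathbb R_+^2\to[0,\infty]$ is defined by $\mathcal F(r,t)=rI(t/r)+J_t(r)$ if $r>0$, $\mathcal F(0,t)=\infty$ if $t>0$, and $\mathcal F(0,0)=0$. *)

theory Defs
  imports "HOL-Probability.Probability"
begin

text \<open>Logarithm on \<open>[0, \<infinity>]\<close> with \<open>ln 0 = -\<infinity>\<close> and \<open>ln \<infinity> = \<infinity>\<close>.\<close>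

definition ln_ennreal :: "ennreal \<Rightarrow> ereal" where
  "ln_ennreal x =
     (if x = 0 then - \<infinity> else if x = \<infinity> then \<infinity> else ereal (ln (enn2real x)))"

text \<open>
  The state space is a subset \<open>X\<close> of a Polish space, carrying the subspace topology.
  Each \<open>Z n\<close> may live on its own probability space \<open>M n\<close>; only \<open>n \<ge> 1\<close> matters.
  The first conjunct says that the \<open>Z n\<close> are random variables with values in \<open>X\<close>.
  By convention the infimum over the empty set is \<open>\<infinity>\<close>.
\<close>

definition large_deviation_principle ::
  "'a :: polish_space set \<Rightarrow> (nat \<Rightarrow> 'w measure) \<Rightarrow> (nat \<Rightarrow> 'w \<Rightarrow> 'a) \<Rightarrow> ('a \<Rightarrow> ereal) \<Rightarrow> bool"
where
  "large_deviation_principle X M Z I \<longleftrightarrow>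
     (\<forall>n\<ge>1. Z n \<in> M n \<rightarrow>\<^sub>M restrict_space borel X) \<and>
     (\<forall>x\<in>X. 0 \<le> I x) \<and>
     (\<forall>c. openin (top_of_set X) {x \<in> X. c < I x}) \<and>
     (\<forall>F. closedin (top_of_set X) F \<longrightarrow>
        limsup (\<lambda>n. ereal (1 / real n) * ln_ennreal (emeasure (M n) {\<omega> \<in> space (M n). Z n \<omega> \<in> F}))
          \<le> - (INF x\<in>F. I x)) \<and>
     (\<forall>U. openin (top_of_set X) U \<longrightarrow>
        liminf (\<lambda>n. ereal (1 / real n) * ln_ennreal (emeasure (M n) {\<omega> \<in> space (M n). Z n \<omega> \<in> U}))
          \<ge> - (INF x\<in>U. I x))"

text \<open>
  Transition kernel on states \<open>(a, s)\<close>. On the reachable states \<open>a \<le> n\<close>, so \<open>a / n\<close> is a genuine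
  probability there; the truncated subtractions only occur for \<open>s > 0\<close>.
\<close>

definition chain_step :: "nat pmf \<Rightarrow> nat \<Rightarrow> nat \<times> nat \<Rightarrow> (nat \<times> nat) pmf" where
  "chain_step \<mu> n = (\<lambda>(a, s).
     if s = 0 then return_pmf (a, s)
     else bind_pmf (bernoulli_pmf (real a / real n)) (\<lambda>b.
       if b then return_pmf (a, s - 1)
       else map_pmf (\<lambda>k. (a + 1, s + k - 1)) \<mu>))"

definition is_chain ::
  "nat pmf \<Rightarrow> nat \<Rightarrow> 'w measure \<Rightarrow> (nat \<Rightarrow> 'w \<Rightarrow> nat) \<Rightarrow> (nat \<Rightarrow> 'w \<Rightarrow> nat) \<Rightarrow> bool"
where
  "is_chain \<mu> n M N S \<longleftrightarrow>
     prob_space M \<and>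
     (\<forall>t. N t \<in> M \<rightarrow>\<^sub>M count_space UNIV) \<and>
     (\<forall>t. S t \<in> M \<rightarrow>\<^sub>M count_space UNIV) \<and>
     (AE \<omega> in M. N 0 \<omega> = 1) \<and>
     distr M (count_space UNIV) (S 0) = measure_pmf \<mu> \<and>
     (\<forall>t h y. \<P>(\<omega> in M. \<forall>i\<le>t. (N i \<omega>, S i \<omega>) = h i) > 0 \<longrightarrow>
        \<P>(\<omega> in M. (N (Suc t) \<omega>, S (Suc t) \<omega>) = y \<bar> \<forall>i\<le>t. (N i \<omega>, S i \<omega>) = h i)
          = pmf (chain_step \<mu> n (h t)) y)"

text \<open>
  The absorption time is almost surely finite for the chain above; on the exceptional null set
  the value of \<open>LEAST\<close> is irrelevant.
\<close>

definition absorption_time :: "(nat \<Rightarrow> 'w \<Rightarrow> nat) \<Rightarrow> 'w \<Rightarrow> nat" where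
  "absorption_time S \<omega> = (LEAST t. S t \<omega> = 0)"

definition mgf :: "nat pmf \<Rightarrow> real \<Rightarrow> ennreal" where
  "mgf \<mu> a = (\<integral>\<^sup>+ k. ennreal (exp (a * real k)) \<partial>measure_pmf \<mu>)"

definition cramer_rate :: "nat pmf \<Rightarrow> real \<Rightarrow> ereal" where
  "cramer_rate \<mu> u = (SUP a::real. ereal (a * u) - ln_ennreal (mgf \<mu> a))"

definition rho :: "real \<Rightarrow> real \<Rightarrow> real" where
  "rho r t = (THE x. 0 < x \<and> (1 - exp (- t * x)) / x = r)"

definition J_formula :: "real \<Rightarrow> real \<Rightarrow> real" where
  "J_formula t r =
     (1 - r) * ln (1 - r) + (t - r) * ln (rho r t) + t * exp (- t * rho r t)"

definition J :: "real \<Rightarrow> real \<Rightarrow> ereal" where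
  "J t r =
     (if 0 < r \<and> r < min t 1 then ereal (J_formula t r)
      else if 0 < r \<and> r = min t 1 then ereal (Lim (at_left (min t 1)) (J_formula t))
      else \<infinity>)"

text \<open>Only the values on the quadrant \<open>r \<ge> 0\<close>, \<open>t \<ge> 0\<close> are relevant.\<close>

definition chain_rate :: "nat pmf \<Rightarrow> real \<times> real \<Rightarrow> ereal" where
  "chain_rate \<mu> = (\<lambda>(r, t).
     if r > 0 then ereal r * cramer_rate \<mu> (t / r) + J t r
     else if t > 0 then \<infinity>
     else 0)"

end

theory Submission
  imports Defs
    "HOL-Computational_Algebra.Computational_Algebra"
    "HOL-Real_Asymp.Real_Asymp"
begin

text \<open>
  Record the draws of the chain as a word over \<open>n\<close> letters, a new letter corresponding to an increase
  of \<open>N\<close>. Then \<open>{N(\<tau>) = a, \<tau> = t}\<close> means that the word of length \<open>t + 1\<close> has \<open>a\<close> distinct letters,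
  that \<open>K\<^sub>1 + \<dots> + K\<^sub>a = t\<close>, and that the supply never runs out before time \<open>t\<close>. Dropping the last condition
  gives an upper bound; by cyclic rotations of the word and, independently, of \<open>(K\<^sub>1, \<dots>, K\<^sub>a)\<close>, it costs
  at most a factor \<open>a (t + 1)\<close>. So up to polynomial factors the probability is the product of
  \<open>P(K\<^sub>1 + \<dots> + K\<^sub>a = t)\<close> and of the number of words divided by \<open>n\<close> to the power \<open>t + 1\<close>. Both are governed by
  coefficients of large powers of a power series, \<open>E(z\<^sup>K)\<close> and \<open>exp z - 1\<close> respectively, whose
  exponential rates are Legendre transforms: Chernoff from above, tilting from below. The Legendre
  transform for \<open>exp z - 1\<close>, evaluated at its critical point, yields the function \<open>J\<close>.
\<close>

section \<open>Coefficients of powers of a weight sequence\<close>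

text \<open>\<open>K\<close> may live on a lattice, so P(K_1 + ... + K_a = t) can vanish for the
  majority of pairs (a, t) of a given slope. The lower bound therefore looks for a single good pair
  (a', t') with t'/a' close to the target slope u and passes to its multiples (L a', L t') by
  supermultiplicativity; after division by n these come close enough to the target. The word factor
  has to follow wherever these multiples go, so it is bounded below for all pairs (a, m) in a thin
  cone. The cone opens only on the side m \<ge> u a, because at u = 1 the coefficients of the powers
  of exp z - 1 vanish below the diagonal; this is why slopes are approximated from a prescribed
  side. In the upper bound the exponent for fixed tilting parameters is continuous in (r, t), and
  for r \<le> 1 the rate is the supremum over these parameters. This gives both lower semicontinuity
  and a finite choice of parameters on compact sets. Compactness comes from the exponential moment,
  which makes survival beyond time C n negligible.\<close>

definition cpow :: "(nat \<Rightarrow> real) \<Rightarrow> nat \<Rightarrow> nat \<Rightarrow> real" where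
  "cpow w a t = fps_nth (Abs_fps w ^ a) t"

lemma cpow_0: "cpow w 0 t = (if t = 0 then 1 else 0)"
  by (simp add: cpow_def)

lemma cpow_1: "cpow w (Suc 0) t = w t"
  by (simp add: cpow_def)

lemma cpow_Suc: "cpow w (Suc a) t = (\<Sum>k=0..t. w k * cpow w a (t - k))"
  by (simp add: cpow_def fps_mult_nth)

lemma cpow_nonneg: "(\<And>k. 0 \<le> w k) \<Longrightarrow> 0 \<le> cpow w a t"
proof (induction a arbitrary: t)
  case (Suc a)
  then show ?case unfolding cpow_Suc by (intro sum_nonneg mult_nonneg_nonneg) auto
qed (simp add: cpow_0)

lemma cpow_mono: "(\<And>k. 0 \<le> v k) \<Longrightarrow> (\<And>k. v k \<le> w k) \<Longrightarrow> cpow v a t \<le> cpow w a t"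
proof (induction a arbitrary: t)
  case (Suc a)
  have "0 \<le> w k" for k using Suc.prems order_trans by blast
  then show ?case unfolding cpow_Suc
    by (intro sum_mono mult_mono Suc.IH Suc.prems cpow_nonneg)
qed (simp add: cpow_0)

text \<open>The product on the left is one term of the Cauchy product for exponent
  \<open>a + b\<close>; the other terms are nonnegative.\<close>

lemma cpow_supermult:
  assumes "\<And>k. 0 \<le> w k"
  shows "cpow w a s * cpow w b t \<le> cpow w (a + b) (s + t)"
proof -
  have "cpow w (a + b) (s + t) = (\<Sum>i=0..s+t. cpow w a i * cpow w b (s + t - i))"
    by (simp add: cpow_def power_add fps_mult_nth)
  moreover have "cpow w a s * cpow w b (s + t - s) \<le> (\<Sum>i=0..s+t. cpow w a i * cpow w b (s + t - i))"
    by (rule member_le_sum) (auto intro: mult_nonneg_nonneg cpow_nonneg assms)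
  ultimately show ?thesis by simp
qed

lemma cpow_power_le:
  assumes "\<And>k. 0 \<le> w k"
  shows "cpow w a t ^ L \<le> cpow w (L * a) (L * t)"
proof (induction L)
  case (Suc L)
  have "cpow w a t ^ Suc L \<le> cpow w a t * cpow w (L * a) (L * t)"
    using Suc by (simp add: mult_left_mono cpow_nonneg assms)
  also have "\<dots> \<le> cpow w (a + L * a) (t + L * t)" by (rule cpow_supermult) (rule assms)
  finally show ?case by simp
qed (simp add: cpow_0)

text \<open>After multiplication by \<open>z ^ t\<close> the coefficient is a single term of the
  nonnegative series of the \<open>a\<close>-th power. The induction on \<open>a\<close> avoids
  handling the product series itself.\<close>

lemma cpow_chernoff:
  assumes "\<And>k. 0 \<le> w k" "0 < z" "summable (\<lambda>k. w k * z ^ k)"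
  shows "cpow w a t * z ^ t \<le> (\<Sum>k. w k * z ^ k) ^ a"
proof (induction a arbitrary: t)
  case (Suc a)
  let ?f = "\<Sum>k. w k * z ^ k"
  have f0: "0 \<le> ?f" using assms by (intro suminf_nonneg) auto
  have "cpow w (Suc a) t * z ^ t = (\<Sum>k=0..t. (w k * z ^ k) * (cpow w a (t - k) * z ^ (t - k)))"
    unfolding cpow_Suc sum_distrib_right
    by (intro sum.cong refl) (simp add: power_add[symmetric])
  also have "\<dots> \<le> (\<Sum>k=0..t. (w k * z ^ k) * ?f ^ a)"
    using assms by (intro sum_mono mult_left_mono Suc) auto
  also have "\<dots> = (\<Sum>k\<in>{0..t}. w k * z ^ k) * ?f ^ a" by (simp add: sum_distrib_right)
  also have "\<dots> \<le> ?f * ?f ^ a"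
    using assms f0 by (intro mult_right_mono sum_le_suminf) auto
  finally show ?case by simp
qed (simp add: cpow_0)

text \<open>For \<open>w = pmf \<mu>\<close> the right-hand side is P(K_1 + ... + K_a = t), in the
  form in which the weights of the model below appear.\<close>

lemma cpow_lists:
  "cpow w a t = (\<Sum>ks\<in>{ks. length ks = a \<and> sum_list ks = t}. prod_list (map w ks))"
proof (induction a arbitrary: t)
  case 0
  have "{ks::nat list. length ks = 0 \<and> sum_list ks = t} = (if t = 0 then {[]} else {})" by auto
  then show ?case by (simp add: cpow_0)
next
  case (Suc a)
  have fin: "finite {ks::nat list. length ks = a \<and> sum_list ks = t}" for t
    by (rule finite_subset[OF _ finite_lists_length_eq[of "{..t}" a]])
      (auto intro: member_le_sum_list)
  have eq: "{ks. length ks = Suc a \<and> sum_list ks = t} =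
      (\<lambda>(k, ks). k # ks) ` (SIGMA k:{0..t}. {ks. length ks = a \<and> sum_list ks = t - k})"
    by (auto simp: length_Suc_conv image_iff)
  have "(\<Sum>ks\<in>{ks. length ks = Suc a \<and> sum_list ks = t}. prod_list (map w ks)) =
     (\<Sum>(k, ks)\<in>(SIGMA k:{0..t}. {ks. length ks = a \<and> sum_list ks = t - k}). w k * prod_list (map w ks))"
    unfolding eq by (subst sum.reindex) (auto simp: inj_on_def o_def case_prod_unfold)
  also have "\<dots> = (\<Sum>k=0..t. \<Sum>ks\<in>{ks. length ks = a \<and> sum_list ks = t - k}. w k * prod_list (map w ks))"
    by (rule sum.Sigma[symmetric]) (auto simp: fin)
  also have "\<dots> = cpow w (Suc a) t"
    unfolding cpow_Suc Suc.IH by (simp add: sum_distrib_left)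
  finally show ?case by simp
qed

text \<open>With finite support the generating function is a polynomial, and the Chernoff inequality
  is replaced by an identity for the total mass. Tilting needs this identity.\<close>

lemma cpow_finite_support:
  assumes "\<And>k. M < k \<Longrightarrow> w k = 0"
  shows "(\<Sum>t\<le>a * M. cpow w a t * z ^ t) = (\<Sum>k\<le>M. w k * z ^ k) ^ a"
proof -
  define p where "p = (\<Sum>k\<le>M. monom (w k) k)"
  have cp: "coeff p k = w k" for k
    using assms by (cases "k \<le> M") (auto simp: p_def coeff_sum if_distrib sum.delta)
  have ff: "fps_of_poly p = Abs_fps w"
    by (simp add: fps_eq_iff cp)
  have cpa: "coeff (p ^ a) t = cpow w a t" for t
    unfolding cpow_def ff[symmetric] fps_of_poly_power[symmetric] by simp
  have dp: "degree p \<le> M"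
    using assms by (intro degree_le) (auto simp: cp)
  have "degree (p ^ a) \<le> a * M"
    using degree_power_le[of p a] dp by (metis mult.commute mult_le_mono2 order_trans)
  then have "(\<Sum>t\<le>a * M. coeff (p ^ a) t * z ^ t) = poly (p ^ a) z"
    unfolding poly_altdef by (intro sum.mono_neutral_right) (auto simp: coeff_eq_0)
  moreover have "poly p z = (\<Sum>k\<le>M. w k * z ^ k)"
    by (simp add: p_def poly_sum poly_monom)
  ultimately show ?thesis by (simp add: cpa poly_power)
qed

section \<open>A coupled model of the chain\<close>

text \<open>
  A state is the word of draws so far and the list of the values of \<open>K\<close> drawn so far, one for each
  distinct letter. The model keeps running after absorption; the chain is recovered from it by
  the function \<open>chain_state\<close> below.
\<close>

definition model_step :: "nat pmf \<Rightarrow> nat \<Rightarrow> nat list \<times> nat list \<Rightarrow> (nat list \<times> nat list) pmf" where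
  "model_step \<mu> n = (\<lambda>(xs, ks). bind_pmf (pmf_of_set {..<n}) (\<lambda>x.
     if x \<in> set xs then return_pmf (xs @ [x], ks) else map_pmf (\<lambda>k. (xs @ [x], ks @ [k])) \<mu>))"

primrec model :: "nat pmf \<Rightarrow> nat \<Rightarrow> nat \<Rightarrow> (nat list \<times> nat list) pmf" where
  "model \<mu> n 0 = return_pmf ([], [])"
| "model \<mu> n (Suc m) = bind_pmf (model \<mu> n m) (model_step \<mu> n)"

lemma set_pmf_model:
  assumes "n \<ge> 1"
  shows "\<omega> \<in> set_pmf (model \<mu> n m) \<Longrightarrow>
    length (fst \<omega>) = m \<and> set (fst \<omega>) \<subseteq> {..<n} \<and> length (snd \<omega>) = card (set (fst \<omega>))"
proof (induction m arbitrary: \<omega>)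
  case (Suc m)
  have ne: "{..<n} \<noteq> {}" using assms by (auto simp: lessThan_empty_iff)
  from Suc.prems obtain xs ks where *: "(xs, ks) \<in> set_pmf (model \<mu> n m)" "\<omega> \<in> set_pmf (model_step \<mu> n (xs, ks))"
    by auto
  show ?case using Suc.IH[OF *(1)] *(2) ne
    by (auto simp: model_step_def card_insert_if split: if_splits)
qed auto

text \<open>The target state determines its predecessor: remove the last letter, and remove the last
  value exactly when that letter is new. This is the backward recursion behind
  \<open>pmf_model\<close>.\<close>

lemma pmf_model_step:
  assumes "n \<ge> 1"
  shows "pmf (model_step \<mu> n \<omega>) (xs @ [x], ks) =
    (if x < n \<and> x \<in> set xs then indicator {(xs, ks)} \<omega> / real n
     else if x < n \<and> ks \<noteq> [] then pmf \<mu> (last ks) / real n * indicator {(xs, butlast ks)} \<omega> else 0)"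
proof -
  have ne: "{..<n} \<noteq> {}" using assms by (auto simp: lessThan_empty_iff)
  obtain xs' ks' where w: "\<omega> = (xs', ks')" by (cases \<omega>)
  have m: "pmf (map_pmf (\<lambda>k. (xs' @ [y], ks' @ [k])) \<mu>) (xs @ [x], ks) =
      (if xs' = xs \<and> y = x \<and> ks \<noteq> [] \<and> ks' = butlast ks then pmf \<mu> (last ks) else 0)" for y
  proof (cases "xs' = xs \<and> y = x \<and> ks \<noteq> [] \<and> ks' = butlast ks")
    case True
    then have "(xs @ [x], ks) = (\<lambda>k. (xs' @ [y], ks' @ [k])) (last ks)" by simp
    then have "pmf (map_pmf (\<lambda>k. (xs' @ [y], ks' @ [k])) \<mu>) (xs @ [x], ks) = pmf \<mu> (last ks)"
      by (simp only:) (rule pmf_map_inj', auto simp: inj_on_def)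
    with True show ?thesis by simp
  next
    case False
    then have "(xs @ [x], ks) \<notin> range (\<lambda>k. (xs' @ [y], ks' @ [k]))" by auto
    then have "pmf (map_pmf (\<lambda>k. (xs' @ [y], ks' @ [k])) \<mu>) (xs @ [x], ks) = 0"
      by (intro pmf_map_outside) auto
    with False show ?thesis by auto
  qed
  have e: "pmf (if y \<in> set xs' then return_pmf (xs' @ [y], ks')
      else map_pmf (\<lambda>k. (xs' @ [y], ks' @ [k])) \<mu>) (xs @ [x], ks) =
      (if y = x then (if x \<in> set xs' then indicator {(xs, ks)} \<omega>
       else (if ks \<noteq> [] then pmf \<mu> (last ks) * indicator {(xs, butlast ks)} \<omega> else 0)) else 0)" for y
  proof (cases "y \<in> set xs'")
    case True
    then show ?thesis by (auto simp: w indicator_def)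
  next
    case False
    then show ?thesis by (simp only: m if_False) (auto simp: w indicator_def)
  qed
  have "pmf (model_step \<mu> n \<omega>) (xs @ [x], ks) = (\<Sum>y<n. pmf (if y \<in> set xs' then return_pmf (xs' @ [y], ks')
      else map_pmf (\<lambda>k. (xs' @ [y], ks' @ [k])) \<mu>) (xs @ [x], ks)) / real n"
    unfolding model_step_def w pmf_bind prod.case by (subst integral_pmf_of_set) (use ne in auto)
  also have "\<dots> = (\<Sum>y<n. if y = x then (if x \<in> set xs' then indicator {(xs, ks)} \<omega>
       else (if ks \<noteq> [] then pmf \<mu> (last ks) * indicator {(xs, butlast ks)} \<omega> else 0)) else 0) / real n"
    by (intro arg_cong2[where f="(/)"] sum.cong refl e)
  also have "\<dots> = (if x < n \<and> x \<in> set xs then indicator {(xs, ks)} \<omega> / real n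
     else if x < n \<and> ks \<noteq> [] then pmf \<mu> (last ks) / real n * indicator {(xs, butlast ks)} \<omega> else 0)"
    by (auto simp: sum.delta' indicator_def w)
  finally show ?thesis .
qed

abbreviation model_prob :: "nat pmf \<Rightarrow> nat \<Rightarrow> nat \<Rightarrow> (nat list \<times> nat list) set \<Rightarrow> real" where
  "model_prob \<mu> n t \<equiv> measure_pmf.prob (model \<mu> n (Suc t))"

text \<open>The weight is a factor depending on the word's length times a factor depending on the
  values; it does not see at which positions new letters occur. Hence words and values may be
  rotated independently.\<close>

lemma pmf_model:
  assumes "n \<ge> 1"
  shows "length xs = m \<Longrightarrow> set xs \<subseteq> {..<n} \<Longrightarrow> length ks = card (set xs) \<Longrightarrow>
    pmf (model \<mu> n m) (xs, ks) = (1 / real n) ^ m * prod_list (map (pmf \<mu>) ks)"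
proof (induction m arbitrary: xs ks)
  case (Suc m)
  then obtain ys x where xs: "xs = ys @ [x]" by (metis length_Suc_conv_rev)
  have "pmf (model \<mu> n (Suc m)) (xs, ks) = measure_pmf.expectation (model \<mu> n m) (\<lambda>\<omega>. pmf (model_step \<mu> n \<omega>) (ys @ [x], ks))"
    by (simp add: pmf_bind xs)
  also have "\<dots> = (1 / real n) ^ Suc m * prod_list (map (pmf \<mu>) ks)"
  proof (cases "x \<in> set ys")
    case True
    then have "measure_pmf.expectation (model \<mu> n m) (\<lambda>\<omega>. pmf (model_step \<mu> n \<omega>) (ys @ [x], ks))
       = pmf (model \<mu> n m) (ys, ks) / real n"
      using Suc.prems assms by (simp add: pmf_model_step xs measure_pmf_single)
    then show ?thesis using Suc True by (simp add: xs insert_absorb)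
  next
    case False
    then have ks: "ks \<noteq> []" using Suc.prems by (auto simp: xs)
    have c: "length (butlast ks) = card (set ys)" using Suc.prems False by (simp add: xs)
    have "measure_pmf.expectation (model \<mu> n m) (\<lambda>\<omega>. pmf (model_step \<mu> n \<omega>) (ys @ [x], ks))
       = pmf \<mu> (last ks) / real n * pmf (model \<mu> n m) (ys, butlast ks)"
      using Suc.prems assms False ks by (simp add: pmf_model_step xs measure_pmf_single)
    also have "pmf (model \<mu> n m) (ys, butlast ks) = (1 / real n) ^ m * prod_list (map (pmf \<mu>) (butlast ks))"
      using Suc.prems by (intro Suc.IH c) (auto simp: xs)
    also have "prod_list (map (pmf \<mu>) ks) = prod_list (map (pmf \<mu>) (butlast ks @ [last ks]))"
      using append_butlast_last_id[OF ks] by (rule arg_cong[where f="\<lambda>l. prod_list (map (pmf \<mu>) l)", OF sym])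
    ultimately show ?thesis by (simp add: mult_ac)
  qed
  finally show ?case .
qed simp

section \<open>Replaying the chain along a state of the model\<close>

text \<open>Letter 0 belongs to time 0: it is always new and its value is the initial supply. While
  the chain is alive, \<open>a\<close> values have been consumed, so index \<open>a\<close> is the
  next one.\<close>

primrec chain_state :: "nat \<Rightarrow> nat list \<times> nat list \<Rightarrow> nat \<times> nat" where
  "chain_state 0 \<omega> = (1, snd \<omega> ! 0)"
| "chain_state (Suc i) \<omega> = (let (a, s) = chain_state i \<omega> in
     if s = 0 then (a, s)
     else if fst \<omega> ! Suc i \<in> set (take (Suc i) (fst \<omega>)) then (a, s - 1)
     else (a + 1, s + snd \<omega> ! a - 1))"

text \<open>\<open>Suc i\<close> because \<open>i + 1\<close> letters have been drawn by time
  \<open>i\<close>.\<close>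

definition ndist :: "nat list \<Rightarrow> nat \<Rightarrow> nat" where
  "ndist xs i = card (set (take (Suc i) xs))"

text \<open>While the chain is alive this is the current supply plus the \<open>i\<close> units
  already used.\<close>

definition supplied :: "nat list \<times> nat list \<Rightarrow> nat \<Rightarrow> nat" where
  "supplied \<omega> i = sum_list (take (ndist (fst \<omega>) i) (snd \<omega>))"

lemma ndist_Suc:
  assumes "Suc i < length xs"
  shows "ndist xs (Suc i) = (if xs ! Suc i \<in> set (take (Suc i) xs) then ndist xs i else Suc (ndist xs i))"
  using assms unfolding ndist_def by (subst take_Suc_conv_app_nth) (auto simp: insert_absorb)

lemma ndist_le: "ndist xs i \<le> card (set xs)"
  unfolding ndist_def by (intro card_mono) (auto dest: in_set_takeD)

text \<open>The conjunct \<open>i \<le> supplied \<omega> i\<close> makes the natural subtraction an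
  honest one up to and including the moment of absorption.\<close>

lemma chain_state_alive:
  assumes "length (snd \<omega>) = card (set (fst \<omega>))"
  shows "i < length (fst \<omega>) \<Longrightarrow> \<forall>j<i. j < supplied \<omega> j \<Longrightarrow>
     chain_state i \<omega> = (ndist (fst \<omega>) i, supplied \<omega> i - i) \<and> i \<le> supplied \<omega> i"
proof (induction i)
  case 0
  then obtain x xs where xs: "fst \<omega> = x # xs" by (cases "fst \<omega>") auto
  then have "snd \<omega> \<noteq> []" using assms by auto
  then show ?case using xs by (cases "snd \<omega>") (auto simp: ndist_def supplied_def)
next
  case (Suc i)
  then have IH: "chain_state i \<omega> = (ndist (fst \<omega>) i, supplied \<omega> i - i)" and al: "i < supplied \<omega> i" by auto
  show ?case
  proof (cases "fst \<omega> ! Suc i \<in> set (take (Suc i) (fst \<omega>))")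
    case True
    then have "ndist (fst \<omega>) (Suc i) = ndist (fst \<omega>) i" using Suc.prems by (simp add: ndist_Suc)
    then show ?thesis using IH al True by (simp add: supplied_def del: take_Suc)
  next
    case False
    then have e: "ndist (fst \<omega>) (Suc i) = Suc (ndist (fst \<omega>) i)" using Suc.prems by (simp add: ndist_Suc)
    then have "ndist (fst \<omega>) i < length (snd \<omega>)" using ndist_le[of "fst \<omega>" "Suc i"] assms by simp
    then have "supplied \<omega> (Suc i) = supplied \<omega> i + snd \<omega> ! ndist (fst \<omega>) i"
      by (simp add: supplied_def e take_Suc_conv_app_nth)
    then show ?thesis using IH al False e by simp
  qed
qed

lemma chain_state_dead:
  assumes "length (snd \<omega>) = card (set (fst \<omega>))"
  shows "i < length (fst \<omega>) \<Longrightarrow> \<not> (\<forall>j<i. j < supplied \<omega> j) \<Longrightarrow> snd (chain_state i \<omega>) = 0"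
proof (induction i)
  case (Suc i)
  show ?case
  proof (cases "\<forall>j<i. j < supplied \<omega> j")
    case True
    then have "\<not> i < supplied \<omega> i" using Suc.prems less_Suc_eq by auto
    then show ?thesis using chain_state_alive[OF assms, of i] True Suc.prems by (simp add: case_prod_unfold Let_def)
  next
    case False
    then show ?thesis using Suc by (simp add: case_prod_unfold Let_def)
  qed
qed simp

lemma chain_state_pos_iff:
  assumes "length (snd \<omega>) = card (set (fst \<omega>))" "i < length (fst \<omega>)"
  shows "0 < snd (chain_state i \<omega>) \<longleftrightarrow> (\<forall>j\<le>i. j < supplied \<omega> j)"
proof (cases "\<forall>j<i. j < supplied \<omega> j")
  case True
  then show ?thesis using chain_state_alive[OF assms True] by (auto simp: le_less)
next
  case False
  then show ?thesis using chain_state_dead[OF assms False] less_imp_le by auto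
qed

text \<open>The replay up to \<open>i\<close> reads only letters already drawn and values already
  attached to them. So paths of the model can be built one step at a time.\<close>

lemma chain_state_cong:
  assumes "length (snd \<omega>) = card (set (fst \<omega>))" "i < length (fst \<omega>)"
  shows "chain_state i (fst \<omega> @ xs, snd \<omega> @ ks) = chain_state i \<omega>"
  using assms(2)
proof (induction i)
  case 0
  then have "snd \<omega> \<noteq> []" using assms by auto
  then show ?case by (simp add: nth_append)
next
  case (Suc i)
  let ?\<omega> = "(fst \<omega> @ xs, snd \<omega> @ ks)"
  have IH: "chain_state i ?\<omega> = chain_state i \<omega>" using Suc by simp
  show ?case
  proof (cases "snd (chain_state i \<omega>) = 0 \<or> fst \<omega> ! Suc i \<in> set (take (Suc i) (fst \<omega>))")
    case True
    then show ?thesis using Suc.prems IH by (auto simp: nth_append case_prod_unfold Let_def simp del: take_Suc)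
  next
    case False
    then have "\<forall>j<i. j < supplied \<omega> j" using chain_state_pos_iff[OF assms(1), of i] Suc.prems by auto
    then have a: "fst (chain_state i \<omega>) = ndist (fst \<omega>) i" using chain_state_alive[OF assms(1), of i] Suc.prems by auto
    have "ndist (fst \<omega>) (Suc i) = Suc (ndist (fst \<omega>) i)" using Suc.prems False by (simp add: ndist_Suc)
    then have "ndist (fst \<omega>) i < length (snd \<omega>)" using ndist_le[of "fst \<omega>" "Suc i"] assms by simp
    then show ?thesis using IH a Suc.prems by (simp add: nth_append case_prod_unfold Let_def)
  qed
qed

section \<open>Path laws of the model and of the chain\<close>

definition model_path :: "nat \<Rightarrow> nat list \<times> nat list \<Rightarrow> (nat \<times> nat) list" where
  "model_path t \<omega> = map (\<lambda>i. chain_state i \<omega>) [0..<Suc t]"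

text \<open>The law of the trajectory built from the transition kernel alone; the model and every
  realisation of the chain are both compared with it.\<close>

primrec path_law :: "nat pmf \<Rightarrow> nat \<Rightarrow> nat \<Rightarrow> (nat \<times> nat) list pmf" where
  "path_law \<mu> n 0 = map_pmf (\<lambda>k. [(1, k)]) \<mu>"
| "path_law \<mu> n (Suc t) = bind_pmf (path_law \<mu> n t) (\<lambda>h. map_pmf (\<lambda>y. h @ [y]) (chain_step \<mu> n (last h)))"

lemma map_pmf_of_set_mem:
  assumes "n \<ge> 1" "A \<subseteq> {..<n}"
  shows "map_pmf (\<lambda>x. x \<in> A) (pmf_of_set {..<n}) = bernoulli_pmf (real (card A) / real n)"
proof (rule pmf_eqI)
  fix b
  have ne: "{..<n} \<noteq> {}" using assms by (auto simp: lessThan_empty_iff)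
  have c: "card A \<le> n" using card_mono[OF _ assms(2)] by simp
  have "pmf (map_pmf (\<lambda>x. x \<in> A) (pmf_of_set {..<n})) b = real (card ({..<n} \<inter> (\<lambda>x. x \<in> A) -` {b})) / real n"
    unfolding pmf_map using ne by (subst measure_pmf_of_set) auto
  also have "\<dots> = pmf (bernoulli_pmf (real (card A) / real n)) b"
  proof (cases b)
    case True
    then have "{..<n} \<inter> (\<lambda>x. x \<in> A) -` {b} = A" using assms by auto
    then show ?thesis using True c assms by simp
  next
    case False
    then have "{..<n} \<inter> (\<lambda>x. x \<in> A) -` {b} = {..<n} - A" using assms by auto
    then have "card ({..<n} \<inter> (\<lambda>x. x \<in> A) -` {b}) = n - card A"
      using assms by (simp add: card_Diff_subset finite_subset[OF assms(2)])
    then show ?thesis using False c assms by (simp add: field_simps)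
  qed
  finally show "pmf (map_pmf (\<lambda>x. x \<in> A) (pmf_of_set {..<n})) b = pmf (bernoulli_pmf (real (card A) / real n)) b" .
qed

text \<open>While the chain is alive its first coordinate is the number of distinct letters, so a
  uniform letter is a repetition with exactly the kernel's probability \<open>a / n\<close>. After
  absorption both sides append the absorbed state, whatever is drawn.\<close>

lemma model_path_step:
  assumes n: "n \<ge> 1" and \<omega>: "\<omega> \<in> set_pmf (model \<mu> n (Suc t))"
  shows "map_pmf (model_path (Suc t)) (model_step \<mu> n \<omega>) =
     map_pmf (\<lambda>y. model_path t \<omega> @ [y]) (chain_step \<mu> n (chain_state t \<omega>))"
proof -
  obtain xs ks where w: "\<omega> = (xs, ks)" by (cases \<omega>)
  have len: "length xs = Suc t" "set xs \<subseteq> {..<n}" and lk: "length ks = card (set xs)"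
    using set_pmf_model[OF n \<omega>] by (auto simp: w)
  have cong: "chain_state i (xs @ [x], ks @ zs) = chain_state i \<omega>" if "i \<le> t" for i x zs
    using chain_state_cong[of \<omega> i "[x]" zs] len lk that by (simp add: w)
  have mp: "model_path (Suc t) (xs @ [x], ks @ zs) = model_path t \<omega> @ [chain_state (Suc t) (xs @ [x], ks @ zs)]" for x zs
    using cong by (auto simp: model_path_def)
  define a s where "a = fst (chain_state t \<omega>)" and "s = snd (chain_state t \<omega>)"
  have cs: "chain_state t \<omega> = (a, s)" by (simp add: a_def s_def)
  have nxt: "chain_state (Suc t) (xs @ [x], ks @ zs) =
      (if s = 0 then (a, s) else if x \<in> set xs then (a, s - 1) else (a + 1, s + (ks @ zs) ! a - 1))" for x zs
    using len cong[of t x zs] cs by (simp add: Let_def nth_append)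
  have mpn: "model_path (Suc t) (xs @ [x], ks @ zs) = model_path t \<omega> @
      [if s = 0 then (a, s) else if x \<in> set xs then (a, s - 1) else (a + 1, s + (ks @ zs) ! a - 1)]" for x zs
    by (simp only: mp nxt)
  have mpn': "model_path (Suc t) (xs @ [x], ks) = model_path t \<omega> @
      [if s = 0 then (a, s) else if x \<in> set xs then (a, s - 1) else (a + 1, s + ks ! a - 1)]" for x
    using mpn[of x "[]"] by simp
  show ?thesis
  proof (cases "s = 0")
    case True
    have "map_pmf (model_path (Suc t)) (model_step \<mu> n \<omega>) =
      bind_pmf (pmf_of_set {..<n}) (\<lambda>x. return_pmf (model_path t \<omega> @ [(a, s)]))"
      unfolding model_step_def w prod.case map_bind_pmf
      by (intro bind_pmf_cong refl)  (auto simp add: True pmf.map_comp o_def mpn mpn' w)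
    then show ?thesis using True by (simp add: cs chain_step_def)
  next
    case False
    then have "\<forall>j<t. j < supplied \<omega> j" using chain_state_pos_iff[of \<omega> t] len lk by (auto simp: w s_def)
    then have "a = ndist xs t" using chain_state_alive[of \<omega> t] len lk by (auto simp: w a_def)
    then have a: "a = card (set xs)" by (simp add: ndist_def len)
    have "map_pmf (model_path (Suc t)) (model_step \<mu> n \<omega>) =
      bind_pmf (pmf_of_set {..<n}) (\<lambda>x. if x \<in> set xs then return_pmf (model_path t \<omega> @ [(a, s - 1)])
        else map_pmf (\<lambda>k. model_path t \<omega> @ [(a + 1, s + k - 1)]) \<mu>)"
      unfolding model_step_def w prod.case map_bind_pmf
      using False lk by (intro bind_pmf_cong refl) (auto simp add: pmf.map_comp o_def mpn mpn' nth_append a w)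
    also have "\<dots> = bind_pmf (map_pmf (\<lambda>x. x \<in> set xs) (pmf_of_set {..<n})) (\<lambda>b. if b then return_pmf (model_path t \<omega> @ [(a, s - 1)])
        else map_pmf (\<lambda>k. model_path t \<omega> @ [(a + 1, s + k - 1)]) \<mu>)"
      by (simp add: bind_map_pmf)
    also have "map_pmf (\<lambda>x. x \<in> set xs) (pmf_of_set {..<n}) = bernoulli_pmf (real a / real n)"
      unfolding a by (rule map_pmf_of_set_mem) (use n len in auto)
    finally show ?thesis using False
      by (simp add: cs chain_step_def map_bind_pmf) (intro bind_pmf_cong refl, simp add: pmf.map_comp o_def)
  qed
qed

lemma map_model_path:
  assumes n: "n \<ge> 1"
  shows "map_pmf (model_path t) (model \<mu> n (Suc t)) = path_law \<mu> n t"
proof (induction t)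
  case 0
  have "map_pmf (model_path 0) (model \<mu> n (Suc 0)) = bind_pmf (pmf_of_set {..<n}) (\<lambda>x. map_pmf (\<lambda>k. [(1, k)]) \<mu>)"
    by (simp add: bind_return_pmf model_step_def map_bind_pmf pmf.map_comp o_def model_path_def)
  then show ?case by simp
next
  case (Suc t)
  have "map_pmf (model_path (Suc t)) (model \<mu> n (Suc (Suc t))) =
     bind_pmf (model \<mu> n (Suc t)) (\<lambda>\<omega>. map_pmf (model_path (Suc t)) (model_step \<mu> n \<omega>))"
    by (simp only: model.simps map_bind_pmf)
  also have "\<dots> = bind_pmf (model \<mu> n (Suc t)) (\<lambda>\<omega>. map_pmf (\<lambda>y. model_path t \<omega> @ [y]) (chain_step \<mu> n (last (model_path t \<omega>))))"
    by (intro bind_pmf_cong refl, subst model_path_step[OF n]) (auto simp: model_path_def)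
  also have "\<dots> = bind_pmf (map_pmf (model_path t) (model \<mu> n (Suc t))) (\<lambda>h. map_pmf (\<lambda>y. h @ [y]) (chain_step \<mu> n (last h)))"
    by (simp only: bind_map_pmf)
  finally show ?case using Suc by simp
qed

definition chain_path :: "(nat \<Rightarrow> 'w \<Rightarrow> nat) \<Rightarrow> (nat \<Rightarrow> 'w \<Rightarrow> nat) \<Rightarrow> nat \<Rightarrow> 'w \<Rightarrow> (nat \<times> nat) list" where
  "chain_path N S t \<omega> = map (\<lambda>i. (N i \<omega>, S i \<omega>)) [0..<Suc t]"

lemma measurable_chain_path [measurable]:
  fixes N S :: "nat \<Rightarrow> 'w \<Rightarrow> nat"
  assumes "\<And>t. N t \<in> M \<rightarrow>\<^sub>M count_space UNIV" "\<And>t. S t \<in> M \<rightarrow>\<^sub>M count_space UNIV"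
  shows "chain_path N S t \<in> M \<rightarrow>\<^sub>M count_space UNIV"
proof (induction t)
  case 0
  have [measurable]: "N 0 \<in> M \<rightarrow>\<^sub>M count_space UNIV" "S 0 \<in> M \<rightarrow>\<^sub>M count_space UNIV" using assms by auto
  show ?case unfolding chain_path_def by simp
next
  case (Suc t)
  have [measurable]: "N (Suc t) \<in> M \<rightarrow>\<^sub>M count_space UNIV" "S (Suc t) \<in> M \<rightarrow>\<^sub>M count_space UNIV" using assms by auto
  note Suc[measurable]
  have "chain_path N S (Suc t) = (\<lambda>\<omega>. chain_path N S t \<omega> @ [(N (Suc t) \<omega>, S (Suc t) \<omega>)])"
    by (simp add: chain_path_def fun_eq_iff)
  then show ?case by simp
qed

text \<open>The Markov property is available only for histories of positive probability; for the
  others both sides of the recursion vanish. As the path space is countable, equality of point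
  masses gives equality of the laws.\<close>

lemma chain_path_law:
  fixes N S :: "nat \<Rightarrow> 'w \<Rightarrow> nat"
  assumes ch: "is_chain \<mu> n M N S"
  shows "distr M (count_space UNIV) (chain_path N S t) = measure_pmf (path_law \<mu> n t)"
proof -
  interpret prob_space M using ch by (simp add: is_chain_def)
  have [measurable]: "\<And>t. N t \<in> M \<rightarrow>\<^sub>M count_space UNIV" "\<And>t. S t \<in> M \<rightarrow>\<^sub>M count_space UNIV"
    using ch by (auto simp: is_chain_def)
  note [measurable] = measurable_chain_path[of N M S]
  have ev: "{\<omega> \<in> space M. \<forall>i\<le>t. (N i \<omega>, S i \<omega>) = h ! i} = {\<omega> \<in> space M. chain_path N S t \<omega> = h}"
    if "length h = Suc t" for h t
    using that by (auto simp: chain_path_def list_eq_iff_nth_eq less_Suc_eq_le simp del: upt_Suc)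
  have pt: "prob {\<omega> \<in> space M. chain_path N S t \<omega> = h} = pmf (path_law \<mu> n t) h" for h
  proof (induction t arbitrary: h)
    case 0
    have N0: "AE \<omega> in M. N 0 \<omega> = 1" and S0: "distr M (count_space UNIV) (S 0) = measure_pmf \<mu>"
      using ch by (auto simp: is_chain_def)
    show ?case
    proof (cases "\<exists>k. h = [(1, k)]")
      case True
      then obtain k where h: "h = [(1, k)]" by auto
      have "prob {\<omega> \<in> space M. chain_path N S 0 \<omega> = h} = prob {\<omega> \<in> space M. S 0 \<omega> = k}"
        by (rule measure_eq_AE) (use N0 in \<open>auto simp: chain_path_def h\<close>)
      also have "\<dots> = measure (distr M (count_space UNIV) (S 0)) {k}"
        by (subst measure_distr) (auto intro!: arg_cong[where f=prob])
      also have "\<dots> = pmf \<mu> k" by (simp add: S0 pmf.rep_eq)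
      also have "\<dots> = pmf (path_law \<mu> n 0) h"
        by (simp add: h, subst pmf_map_inj') (auto simp: inj_on_def)
      finally show ?thesis .
    next
      case False
      have "prob {\<omega> \<in> space M. chain_path N S 0 \<omega> = h} = prob {}"
        by (rule measure_eq_AE) (use N0 False in \<open>auto simp: chain_path_def\<close>)
      also have "\<dots> = pmf (path_law \<mu> n 0) h"
        by (simp, subst pmf_map_outside) (use False in auto)
      finally show ?thesis .
    qed
  next
    case (Suc t)
    show ?case
    proof (cases "length h = Suc (Suc t)")
      case True
      then obtain g y where h: "h = g @ [y]" by (metis length_Suc_conv_rev)
      then have g: "length g = Suc t" using True by simp
      have p: "pmf (map_pmf (\<lambda>y. g' @ [y]) p) h = pmf p y * indicator {g} g'" for g' p
      proof (cases "g' = g")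
        case True
        then show ?thesis by (simp add: h, subst pmf_map_inj') (auto simp: inj_on_def)
      next
        case False
        then show ?thesis by (simp, intro pmf_map_outside) (auto simp: h)
      qed
      have R: "pmf (path_law \<mu> n (Suc t)) h = pmf (chain_step \<mu> n (last g)) y * pmf (path_law \<mu> n t) g"
      proof -
        have "pmf (path_law \<mu> n (Suc t)) h = measure_pmf.expectation (path_law \<mu> n t) (\<lambda>g'. pmf (chain_step \<mu> n (last g)) y * indicator {g} g')"
          unfolding path_law.simps pmf_bind p by (intro Bochner_Integration.integral_cong refl) (auto simp: indicator_def)
        then show ?thesis by (simp add: measure_pmf_single)
      qed
      have E1: "{\<omega> \<in> space M. chain_path N S (Suc t) \<omega> = h} =
        {\<omega> \<in> space M. (N (Suc t) \<omega>, S (Suc t) \<omega>) = y \<and> chain_path N S t \<omega> = g}"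
        by (auto simp: h chain_path_def)
      show ?thesis
      proof (cases "prob {\<omega> \<in> space M. chain_path N S t \<omega> = g} > 0")
        case True
        then have pos: "\<P>(\<omega> in M. \<forall>i\<le>t. (N i \<omega>, S i \<omega>) = g ! i) > 0" by (simp add: ev[OF g])
        have "\<P>(\<omega> in M. (N (Suc t) \<omega>, S (Suc t) \<omega>) = y \<bar> \<forall>i\<le>t. (N i \<omega>, S i \<omega>) = g ! i)
          = pmf (chain_step \<mu> n (g ! t)) y"
          using ch pos unfolding is_chain_def by blast
        moreover have "{\<omega> \<in> space M. (N (Suc t) \<omega>, S (Suc t) \<omega>) = y \<and> (\<forall>i\<le>t. (N i \<omega>, S i \<omega>) = g ! i)}
          = {\<omega> \<in> space M. (N (Suc t) \<omega>, S (Suc t) \<omega>) = y \<and> chain_path N S t \<omega> = g}"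
          using ev[OF g] by blast
        moreover have "g ! t = last g" using g by (cases g rule: rev_cases) auto
        ultimately have "prob {\<omega> \<in> space M. (N (Suc t) \<omega>, S (Suc t) \<omega>) = y \<and> chain_path N S t \<omega> = g}
          = pmf (chain_step \<mu> n (last g)) y * prob {\<omega> \<in> space M. chain_path N S t \<omega> = g}"
          using True by (simp add: cond_prob_def ev[OF g] field_simps)
        then show ?thesis unfolding E1 R Suc by simp
      next
        case False
        then have z: "prob {\<omega> \<in> space M. chain_path N S t \<omega> = g} = 0" by (simp add: zero_less_measure_iff)
        have "prob {\<omega> \<in> space M. (N (Suc t) \<omega>, S (Suc t) \<omega>) = y \<and> chain_path N S t \<omega> = g} \<le> 0"
          unfolding z[symmetric] by (rule finite_measure_mono) auto
        then show ?thesis unfolding E1 R Suc[symmetric] z by (simp add: measure_le_0_iff)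
      qed
    next
      case False
      have l: "g \<in> set_pmf (path_law \<mu> n t) \<Longrightarrow> length g = Suc t" for g t
        by (induction t arbitrary: g) auto
      have "h \<notin> set_pmf (path_law \<mu> n (Suc t))" using l[of h "Suc t"] False by blast
      moreover have "{\<omega> \<in> space M. chain_path N S (Suc t) \<omega> = h} = {}" using False by (auto simp: chain_path_def)
      ultimately show ?thesis by (simp only: set_pmf_iff) simp
    qed
  qed
  show ?thesis
  proof (rule measure_eqI_countable[of _ UNIV])
    fix h
    have "emeasure (distr M (count_space UNIV) (chain_path N S t)) {h} = emeasure M {\<omega> \<in> space M. chain_path N S t \<omega> = h}"
      by (subst emeasure_distr) (auto intro!: arg_cong[where f="emeasure M"])
    also have "\<dots> = emeasure (measure_pmf (path_law \<mu> n t)) {h}"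
      by (simp add: emeasure_eq_measure pt emeasure_pmf_single)
    finally show "emeasure (distr M (count_space UNIV) (chain_path N S t)) {h} = emeasure (measure_pmf (path_law \<mu> n t)) {h}" .
  qed auto
qed

text \<open>The transfer principle: any event determined by the path up to a fixed time, described
  by \<open>P\<close>, can be evaluated in the model.\<close>

lemma chain_prob_eq_model:
  fixes N S :: "nat \<Rightarrow> 'w \<Rightarrow> nat"
  assumes ch: "is_chain \<mu> n M N S" and n: "n \<ge> 1"
  shows "measure M {\<omega> \<in> space M. P (chain_path N S t \<omega>)} =
     model_prob \<mu> n t {\<omega>. P (model_path t \<omega>)}"
proof -
  have "\<And>t. N t \<in> M \<rightarrow>\<^sub>M count_space UNIV" "\<And>t. S t \<in> M \<rightarrow>\<^sub>M count_space UNIV"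
    using ch by (auto simp: is_chain_def)
  note [measurable] = measurable_chain_path[of N M S, OF this]
  have "measure M {\<omega> \<in> space M. P (chain_path N S t \<omega>)} = measure (distr M (count_space UNIV) (chain_path N S t)) {h. P h}"
    by (subst measure_distr) (auto intro!: arg_cong[where f="measure M"])
  also have "\<dots> = model_prob \<mu> n t {\<omega>. P (model_path t \<omega>)}"
    unfolding chain_path_law[OF ch] map_model_path[OF n, symmetric] by (simp add: vimage_def)
  finally show ?thesis .
qed

section \<open>Rotations and counting of words\<close>

text \<open>The rotation starts where the centred partial sums attain their minimum.\<close>

lemma exists_rotation_prefix_sums_ge_mean:
  fixes f :: "'a \<Rightarrow> real"
  assumes "xs \<noteq> []"
  shows "\<exists>i<length xs. \<forall>j\<le>length xs.
     real j * sum_list (map f xs) / real (length xs) \<le> sum_list (map f (take j (rotate i xs)))"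
proof -
  define m where "m = length xs"
  define P where "P j = sum_list (map f (take j xs))" for j
  define c where "c = sum_list (map f xs) / real m"
  define D where "D j = P j - real j * c" for j
  have m: "0 < m" using assms by (simp add: m_def)
  have Pm: "P m = real m * c" using m by (simp add: P_def m_def c_def)
  obtain i where i: "i < m" and mini: "\<And>j. j < m \<Longrightarrow> D i \<le> D j"
    using ex_min_if_finite[of "D ` {..<m}"] m
    by (metis (no_types, lifting) arg_min_if_finite(1) arg_min_least finite_lessThan lessThan_iff empty_iff)
  have "D m = D 0" using Pm by (simp add: D_def P_def)
  then have min: "D i \<le> D j" if "j \<le> m" for j using mini m that by (cases "j = m") auto
  have rot: "rotate i xs = drop i xs @ take i xs" using i m by (simp add: rotate_drop_take m_def)
  have "real j * c \<le> sum_list (map f (take j (rotate i xs)))" if j: "j \<le> m" for j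
  proof (cases "j \<le> m - i")
    case True
    have "take (i + j) xs = take i xs @ take j (drop i xs)" by (simp add: take_add)
    then have "P (i + j) = P i + sum_list (map f (take j (rotate i xs)))"
      using True by (simp add: P_def rot m_def)
    moreover have "D i \<le> D (i + j)" using True i by (intro min) auto
    ultimately show ?thesis by (simp add: D_def algebra_simps)
  next
    case False
    \<comment> \<open>The rotated prefix wraps around the end of \<open>xs\<close> and reaches index
      \<open>l\<close>. A full turn contributes exactly the mean, \<open>P m = m c\<close>, so
      comparing \<open>D i\<close> with \<open>D l\<close> still suffices.\<close>
    define l where "l = i + j - m"
    have l: "real l = real i + real j - real m" using False i by (simp add: l_def of_nat_diff)
    have "take j (rotate i xs) = drop i xs @ take l xs"
      using False j i by (simp add: rot m_def l_def min_def add.commute)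
    moreover have "P m = P i + sum_list (map f (drop i xs))"
      unfolding P_def m_def by (metis append_take_drop_id map_append sum_list_append take_all_iff order_refl)
    ultimately have "sum_list (map f (take j (rotate i xs))) = P m - P i + P l"
      by (simp add: P_def)
    moreover have "D i \<le> D l" using j i by (intro min) (auto simp: l_def)
    ultimately show ?thesis by (simp add: D_def Pm l algebra_simps)
  qed
  then show ?thesis using i by (intro exI[of _ i]) (auto simp: m_def c_def)
qed

lemma inj_rotate: "inj (rotate i)"
  unfolding rotate_def by (rule inj_fn[OF inj_rotate1])

text \<open>Double counting: every element of \<open>W\<close> has a good rotation among
  \<open>m\<close> shifts, while a fixed shift is injective and preserves weights, so it accounts
  for at most the weight of the good elements.\<close>

lemma sum_le_rotations:
  fixes w :: "'a list \<Rightarrow> real"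
  assumes "finite W" "\<And>xs. 0 \<le> w xs" "\<And>xs i. w (rotate i xs) = w xs"
    and closed: "\<And>xs i. xs \<in> W \<Longrightarrow> rotate i xs \<in> W"
    and ex: "\<And>xs. xs \<in> W \<Longrightarrow> \<exists>i<m. rotate i xs \<in> G"
  shows "sum w W \<le> real m * sum w (W \<inter> G)"
proof -
  have "sum w W \<le> (\<Sum>xs\<in>W. \<Sum>i<m. if rotate i xs \<in> G then w xs else 0)"
  proof (rule sum_mono)
    fix xs assume "xs \<in> W"
    then obtain i where i: "i < m" "rotate i xs \<in> G" using ex by blast
    then have "w xs = (if rotate i xs \<in> G then w xs else 0)" by simp
    also have "\<dots> \<le> (\<Sum>i<m. if rotate i xs \<in> G then w xs else 0)"
      using i assms(2) by (intro member_le_sum) auto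
    finally show "w xs \<le> \<dots>" .
  qed
  also have "\<dots> = (\<Sum>i<m. \<Sum>xs\<in>W. if rotate i xs \<in> G then w xs else 0)" by (rule sum.swap)
  also have "\<dots> \<le> (\<Sum>i<m. sum w (W \<inter> G))"
  proof (rule sum_mono)
    fix i
    have "(\<Sum>xs\<in>W. if rotate i xs \<in> G then w xs else 0) = (\<Sum>xs\<in>{xs\<in>W. rotate i xs \<in> G}. w (rotate i xs))"
      by (simp add: sum.inter_filter assms)
    also have "\<dots> = sum w (rotate i ` {xs\<in>W. rotate i xs \<in> G})"
      by (subst sum.reindex) (auto intro: inj_on_subset[OF inj_rotate])
    also have "\<dots> \<le> sum w (W \<inter> G)"
      using assms by (intro sum_mono2) auto
    finally show "(\<Sum>xs\<in>W. if rotate i xs \<in> G then w xs else 0) \<le> sum w (W \<inter> G)" .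
  qed
  finally show ?thesis by simp
qed

text \<open>
  Apply the prefix sum lemma to the indicator of the first occurrences in the unrotated word:
  after a rotation they are still representatives of distinct letters.
\<close>

lemma exists_rotation_ndist_ge:
  assumes "xs \<noteq> []"
  shows "\<exists>i<length xs. \<forall>s<length xs.
     real (card (set xs)) * real (Suc s) / real (length xs) \<le> real (ndist (rotate i xs) s)"
proof -
  define m where "m = length xs"
  define First where "First = {p. p < m \<and> xs ! p \<notin> set (take p xs)}"
  define f :: "nat \<Rightarrow> real" where "f = indicator First"
  have inj: "inj_on (nth xs) First"
  proof (rule inj_onI)
    have *: False if "p \<in> First" "q \<in> First" "xs ! p = xs ! q" "p < q" for p q
      using that by (auto simp: First_def m_def in_set_conv_nth)
    fix p q assume "p \<in> First" "q \<in> First" "xs ! p = xs ! q"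
    then show "p = q" using *[of p q] *[of q p] by (metis nat_neq_iff)
  qed
  have img: "nth xs ` First = set xs"
  proof
    show "nth xs ` First \<subseteq> set xs" by (auto simp: First_def m_def)
    show "set xs \<subseteq> nth xs ` First"
    proof
      fix x assume "x \<in> set xs"
      then have ex: "\<exists>p. p < m \<and> xs ! p = x" by (auto simp: m_def in_set_conv_nth)
      define p where "p = (LEAST p. p < m \<and> xs ! p = x)"
      have p: "p < m \<and> xs ! p = x" unfolding p_def by (rule LeastI_ex[OF ex])
      have "xs ! p \<notin> set (take p xs)"
      proof
        assume "xs ! p \<in> set (take p xs)"
        then obtain q where "q < p" "xs ! q = x" using p by (auto simp: in_set_conv_nth)
        then have "p \<le> q" using p unfolding p_def by (intro Least_le) auto
        then show False using \<open>q < p\<close> by simp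
      qed
      then show "x \<in> nth xs ` First" using p by (auto simp: First_def)
    qed
  qed
  have cnt: "sum_list (map f zs) = real (card (set zs \<inter> First))" if "distinct zs" for zs
    using that by (simp add: sum_list_distinct_conv_sum_set f_def indicator_def sum.If_cases Int_def)
  have "set [0..<m] \<inter> First = First" by (auto simp: First_def)
  then have tot: "sum_list (map f [0..<m]) = real (card (set xs))"
    using card_image[OF inj] img by (simp only: cnt[OF distinct_upt])
  have "[0..<m] \<noteq> []" using assms by (auto simp: m_def)
  from exists_rotation_prefix_sums_ge_mean[OF this, of f] obtain i where i: "i < m" and
    le: "\<And>j. j \<le> m \<Longrightarrow> real j * real (card (set xs)) / real m \<le> sum_list (map f (take j (rotate i [0..<m])))"
    unfolding tot by auto
  have "real (card (set xs)) * real (Suc s) / real m \<le> real (ndist (rotate i xs) s)" if s: "s < m" for s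
  proof -
    define zs where "zs = take (Suc s) (rotate i [0..<m])"
    have dz: "distinct zs" by (simp add: zs_def)
    have "map (nth xs) zs = take (Suc s) (rotate i xs)"
      unfolding zs_def take_map[symmetric] rotate_map[symmetric] m_def map_nth ..
    then have "nth xs ` (set zs \<inter> First) \<subseteq> set (take (Suc s) (rotate i xs))"
      by (metis Int_lower1 image_mono set_map)
    then have "card (nth xs ` (set zs \<inter> First)) \<le> ndist (rotate i xs) s"
      unfolding ndist_def by (intro card_mono) auto
    then have "card (set zs \<inter> First) \<le> ndist (rotate i xs) s"
      by (subst (asm) card_image) (auto intro: inj_on_subset[OF inj])
    moreover have "real (Suc s) * real (card (set xs)) / real m \<le> real (card (set zs \<inter> First))"
      using le[of "Suc s"] s cnt[OF dz] by (simp add: zs_def)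
    ultimately show ?thesis by (simp add: mult.commute)
  qed
  then show ?thesis using i by (auto simp: m_def)
qed

section \<open>Words with a given number of distinct letters\<close>

definition words :: "nat \<Rightarrow> nat \<Rightarrow> nat \<Rightarrow> nat list set" where
  "words n m a = {xs. length xs = m \<and> set xs \<subseteq> {..<n} \<and> card (set xs) = a}"

lemma finite_words: "finite (words n m a)"
  unfolding words_def by (rule finite_subset[OF _ finite_lists_length_eq[of "{..<n}" m]]) auto

text \<open>Split by the first letter. If it recurs in the rest, there are \<open>Suc a\<close>
  choices for it; otherwise the rest has \<open>a\<close> distinct letters and \<open>n - a\<close>
  letters are left.\<close>

lemma card_words_Suc:
  "card (words n (Suc m) (Suc a)) = Suc a * card (words n m (Suc a)) + (n - a) * card (words n m a)"
proof -
  let ?A = "(\<lambda>(xs, x). x # xs) ` (SIGMA xs:words n m (Suc a). set xs)"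
  let ?B = "(\<lambda>(xs, x). x # xs) ` (SIGMA xs:words n m a. {..<n} - set xs)"
  have "words n (Suc m) (Suc a) = ?A \<union> ?B"
  proof (intro equalityI subsetI)
    fix ys assume ys: "ys \<in> words n (Suc m) (Suc a)"
    then obtain x xs where e: "ys = x # xs" by (cases ys) (auto simp: words_def)
    show "ys \<in> ?A \<union> ?B"
    proof (cases "x \<in> set xs")
      case True
      then have "(xs, x) \<in> (SIGMA xs:words n m (Suc a). set xs)" using ys by (auto simp: words_def e insert_absorb)
      then show ?thesis unfolding e by (intro UnI1 image_eqI[of _ _ "(xs, x)"]) auto
    next
      case False
      then have "(xs, x) \<in> (SIGMA xs:words n m a. {..<n} - set xs)" using ys by (auto simp: words_def e)
      then show ?thesis unfolding e by (intro UnI2 image_eqI[of _ _ "(xs, x)"]) auto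
    qed
  qed (auto simp: words_def insert_absorb)
  moreover have "?A \<inter> ?B = {}" by (auto simp: words_def)
  moreover have inj: "inj_on (\<lambda>(xs, x). x # xs) X" for X :: "('a list \<times> 'a) set"
    by (auto simp: inj_on_def)
  have "card ?A = Suc a * card (words n m (Suc a))"
    by (subst card_image[OF inj], subst card_SigmaI) (simp_all add: finite_words, simp add: words_def)
  moreover have "card ?B = (n - a) * card (words n m a)"
  proof -
    have "card ?B = (\<Sum>xs\<in>words n m a. card ({..<n} - set xs))"
      by (subst card_image[OF inj], subst card_SigmaI) (auto simp: finite_words)
    also have "\<dots> = (\<Sum>xs\<in>words n m a. n - a)"
      by (intro sum.cong refl) (auto simp: words_def card_Diff_subset)
    finally show ?thesis by simp
  qed
  moreover have "finite ?A" "finite ?B" by (auto simp: finite_words)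
  ultimately show ?thesis by (simp only: card_Un_disjoint)
qed

text \<open>The weights whose generating function is \<open>exp z - 1\<close>, so that \<open>m!\<close> times their convolution power counts surjections.\<close>

definition exp_wt :: "nat \<Rightarrow> real" where
  "exp_wt k = (if k = 0 then 0 else 1 / fact k)"

lemma exp_wt_nonneg: "0 \<le> exp_wt k" by (simp add: exp_wt_def)

lemma Abs_fps_exp_wt: "Abs_fps exp_wt = fps_exp 1 - 1"
  by (simp add: fps_eq_iff exp_wt_def)

text \<open>For f = exp z - 1 one has f' = f + 1, so the derivative of f^(a+1) is (a+1) (f^(a+1) +
  f^a). Compare the coefficients of z^m.\<close>

lemma cpow_exp_wt_rec:
  "real (Suc m) * cpow exp_wt (Suc a) (Suc m) = real (Suc a) * (cpow exp_wt (Suc a) m + cpow exp_wt a m)"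
proof -
  let ?f = "fps_exp (1::real) - 1"
  have "fps_deriv (?f ^ Suc a) = fps_const (real (Suc a)) * fps_deriv ?f * ?f ^ a"
    by (subst fps_deriv_power) simp
  also have "\<dots> = fps_const (real (Suc a)) * (?f ^ Suc a + ?f ^ a)"
    by (simp add: algebra_simps)
  finally have "fps_nth (fps_deriv (?f ^ Suc a)) m = fps_nth (fps_const (real (Suc a)) * (?f ^ Suc a + ?f ^ a)) m"
    by simp
  then show ?thesis
    unfolding cpow_def Abs_fps_exp_wt by (simp only: fps_deriv_nth fps_mult_left_const_nth fps_add_nth) simp
qed

text \<open>Choose the \<open>a\<close> letters, then a surjection of the \<open>m\<close> positions
  onto them. The proof matches the two recursions instead of exhibiting the surjections.\<close>

lemma card_words:
  "real (card (words n m a)) = real (n choose a) * fact m * cpow exp_wt a m"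
proof (induction m arbitrary: a)
  case 0
  have "words n 0 a = (if a = 0 then {[]} else {})" by (auto simp: words_def)
  moreover have "cpow exp_wt a 0 = (if a = 0 then 1 else 0)"
    by (cases a) (auto simp: cpow_0 cpow_Suc exp_wt_def)
  ultimately show ?case by simp
next
  case (Suc m)
  show ?case
  proof (cases a)
    case 0
    then have "words n (Suc m) a = {}" by (auto simp: words_def length_Suc_conv)
    then show ?thesis using 0 by (simp add: cpow_0)
  next
    case (Suc b)
    have ch: "real (n - b) * real (n choose b) = real (Suc b) * real (n choose Suc b)"
      by (metis Suc_times_binomial_add binomial_absorb_comp mult.commute of_nat_mult binomial_absorption diff_Suc_Suc)
    have "real (card (words n (Suc m) (Suc b))) =
       real (Suc b) * (real (n choose Suc b) * fact m * cpow exp_wt (Suc b) m)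
       + (real (n - b) * real (n choose b)) * fact m * cpow exp_wt b m"
      by (simp only: card_words_Suc of_nat_add of_nat_mult Suc.IH mult.assoc)
    also have "\<dots> = real (n choose Suc b) * fact m * (real (Suc m) * cpow exp_wt (Suc b) (Suc m))"
      unfolding ch cpow_exp_wt_rec by (simp add: algebra_simps)
    finally show ?thesis by (simp add: \<open>a = Suc b\<close>)
  qed
qed

section \<open>Probability of absorption at a given time and height\<close>

lemma finite_lists_sum_eq: "finite {ks::nat list. length ks = a \<and> sum_list ks = t}"
  by (rule finite_subset[OF _ finite_lists_length_eq[of "{..t}" a]])
    (auto intro: member_le_sum_list)

definition absorbed_at :: "nat \<Rightarrow> nat \<Rightarrow> (nat list \<times> nat list) set" where
  "absorbed_at t a = {\<omega>. chain_state t \<omega> = (a, 0) \<and> (\<forall>i<t. 0 < snd (chain_state i \<omega>))}"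

lemma prob_model_Times:
  assumes n: "n \<ge> 1" and "A \<subseteq> words n (Suc t) a" "B \<subseteq> {ks. length ks = a \<and> sum_list ks = t}"
  shows "model_prob \<mu> n t (A \<times> B) =
    real (card A) / real n ^ Suc t * (\<Sum>ks\<in>B. prod_list (map (pmf \<mu>) ks))"
proof -
  have fin: "finite A" "finite B"
    using assms finite_words finite_lists_sum_eq finite_subset by metis+
  have "model_prob \<mu> n t (A \<times> B) = (\<Sum>(xs, ks)\<in>A \<times> B. pmf (model \<mu> n (Suc t)) (xs, ks))"
    using fin by (subst measure_measure_pmf_finite) auto
  also have "\<dots> = (\<Sum>(xs, ks)\<in>A \<times> B. (1 / real n) ^ Suc t * prod_list (map (pmf \<mu>) ks))"
    using assms by (intro sum.cong refl) (auto simp: words_def intro!: pmf_model simp del: power_Suc model.simps)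
  also have "\<dots> = (\<Sum>xs\<in>A. \<Sum>ks\<in>B. (1 / real n) ^ Suc t * prod_list (map (pmf \<mu>) ks))"
    by (rule sum.cartesian_product[symmetric])
  also have "\<dots> = real (card A) / real n ^ Suc t * (\<Sum>ks\<in>B. prod_list (map (pmf \<mu>) ks))"
    unfolding sum_distrib_left[symmetric] by (simp add: power_one_over)
  finally show ?thesis .
qed

lemma prob_absorbed_at_le:
  assumes n: "n \<ge> 1"
  shows "model_prob \<mu> n t (absorbed_at t a) \<le>
    real (card (words n (Suc t) a)) / real n ^ Suc t * cpow (pmf \<mu>) a t"
proof -
  have "model_prob \<mu> n t (absorbed_at t a)
    = model_prob \<mu> n t (absorbed_at t a \<inter> set_pmf (model \<mu> n (Suc t)))"
    by (rule measure_Int_set_pmf[symmetric])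
  also have "\<dots> \<le> model_prob \<mu> n t (words n (Suc t) a \<times> {ks. length ks = a \<and> sum_list ks = t})"
  proof (intro measure_pmf.finite_measure_mono subsetI)
    fix \<omega> assume w: "\<omega> \<in> absorbed_at t a \<inter> set_pmf (model \<mu> n (Suc t))"
    then have s: "length (fst \<omega>) = Suc t" "set (fst \<omega>) \<subseteq> {..<n}" "length (snd \<omega>) = card (set (fst \<omega>))"
      using set_pmf_model[OF n] by blast+
    from w have st: "chain_state t \<omega> = (a, 0)" and al: "\<forall>i<t. 0 < snd (chain_state i \<omega>)" by (auto simp: absorbed_at_def)
    have "\<forall>j<t. j < supplied \<omega> j" using al chain_state_pos_iff[OF s(3)] s(1) by auto
    from chain_state_alive[OF s(3) _ this] st s(1)
    have "ndist (fst \<omega>) t = a" "supplied \<omega> t = t" by auto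
    then show "\<omega> \<in> words n (Suc t) a \<times> {ks. length ks = a \<and> sum_list ks = t}"
      using s by (auto simp: words_def ndist_def supplied_def mem_Times_iff)
  qed auto
  also have "\<dots> = real (card (words n (Suc t) a)) / real n ^ Suc t * cpow (pmf \<mu>) a t"
    unfolding cpow_lists by (rule prob_model_Times[OF n]) auto
  finally show ?thesis .
qed

text \<open>After a suitable rotation, letters appear at least at the rate
  \<open>a / (t + 1)\<close>; after an independent one, partial sums of the values grow at least at
  the rate \<open>t / a\<close>. Together the supply at time \<open>j\<close> is at least
  \<open>(j + 1) t / (t + 1)\<close>.\<close>

lemma prob_absorbed_at_ge:
  assumes n: "n \<ge> 1" and a: "a \<ge> 1"
  shows "real (card (words n (Suc t) a)) / real n ^ Suc t * cpow (pmf \<mu>) a t / (real a * real (Suc t)) \<le>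
    model_prob \<mu> n t (absorbed_at t a)"
proof -
  define W where "W = words n (Suc t) a"
  define K where "K = {ks. length ks = a \<and> sum_list ks = t}"
  define GW where "GW = {xs. \<forall>s<length xs. real a * real (Suc s) / real (Suc t) \<le> real (ndist xs s)}"
  define GK where "GK = {ks. \<forall>j\<le>a. real j * real t / real a \<le> real (sum_list (take j ks))}"
  have cW: "real (card W) \<le> real (Suc t) * real (card (W \<inter> GW))"
  proof -
    have "(\<Sum>xs\<in>W. 1) \<le> real (Suc t) * (\<Sum>xs\<in>W \<inter> GW. 1)"
    proof (rule sum_le_rotations)
      show "finite W" by (simp add: W_def finite_words)
      fix xs i assume "xs \<in> W" then show "rotate i xs \<in> W" by (simp add: W_def words_def)
    next
      fix xs assume xs: "xs \<in> W"
      then have "xs \<noteq> []" by (auto simp: W_def words_def)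
      from exists_rotation_ndist_ge[OF this] xs
      show "\<exists>i<Suc t. rotate i xs \<in> GW" by (auto simp: W_def words_def GW_def)
    qed auto
    then show ?thesis by simp
  qed
  have fK: "finite K" unfolding K_def by (rule finite_lists_sum_eq)
  have cK: "cpow (pmf \<mu>) a t \<le> real a * (\<Sum>ks\<in>K \<inter> GK. prod_list (map (pmf \<mu>) ks))"
    unfolding cpow_lists K_def[symmetric]
  proof (rule sum_le_rotations[OF fK])
    have mset_rot: "mset (rotate i xs) = mset xs" for i and xs :: "nat list"
    proof (induction i)
      case (Suc i)
      have "mset (rotate1 ys) = mset ys" for ys :: "nat list" by (cases ys) auto
      then show ?case using Suc by simp
    qed simp
    show "0 \<le> prod_list (map (pmf \<mu>) ks)" for ks by (induction ks) auto
    show "prod_list (map (pmf \<mu>) (rotate i ks)) = prod_list (map (pmf \<mu>) ks)" for ks i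
      by (metis mset_rot mset_map prod_mset_prod_list)
    show "rotate i ks \<in> K" if "ks \<in> K" for ks i
      using that mset_rot[of i ks] by (auto simp: K_def sum_mset_sum_list[symmetric])
    fix ks assume ks: "ks \<in> K"
    then have "ks \<noteq> []" using a by (auto simp: K_def)
    from exists_rotation_prefix_sums_ge_mean[OF this, of real] ks
    have "\<exists>i<a. \<forall>j\<le>a. real j * real t / real a \<le> sum_list (map real (take j (rotate i ks)))"
      by (auto simp: K_def sum_list_of_nat[symmetric])
    then show "\<exists>i<a. rotate i ks \<in> GK" by (auto simp: GK_def sum_list_of_nat)
  qed
  have sub: "(W \<inter> GW) \<times> (K \<inter> GK) \<subseteq> absorbed_at t a"
  proof (rule subsetI, unfold mem_Times_iff, elim conjE)
    fix \<omega> assume x: "fst \<omega> \<in> W \<inter> GW" and k: "snd \<omega> \<in> K \<inter> GK"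
    have l: "length (snd \<omega>) = card (set (fst \<omega>))" "length (fst \<omega>) = Suc t"
      and c: "card (set (fst \<omega>)) = a" and s: "sum_list (snd \<omega>) = t"
      using x k by (auto simp: W_def words_def K_def)
    have al: "j < supplied \<omega> j" if j: "j < t" for j
    proof -
      have nd: "ndist (fst \<omega>) j \<le> a" using ndist_le c by metis
      \<comment> \<open>This is where the extra letter at time 0 pays: the inequality amounts to
        \<open>j < t\<close>, so the supply strictly exceeds the elapsed time before
        \<open>t\<close>.\<close>
      have "real j < real (Suc j) * real t / real (Suc t)" using j by (simp add: field_simps)
      also have "\<dots> = (real a * real (Suc j) / real (Suc t)) * real t / real a" using a by simp
      also have "\<dots> \<le> real (ndist (fst \<omega>) j) * real t / real a"
        using x j l by (intro divide_right_mono mult_right_mono) (auto simp: GW_def)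
      also have "\<dots> \<le> real (supplied \<omega> j)" using k nd by (auto simp: GK_def supplied_def)
      finally show ?thesis by simp
    qed
    have "chain_state t \<omega> = (ndist (fst \<omega>) t, supplied \<omega> t - t)"
      using chain_state_alive[OF l(1), of t] al l by auto
    moreover have "ndist (fst \<omega>) t = a" using l c by (simp add: ndist_def)
    ultimately have "chain_state t \<omega> = (a, 0)" using l s c by (simp add: supplied_def)
    moreover have "0 < snd (chain_state i \<omega>)" if "i < t" for i
      using chain_state_pos_iff[OF l(1), of i] al l that by auto
    ultimately show "\<omega> \<in> absorbed_at t a" by (simp add: absorbed_at_def)
  qed
  have "real (card W) * cpow (pmf \<mu>) a t \<le> (real (Suc t) * real (card (W \<inter> GW))) * (real a * (\<Sum>ks\<in>K \<inter> GK. prod_list (map (pmf \<mu>) ks)))"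
    by (intro mult_mono cW cK cpow_nonneg) auto
  then have "real (card W) / real n ^ Suc t * cpow (pmf \<mu>) a t / (real a * real (Suc t)) \<le>
     real (card (W \<inter> GW)) / real n ^ Suc t * (\<Sum>ks\<in>K \<inter> GK. prod_list (map (pmf \<mu>) ks))"
  proof -
    have "X / p * C / (r * q) \<le> Y / p * S" if "X * C \<le> (q * Y) * (r * S)" "0 < p" "0 < q" "0 < r" for X C p q r Y S :: real
    proof -
      have "X * C / (p * (r * q)) \<le> (q * Y) * (r * S) / (p * (r * q))"
        using that by (intro divide_right_mono) auto
      then show ?thesis using that by (simp add: field_simps)
    qed
    moreover have "0 < real n ^ Suc t" "0 < real (Suc t)" "0 < real a" using n a by simp_all
    ultimately show "?thesis" if "real (card W) * cpow (pmf \<mu>) a t \<le> (real (Suc t) * real (card (W \<inter> GW))) * (real a * (\<Sum>ks\<in>K \<inter> GK. prod_list (map (pmf \<mu>) ks)))"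
      using that by blast
  qed
  also have "\<dots> = model_prob \<mu> n t ((W \<inter> GW) \<times> (K \<inter> GK))"
    by (rule prob_model_Times[OF n, symmetric]) (auto simp: W_def K_def)
  also have "\<dots> \<le> model_prob \<mu> n t (absorbed_at t a)"
    by (rule measure_pmf.finite_measure_mono[OF sub]) simp
  finally show ?thesis by (simp add: W_def)
qed

section \<open>Survival probability\<close>

text \<open>The integrand is a martingale started at 1: a repeated letter leaves it unchanged, a new
  one multiplies it by \<open>z ^ K / M\<close>, which has mean one.\<close>

lemma nn_integral_model:
  assumes n: "n \<ge> 1" and z: "0 < z" and M: "0 < M" "(\<integral>\<^sup>+k. ennreal (z ^ k) \<partial>measure_pmf \<mu>) = ennreal M"
  shows "(\<integral>\<^sup>+\<omega>. ennreal (z ^ sum_list (snd \<omega>) / M ^ length (snd \<omega>)) \<partial>measure_pmf (model \<mu> n m)) = 1"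
proof (induction m)
  case (Suc m)
  have ne: "{..<n} \<noteq> {}" using n by (auto simp: lessThan_empty_iff)
  have st: "(\<integral>\<^sup>+\<omega>. ennreal (z ^ sum_list (snd \<omega>) / M ^ length (snd \<omega>)) \<partial>measure_pmf (model_step \<mu> n \<omega>'))
      = ennreal (z ^ sum_list (snd \<omega>') / M ^ length (snd \<omega>'))" for \<omega>'
  proof -
    obtain xs ks where w: "\<omega>' = (xs, ks)" by (cases \<omega>')
    have "(\<integral>\<^sup>+k. ennreal (z ^ sum_list (ks @ [k]) / M ^ length (ks @ [k])) \<partial>measure_pmf \<mu>)
       = (\<integral>\<^sup>+k. ennreal (z ^ sum_list ks / (M * M ^ length ks)) * ennreal (z ^ k) \<partial>measure_pmf \<mu>)"
      using z M by (intro nn_integral_cong) (simp add: ennreal_mult'[symmetric] power_add)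
    also have "\<dots> = ennreal (z ^ sum_list ks / (M * M ^ length ks)) * ennreal M"
      by (subst nn_integral_cmult) (auto simp: M)
    also have "\<dots> = ennreal (z ^ sum_list ks / M ^ length ks)"
      using z M by (simp add: ennreal_mult'[symmetric])
    finally have "(\<integral>\<^sup>+\<omega>. ennreal (z ^ sum_list (snd \<omega>) / M ^ length (snd \<omega>)) \<partial>measure_pmf (model_step \<mu> n \<omega>'))
      = (\<integral>\<^sup>+x. ennreal (z ^ sum_list ks / M ^ length ks) \<partial>measure_pmf (pmf_of_set {..<n}))"
      unfolding model_step_def w prod.case nn_integral_bind_pmf
      by (intro nn_integral_cong) simp
    then show ?thesis by (simp add: w)
  qed
  show ?case using Suc by (simp add: nn_integral_bind_pmf st)
qed simp

text \<open>Survival at time \<open>t\<close> forces the values to sum to more than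
  \<open>t\<close>, and there are at most \<open>n\<close> of them. Since \<open>M \<ge> 1\<close>,
  the martingale above is then at least \<open>z ^ t / M ^ n\<close>, and Markov's inequality
  applies.\<close>

lemma prob_alive_le:
  assumes n: "n \<ge> 1" and z: "1 \<le> z" and M: "(\<integral>\<^sup>+k. ennreal (z ^ k) \<partial>measure_pmf \<mu>) = ennreal M"
  shows "model_prob \<mu> n t {\<omega>. 0 < snd (chain_state t \<omega>)} \<le> M ^ n / z ^ t"
proof -
  have "1 = (\<integral>\<^sup>+k. 1 \<partial>measure_pmf \<mu>)" by simp
  also have "\<dots> \<le> ennreal M" unfolding M[symmetric] using z by (intro nn_integral_mono) simp
  finally have M1: "1 \<le> M" by simp
  have "emeasure (measure_pmf (model \<mu> n (Suc t))) {\<omega>. 0 < snd (chain_state t \<omega>)}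
    = (\<integral>\<^sup>+\<omega>. indicator {\<omega>. 0 < snd (chain_state t \<omega>)} \<omega> \<partial>measure_pmf (model \<mu> n (Suc t)))" by simp
  also have "\<dots> \<le> (\<integral>\<^sup>+\<omega>. ennreal (M ^ n / z ^ t) * ennreal (z ^ sum_list (snd \<omega>) / M ^ length (snd \<omega>)) \<partial>measure_pmf (model \<mu> n (Suc t)))"
  proof (intro nn_integral_mono_AE AE_pmfI)
    fix \<omega> assume "\<omega> \<in> set_pmf (model \<mu> n (Suc t))"
    note s = set_pmf_model[OF n this]
    show "indicator {\<omega>. 0 < snd (chain_state t \<omega>)} \<omega> \<le> ennreal (M ^ n / z ^ t) * ennreal (z ^ sum_list (snd \<omega>) / M ^ length (snd \<omega>))"
    proof (cases "0 < snd (chain_state t \<omega>)")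
      case True
      then have "t < supplied \<omega> t" using chain_state_pos_iff[of \<omega> t] s by auto
      also have "supplied \<omega> t = sum_list (snd \<omega>)" using s by (simp add: supplied_def ndist_def)
      finally have "z ^ t \<le> z ^ sum_list (snd \<omega>)" using z by (intro power_increasing) auto
      moreover have "length (snd \<omega>) \<le> n" using s card_mono[of "{..<n}" "set (fst \<omega>)"] by auto
      then have "M ^ length (snd \<omega>) \<le> M ^ n" using M1 by (intro power_increasing) auto
      ultimately have "z ^ t * M ^ length (snd \<omega>) \<le> z ^ sum_list (snd \<omega>) * M ^ n"
        using z M1 by (intro mult_mono) auto
      then have "1 \<le> (M ^ n / z ^ t) * (z ^ sum_list (snd \<omega>) / M ^ length (snd \<omega>))"
        using z M1 by (simp add: field_simps)
      then show ?thesis using True z M1 by (simp add: ennreal_mult'[symmetric])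
    qed simp
  qed
  also have "\<dots> = ennreal (M ^ n / z ^ t)"
    by (subst nn_integral_cmult, simp, subst nn_integral_model[OF n _ _ M]) (use z M1 in auto)
  finally show ?thesis using M1 z by (simp add: measure_pmf.emeasure_eq_measure)
qed

section \<open>Lower bounds for coefficients of large powers\<close>

text \<open>
  Truncating the weights makes the generating function entire, so that below an interior maximiser exists
  and is a critical point; without truncation the supremum may be attained at the boundary
  of the domain of convergence with a nonzero derivative.
\<close>

lemma truncated_rate_le:
  fixes u c :: real
  assumes w: "\<And>k. 0 \<le> w k" and k1: "real k1 < u" "0 < w k1" and k2: "u < real k2" "0 < w k2"
    and c: "\<And>\<alpha>. summable (\<lambda>k. w k * exp \<alpha> ^ k) \<Longrightarrow> \<alpha> * u - ln (\<Sum>k. w k * exp \<alpha> ^ k) \<le> c"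
    and e: "0 < e"
  shows "\<exists>M \<eta>. 0 < \<eta> \<and> k1 \<le> M \<and> k2 \<le> M \<and>
     (\<forall>v \<alpha>. \<bar>v - u\<bar> < \<eta> \<longrightarrow> \<alpha> * v - ln (\<Sum>k\<le>M. w k * exp \<alpha> ^ k) \<le> c + e)"
proof (rule ccontr)
  assume neg: "\<not> ?thesis"
  define f where "f M \<alpha> = (\<Sum>k\<le>M. w k * exp \<alpha> ^ k)" for M and \<alpha> :: real
  define m where "m = max k1 k2"
  \<comment> \<open>The first term forces \<open>v j\<close> to converge to \<open>u\<close>; the
    other two keep \<open>v j\<close> away from \<open>k1\<close> and \<open>k2\<close>, which
    bounds the parameters \<open>\<alpha> j\<close>.\<close>
  define \<eta> where "\<eta> j = min (1 / real (Suc j)) (min ((u - k1) / 2) ((k2 - u) / 2))" for j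
  have \<eta>0: "0 < \<eta> j" for j using k1 k2 by (simp add: \<eta>_def)
  have "\<forall>j. \<exists>v \<alpha>. \<bar>v - u\<bar> < \<eta> j \<and> c + e < \<alpha> * v - ln (f (m + j) \<alpha>)"
  proof (rule allI, rule ccontr)
    fix j
    assume "\<not> (\<exists>v \<alpha>. \<bar>v - u\<bar> < \<eta> j \<and> c + e < \<alpha> * v - ln (f (m + j) \<alpha>))"
    then have "0 < \<eta> j \<and> k1 \<le> m + j \<and> k2 \<le> m + j \<and>
       (\<forall>v \<alpha>. \<bar>v - u\<bar> < \<eta> j \<longrightarrow> \<alpha> * v - ln (\<Sum>k\<le>m + j. w k * exp \<alpha> ^ k) \<le> c + e)"
    proof (intro conjI allI impI)
      fix v \<alpha> assume "\<not> (\<exists>v \<alpha>. \<bar>v - u\<bar> < \<eta> j \<and> c + e < \<alpha> * v - ln (f (m + j) \<alpha>))" "\<bar>v - u\<bar> < \<eta> j"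
      then have "\<not> c + e < \<alpha> * v - ln (f (m + j) \<alpha>)" by blast
      then show "\<alpha> * v - ln (\<Sum>k\<le>m + j. w k * exp \<alpha> ^ k) \<le> c + e" by (simp add: f_def not_less)
    qed (use \<eta>0 in \<open>auto simp: m_def\<close>)
    with neg show False by blast
  qed
  then obtain v \<alpha> where v: "\<And>j. \<bar>v j - u\<bar> < \<eta> j" and \<alpha>: "\<And>j. c + e < \<alpha> j * v j - ln (f (m + j) (\<alpha> j))"
    by metis
  have fge: "w k * exp \<alpha> ^ k \<le> f M \<alpha>" if "k \<le> M" for k M \<alpha>
    unfolding f_def using w that by (intro member_le_sum) auto
  have fpos: "0 < f M \<alpha>" if "k1 \<le> M" for M \<alpha>
    using fge[OF that, of \<alpha>] k1(2) by (smt (verit) exp_gt_zero mult_pos_pos zero_less_power)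
  have fmono: "f M \<alpha> \<le> f M' \<alpha>" if "M \<le> M'" for M M' \<alpha>
    unfolding f_def using w that by (intro sum_mono2) auto
  have lnf: "ln (w k) + \<alpha> * real k \<le> ln (f M \<alpha>)" if "k \<le> M" "0 < w k" for k M \<alpha>
  proof -
    have "ln (w k) + \<alpha> * real k = ln (w k * exp \<alpha> ^ k)"
      using that by (simp add: ln_mult ln_realpow mult.commute)
    also have "\<dots> \<le> ln (f M \<alpha>)" using fge[OF that(1), of \<alpha>] that(2)
      by (smt (verit) exp_gt_zero ln_mono mult_pos_pos zero_less_power)
    finally show ?thesis .
  qed
  \<comment> \<open>The atoms at \<open>k1 < u < k2\<close> make the exponent decrease at least
    linearly in both directions, so parameters whose value exceeds \<open>c + e\<close> stay in
    [-A, A].\<close>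
  define A where "A = max (2 * \<bar>c + e + ln (w k2)\<bar> / (k2 - u)) (2 * \<bar>c + e + ln (w k1)\<bar> / (u - k1))"
  have \<eta>v: "\<bar>v j - u\<bar> < (u - k1) / 2" "\<bar>v j - u\<bar> < (k2 - u) / 2" for j
    using v[of j] by (simp_all add: \<eta>_def)
  have mk: "k1 \<le> m + j" "k2 \<le> m + j" for j by (simp_all add: m_def)
  have bnd: "\<bar>\<alpha> j\<bar> \<le> A" for j
  proof (cases "0 \<le> \<alpha> j")
    case True
    have "c + e < \<alpha> j * v j - (ln (w k2) + \<alpha> j * real k2)"
      using \<alpha>[of j] lnf[of k2 "m + j" "\<alpha> j", OF mk(2) k2(2)] by linarith
    moreover have "v j \<le> u + (k2 - u) / 2" using \<eta>v(2)[of j] by linarith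
    then have "\<alpha> j * v j \<le> \<alpha> j * (u + (k2 - u) / 2)" using True by (intro mult_left_mono)
    moreover have "\<alpha> j * (u + (k2 - u) / 2) = \<alpha> j * k2 - \<alpha> j * ((k2 - u) / 2)" by (simp add: field_simps)
    ultimately have "\<alpha> j * ((k2 - u) / 2) \<le> \<bar>c + e + ln (w k2)\<bar>" by linarith
    then have "\<alpha> j \<le> 2 * \<bar>c + e + ln (w k2)\<bar> / (k2 - u)" using k2 by (simp add: field_simps)
    then show ?thesis using True by (simp add: A_def)
  next
    case False
    have "c + e < \<alpha> j * v j - (ln (w k1) + \<alpha> j * real k1)"
      using \<alpha>[of j] lnf[of k1 "m + j" "\<alpha> j", OF mk(1) k1(2)] by linarith
    moreover have "u - (u - k1) / 2 \<le> v j" using \<eta>v(1)[of j] by linarith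
    then have "\<alpha> j * v j \<le> \<alpha> j * (u - (u - k1) / 2)" using False by (intro mult_left_mono_neg) auto
    moreover have "\<alpha> j * (u - (u - k1) / 2) = \<alpha> j * k1 - (- \<alpha> j * ((u - k1) / 2))" by (simp add: field_simps)
    ultimately have "- \<alpha> j * ((u - k1) / 2) \<le> \<bar>c + e + ln (w k1)\<bar>" by linarith
    then have "- \<alpha> j \<le> 2 * \<bar>c + e + ln (w k1)\<bar> / (u - k1)" using k1 by (simp add: field_simps)
    then show ?thesis using False by (simp add: A_def)
  qed
  have sc: "seq_compact {-A..A}" by (simp add: compact_imp_seq_compact)
  have "\<forall>j. \<alpha> j \<in> {-A..A}" using bnd by (simp add: abs_le_iff minus_le_iff)
  then obtain a r where r: "strict_mono r" and lim: "(\<alpha> \<circ> r) \<longlonglongrightarrow> a"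
    using seq_compactE[OF sc, of \<alpha>] by metis
  have "v \<longlonglongrightarrow> u"
  proof (rule LIM_zero_cancel, rule Lim_null_comparison)
    show "\<forall>\<^sub>F j in sequentially. norm (v j - u) \<le> 1 / real (Suc j)"
      using v by (auto simp: \<eta>_def intro!: always_eventually less_imp_le)
    show "(\<lambda>j. 1 / real (Suc j)) \<longlonglongrightarrow> 0" by (rule LIMSEQ_Suc[OF lim_1_over_n])
  qed
  then have limv: "(v \<circ> r) \<longlonglongrightarrow> u" using r by (rule LIMSEQ_subseq_LIMSEQ)
  \<comment> \<open>The limit point \<open>a\<close> does not depend on the truncation: for every
    \<open>M\<close>, later members of the subsequence use longer truncations. A bound uniform in
    \<open>M\<close> makes the full series converge at \<open>a\<close>, where it then contradicts
    \<open>c\<close>.\<close>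
  have bound: "f M a \<le> exp (a * u - c - e)" for M
  proof -
    have "c + e \<le> a * u - ln (f (max M k1) a)"
    proof (rule tendsto_lowerbound)
      have "isCont (\<lambda>x. ln (f (max M k1) x)) a"
        unfolding f_def using fpos[of "max M k1" a] by (intro continuous_intros) (auto simp: f_def)
      then have "(\<lambda>j. ln (f (max M k1) ((\<alpha> \<circ> r) j))) \<longlonglongrightarrow> ln (f (max M k1) a)"
        using lim by (rule isCont_tendsto_compose)
      from tendsto_diff[OF tendsto_mult[OF lim limv] this]
      show "(\<lambda>j. (\<alpha> \<circ> r) j * (v \<circ> r) j - ln (f (max M k1) ((\<alpha> \<circ> r) j))) \<longlonglongrightarrow> a * u - ln (f (max M k1) a)" .
      show "\<forall>\<^sub>F j in sequentially. c + e \<le> (\<alpha> \<circ> r) j * (v \<circ> r) j - ln (f (max M k1) ((\<alpha> \<circ> r) j))"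
      proof (rule eventually_sequentiallyI)
        fix j assume "max M k1 \<le> j"
        also have "j \<le> r j" using r by (rule seq_suble)
        finally have "f (max M k1) (\<alpha> (r j)) \<le> f (m + r j) (\<alpha> (r j))" by (intro fmono) simp
        then have "ln (f (max M k1) (\<alpha> (r j))) \<le> ln (f (m + r j) (\<alpha> (r j)))"
          using fpos[of "max M k1" "\<alpha> (r j)"] by (simp add: ln_mono)
        then show "c + e \<le> (\<alpha> \<circ> r) j * (v \<circ> r) j - ln (f (max M k1) ((\<alpha> \<circ> r) j))"
          using \<alpha>[of "r j"] by simp
      qed
    qed simp
    then have "exp (ln (f (max M k1) a)) \<le> exp (a * u - c - e)" by simp
    then have "f (max M k1) a \<le> exp (a * u - c - e)" using fpos[of "max M k1" a] by simp
    then show ?thesis using fmono[of M "max M k1" a] by simp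
  qed
  have summ: "summable (\<lambda>k. w k * exp a ^ k)"
  proof (rule summableI_nonneg_bounded)
    show "(\<Sum>i<n. w i * exp a ^ i) \<le> exp (a * u - c - e)" for n
    proof -
      have "(\<Sum>i<n. w i * exp a ^ i) \<le> f n a" unfolding f_def using w by (intro sum_mono2) auto
      then show ?thesis using bound[of n] by simp
    qed
  qed (use w in auto)
  have le: "(\<Sum>k. w k * exp a ^ k) \<le> exp (a * u - c - e)"
  proof (rule suminf_le_const[OF summ])
    fix n
    have "(\<Sum>i<n. w i * exp a ^ i) \<le> f n a" unfolding f_def using w by (intro sum_mono2) auto
    then show "(\<Sum>i<n. w i * exp a ^ i) \<le> exp (a * u - c - e)" using bound[of n] by simp
  qed
  have "f k1 a \<le> (\<Sum>k. w k * exp a ^ k)"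
    unfolding f_def using w by (intro sum_le_suminf summ) auto
  then have "0 < (\<Sum>k. w k * exp a ^ k)" using fpos[of k1 a] by simp
  then have "ln (\<Sum>k. w k * exp a ^ k) \<le> a * u - c - e" using le by (metis ln_exp ln_mono)
  then show False using c[OF summ] e by simp
qed

text \<open>Tilt the weights by the maximiser \<open>s\<close> of \<open>g\<close>, so that their
  mean becomes \<open>v\<close>. Chernoff bounds at \<open>s + h\<close> and \<open>s - h\<close>
  show that at most half of the tilted mass lies off the window around \<open>a v\<close>. The
  window has at most \<open>a M + 1\<close> points, so one coefficient in it is large.\<close>

lemma cpow_ge_near_mean:
  fixes v c :: real
  assumes w: "\<And>k. 0 \<le> w k" and k1: "real k1 < v" "0 < w k1" and k2: "v < real k2" "0 < w k2"
    and M: "k1 \<le> M" "k2 \<le> M"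
    and c: "\<And>\<alpha>. \<alpha> * v - ln (\<Sum>k\<le>M. w k * exp \<alpha> ^ k) \<le> c"
    and e: "0 < e" and d: "0 < d"
  shows "\<exists>a t. 1 \<le> a \<and> \<bar>real t / real a - v\<bar> < d \<and> exp (- (real a * (c + e))) \<le> cpow w a t"
proof -
  define f where "f \<alpha> = (\<Sum>k\<le>M. w k * exp \<alpha> ^ k)" for \<alpha> :: real
  define g where "g \<alpha> = \<alpha> * v - ln (f \<alpha>)" for \<alpha>
  have fge: "w k * exp \<alpha> ^ k \<le> f \<alpha>" if "k \<le> M" for k \<alpha>
    unfolding f_def using w that by (intro member_le_sum) auto
  have fpos: "0 < f \<alpha>" for \<alpha>
    using fge[OF M(1), of \<alpha>] k1(2) by (smt (verit) exp_gt_zero mult_pos_pos zero_less_power)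
  have gle: "g \<alpha> \<le> \<alpha> * (v - real k) - ln (w k)" if "k \<le> M" "0 < w k" for k \<alpha>
  proof -
    have "ln (w k) + \<alpha> * real k = ln (w k * exp \<alpha> ^ k)"
      using that by (simp add: ln_mult ln_realpow mult.commute)
    also have "\<dots> \<le> ln (f \<alpha>)" using fge[OF that(1), of \<alpha>] that(2)
      by (smt (verit) exp_gt_zero ln_mono mult_pos_pos zero_less_power)
    finally show ?thesis by (simp add: g_def algebra_simps)
  qed
  have contg: "isCont g \<alpha>" for \<alpha>
    unfolding g_def f_def using fpos[of \<alpha>] by (intro continuous_intros) (auto simp: f_def)
  \<comment> \<open>Outside [-A, A] one of the two atoms pushes \<open>g\<close> below
    \<open>g 0\<close>, so the maximum over this interval is global.\<close>
  define A where "A = max (\<bar>g 0 + ln (w k2)\<bar> / (k2 - v)) (\<bar>g 0 + ln (w k1)\<bar> / (v - k1))"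
  have A0: "0 \<le> A" using k1 k2 by (simp add: A_def le_max_iff_disj)
  obtain s where s: "s \<in> {-A..A}" "\<And>y. y \<in> {-A..A} \<Longrightarrow> g y \<le> g s"
  proof -
    have "continuous_on {-A..A} g" using contg by (intro continuous_at_imp_continuous_on) auto
    then have "\<exists>s\<in>{-A..A}. \<forall>y\<in>{-A..A}. g y \<le> g s" using A0 by (intro continuous_attains_sup) auto
    then show ?thesis using that by blast
  qed
  have smax: "g y \<le> g s" for y
  proof (cases "y \<in> {-A..A}")
    case False
    then consider "A < y" | "y < -A" by fastforce
    then have "g y \<le> g 0"
    proof cases
      case 1
      then have "\<bar>g 0 + ln (w k2)\<bar> / (k2 - v) \<le> y" by (simp add: A_def)
      then have "\<bar>g 0 + ln (w k2)\<bar> \<le> y * (k2 - v)" using k2 by (simp add: field_simps)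
      then show ?thesis using gle[OF M(2) k2(2), of y] by (simp add: algebra_simps)
    next
      case 2
      then have "\<bar>g 0 + ln (w k1)\<bar> / (v - k1) \<le> - y" by (simp add: A_def)
      then have "\<bar>g 0 + ln (w k1)\<bar> \<le> - y * (v - k1)" using k1 by (simp add: field_simps)
      then show ?thesis using gle[OF M(1) k1(2), of y] by (simp add: algebra_simps)
    qed
    also have "g 0 \<le> g s" using A0 by (intro s(2)) auto
    finally show ?thesis .
  qed (use s in auto)
  obtain D where D: "(g has_real_derivative D) (at s)"
  proof -
    have "(f has_real_derivative (\<Sum>k\<le>M. w k * (real k * exp s ^ (k - 1) * exp s))) (at s)"
      (is "(f has_real_derivative ?D) _") unfolding f_def by (auto intro!: derivative_eq_intros sum.cong)
    from DERIV_diff[OF DERIV_cmult_right[OF DERIV_ident, of v] DERIV_chain2[OF DERIV_ln[OF fpos[of s]] this]]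
    show ?thesis unfolding g_def[symmetric] by (rule that)
  qed
  have "D = 0" using DERIV_local_max[OF D, of 1] smax by auto
  then have D0: "(g has_real_derivative 0) (at s)" using D by simp
  \<comment> \<open>The window is narrowed so that undoing the tilt costs at most
    \<open>a e / 2\<close> in the exponent, however large \<open>s\<close> is; the
    \<open>+ 1\<close> covers \<open>s = 0\<close>.\<close>
  define d' where "d' = min d (e / (2 * (\<bar>s\<bar> + 1)))"
  have d': "0 < d'" "d' \<le> d" "\<bar>s\<bar> * d' \<le> e / 2"
  proof -
    show "0 < d'" "d' \<le> d" using d e by (auto simp: d'_def)
    have "\<bar>s\<bar> * d' \<le> (\<bar>s\<bar> + 1) * (e / (2 * (\<bar>s\<bar> + 1)))"
      using e d by (intro mult_mono) (auto simp: d'_def)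
    also have "\<dots> = e / 2" by (simp add: field_simps)
    finally show "\<bar>s\<bar> * d' \<le> e / 2" .
  qed
  \<comment> \<open>As \<open>g\<close> is flat at \<open>s\<close>, a shift by \<open>h\<close> in
    either direction loses at most \<open>h d' / 2\<close>, while the Chernoff bound off the window
    gains \<open>h d'\<close>. The net gain per factor is \<open>h d' / 2\<close>.\<close>
  have "(\<lambda>h. (g (s + h) - g s) / h) \<midarrow>0\<rightarrow> 0" using D0 by (simp add: DERIV_def)
  from LIM_D[OF this, of "d' / 2"] obtain h0 where h0: "0 < h0"
    and hh: "\<And>h. h \<noteq> 0 \<Longrightarrow> \<bar>h\<bar> < h0 \<Longrightarrow> \<bar>(g (s + h) - g s) / h\<bar> < d' / 2"
    using d' by auto
  define h where "h = h0 / 2"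
  have h: "0 < h" using h0 by (simp add: h_def)
  have gh: "g s - g (s + x) \<le> h * d' / 2" if "x = h \<or> x = - h" for x
  proof -
    have "\<bar>(g (s + x) - g s) / x\<bar> < d' / 2" using that h h0 by (intro hh) (auto simp: h_def)
    then have "\<bar>g (s + x) - g s\<bar> < d' / 2 * h" using that h by (auto simp: abs_divide field_simps)
    moreover have "d' / 2 * h = h * d' / 2" by simp
    ultimately show ?thesis by linarith
  qed
  define wM where "wM k = (if k \<le> M then w k else 0)" for k
  have wM: "0 \<le> wM k" "wM k \<le> w k" for k using w by (auto simp: wM_def)
  define q where "q a t = cpow wM a t" for a t
  have q0: "0 \<le> q a t" for a t unfolding q_def by (rule cpow_nonneg) (rule wM)
  have gen: "(\<Sum>t\<le>a * M. q a t * exp \<alpha> ^ t) = f \<alpha> ^ a" for a \<alpha>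
  proof -
    have "(\<Sum>t\<le>a * M. q a t * exp \<alpha> ^ t) = (\<Sum>k\<le>M. wM k * exp \<alpha> ^ k) ^ a"
      unfolding q_def by (rule cpow_finite_support) (simp add: wM_def)
    also have "(\<Sum>k\<le>M. wM k * exp \<alpha> ^ k) = f \<alpha>"
      unfolding f_def by (intro sum.cong) (auto simp: wM_def)
    finally show ?thesis .
  qed
  have tail: "(\<Sum>t\<in>T. q a t * exp s ^ t) \<le> f s ^ a * exp (- (real a * (h * d' / 2)))"
    if x: "x = h \<or> x = - h" and T: "T \<subseteq> {..a * M}" and out: "\<And>t. t \<in> T \<Longrightarrow> x * real a * v + h * d' * real a \<le> x * real t" for x T a
  proof -
    have "(\<Sum>t\<in>T. q a t * exp s ^ t) \<le> (\<Sum>t\<in>T. exp (- (x * real a * v + h * d' * real a)) * (q a t * exp (s + x) ^ t))"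
    proof (rule sum_mono)
      fix t assume "t \<in> T"
      have "exp s ^ t = exp (- (x * real t)) * exp (s + x) ^ t"
        by (simp add: exp_of_nat_mult[symmetric] exp_add[symmetric] algebra_simps)
      also have "\<dots> \<le> exp (- (x * real a * v + h * d' * real a)) * exp (s + x) ^ t"
        using out[OF \<open>t \<in> T\<close>] by (intro mult_right_mono) auto
      finally have "q a t * exp s ^ t \<le> q a t * (exp (- (x * real a * v + h * d' * real a)) * exp (s + x) ^ t)"
        by (rule mult_left_mono[OF _ q0])
      then show "q a t * exp s ^ t \<le> exp (- (x * real a * v + h * d' * real a)) * (q a t * exp (s + x) ^ t)"
        by (simp add: mult_ac)
    qed
    also have "\<dots> \<le> exp (- (x * real a * v + h * d' * real a)) * f (s + x) ^ a"
      unfolding sum_distrib_left[symmetric] gen[symmetric] using T q0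
      by (intro mult_left_mono sum_mono2) auto
    also have "\<dots> = exp (real a * (ln (f (s + x)) - x * v - h * d'))"
    proof -
      have "f (s + x) ^ a = exp (real a * ln (f (s + x)))"
        using fpos[of "s + x"] by (simp add: exp_of_nat_mult)
      then show ?thesis by (simp add: exp_add[symmetric] algebra_simps)
    qed
    also have "\<dots> \<le> exp (real a * (ln (f s) - h * d' / 2))"
    proof -
      have "ln (f (s + x)) - x * v = ln (f s) + (g s - g (s + x))" by (simp add: g_def algebra_simps)
      also have "\<dots> \<le> ln (f s) + h * d' / 2" using gh[OF x] by simp
      finally show ?thesis by (simp add: mult_left_mono)
    qed
    also have "\<dots> = f s ^ a * exp (- (real a * (h * d' / 2)))"
    proof -
      have "f s ^ a = exp (real a * ln (f s))" using fpos[of s] by (simp add: exp_of_nat_mult)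
      then show ?thesis by (simp add: exp_add[symmetric] algebra_simps)
    qed
    finally show ?thesis .
  qed
  have "\<forall>\<^sub>F a in sequentially. exp (- (real a * (h * d' / 2))) \<le> 1 / 4 \<and> ln (2 * (real a * real M + 1)) \<le> real a * (e / 2) \<and> 1 \<le> a"
  proof (intro eventually_conj)
    have "(\<lambda>a. exp (- (real a * x))) \<longlonglongrightarrow> 0" if "0 < x" for x using that by real_asymp
    from this[of "h * d' / 2"] have "(\<lambda>a. exp (- (real a * (h * d' / 2)))) \<longlonglongrightarrow> 0" using h d' by simp
    then show "\<forall>\<^sub>F a in sequentially. exp (- (real a * (h * d' / 2))) \<le> 1 / 4"
      by (rule eventually_mono[OF order_tendstoD(2)[of _ _ _ "1/4"]]) auto
    have M0: "0 < real M" using M k1 k2 by (cases M) auto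
    show "\<forall>\<^sub>F a in sequentially. ln (2 * (real a * real M + 1)) \<le> real a * (e / 2)"
      using e M0 by real_asymp
    show "\<forall>\<^sub>F a in sequentially. 1 \<le> a" by (rule eventually_ge_at_top)
  qed
  then obtain a where a: "exp (- (real a * (h * d' / 2))) \<le> 1 / 4" "ln (2 * (real a * real M + 1)) \<le> real a * (e / 2)" "1 \<le> a"
    by (auto simp: eventually_sequentially)
  define T1 where "T1 = {t. t \<le> a * M \<and> real a * (v + d') \<le> real t}"
  define T2 where "T2 = {t. t \<le> a * M \<and> real t \<le> real a * (v - d')}"
  define T3 where "T3 = {t. t \<le> a * M \<and> \<bar>real t - real a * v\<bar> < real a * d'}"
  have "(\<Sum>t\<in>T1. q a t * exp s ^ t) \<le> f s ^ a * exp (- (real a * (h * d' / 2)))"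
  proof (rule tail[of h])
    fix t assume "t \<in> T1"
    then have "h * (real a * (v + d')) \<le> h * real t" using h by (intro mult_left_mono) (auto simp: T1_def)
    then show "h * real a * v + h * d' * real a \<le> h * real t" by (simp add: algebra_simps)
  qed (auto simp: T1_def)
  also have "\<dots> \<le> f s ^ a * (1 / 4)" using a fpos[of s] by (intro mult_left_mono) auto
  finally have t1: "(\<Sum>t\<in>T1. q a t * exp s ^ t) \<le> f s ^ a / 4" by simp
  have "(\<Sum>t\<in>T2. q a t * exp s ^ t) \<le> f s ^ a * exp (- (real a * (h * d' / 2)))"
  proof (rule tail[of "- h"])
    fix t assume "t \<in> T2"
    then have "h * real t \<le> h * (real a * (v - d'))" using h by (intro mult_left_mono) (auto simp: T2_def)
    then show "- h * real a * v + h * d' * real a \<le> - h * real t" by (simp add: algebra_simps)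
  qed (auto simp: T2_def)
  also have "\<dots> \<le> f s ^ a * (1 / 4)" using a fpos[of s] by (intro mult_left_mono) auto
  finally have t2: "(\<Sum>t\<in>T2. q a t * exp s ^ t) \<le> f s ^ a / 4" by simp
  have fin: "finite T1" "finite T2" "finite T3" by (auto simp: T1_def T2_def T3_def)
  have "f s ^ a = (\<Sum>t\<le>a * M. q a t * exp s ^ t)" by (rule gen[symmetric])
  also have "\<dots> \<le> (\<Sum>t\<in>T1 \<union> T2 \<union> T3. q a t * exp s ^ t)"
    using fin q0 by (intro sum_mono2) (auto simp: T1_def T2_def T3_def abs_less_iff algebra_simps)
  also have "\<dots> \<le> (\<Sum>t\<in>T1 \<union> T2. q a t * exp s ^ t) + (\<Sum>t\<in>T3. q a t * exp s ^ t)"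
    using fin q0 by (simp add: sum_Un[of "T1 \<union> T2" T3] sum_nonneg)
  also have "(\<Sum>t\<in>T1 \<union> T2. q a t * exp s ^ t) \<le> (\<Sum>t\<in>T1. q a t * exp s ^ t) + (\<Sum>t\<in>T2. q a t * exp s ^ t)"
    using fin q0 by (simp add: sum_Un[of T1 T2] sum_nonneg)
  finally have half: "f s ^ a / 2 \<le> (\<Sum>t\<in>T3. q a t * exp s ^ t)" using t1 t2 by simp
  \<comment> \<open>Pigeonhole: half of the total mass sits on at most \<open>a M + 1\<close>
    indices.\<close>
  have "\<exists>t\<in>T3. f s ^ a / (2 * (real a * real M + 1)) \<le> q a t * exp s ^ t"
  proof (rule ccontr)
    assume n: "\<not> ?thesis"
    have ne: "T3 \<noteq> {}" using half zero_less_power[OF fpos[of s], of a] by auto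
    have "(\<Sum>t\<in>T3. q a t * exp s ^ t) < (\<Sum>t\<in>T3. f s ^ a / (2 * (real a * real M + 1)))"
      using n ne fin by (intro sum_strict_mono) (auto simp: not_le)
    also have "\<dots> = real (card T3) * (f s ^ a / (2 * (real a * real M + 1)))" by simp
    also have "\<dots> \<le> (real a * real M + 1) * (f s ^ a / (2 * (real a * real M + 1)))"
    proof (rule mult_right_mono)
      have "card T3 \<le> card {..a * M}" by (intro card_mono) (auto simp: T3_def)
      then have "real (card T3) \<le> real (a * M + 1)" by (simp only: of_nat_le_iff) simp
      then show "real (card T3) \<le> real a * real M + 1" by simp
    qed (use fpos[of s] in auto)
    also have "\<dots> = f s ^ a / 2"
    proof -
      have "x * (y / (2 * x)) = y / 2" if "0 < x" for x y :: real using that by simp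
      from this[of "real a * real M + 1"] show ?thesis by (simp only: add_nonneg_pos of_nat_0_le_iff mult_nonneg_nonneg zero_less_one)
    qed
    finally show False using half by simp
  qed
  then obtain t where t: "t \<in> T3" "f s ^ a / (2 * (real a * real M + 1)) \<le> q a t * exp s ^ t" by blast
  have "exp (- (real a * (c + e))) \<le> q a t"
  proof -
    have "g s \<le> c" using c[of s] by (simp add: g_def f_def)
    moreover have "s * (real t - real a * v) \<le> \<bar>s\<bar> * \<bar>real t - real a * v\<bar>"
      by (metis abs_ge_self abs_mult)
    moreover have "\<bar>s\<bar> * \<bar>real t - real a * v\<bar> \<le> \<bar>s\<bar> * (real a * d')"
      using t(1) by (intro mult_left_mono) (auto simp: T3_def)
    ultimately have "g s \<le> c" "s * (real t - real a * v) \<le> real a * (e / 2)"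
      using mult_left_mono[OF d'(3), of "real a"] by (simp_all add: mult.left_commute)
    then have "- (real a * (c + e)) \<le> real a * ln (f s) - ln (2 * (real a * real M + 1)) - s * real t"
      using a(2) mult_left_mono[of "g s" c "real a"] by (simp add: g_def algebra_simps)
    then have "exp (- (real a * (c + e))) \<le> exp (real a * ln (f s) - ln (2 * (real a * real M + 1)) - s * real t)" by simp
    also have "\<dots> = f s ^ a / (2 * (real a * real M + 1)) / exp s ^ t"
      using fpos[of s] by (simp add: exp_diff exp_of_nat_mult exp_of_nat2_mult add_nonneg_pos del: mult_2 distrib_left_numeral)
    also have "\<dots> \<le> q a t" using t(2) by (subst pos_divide_le_eq) simp_all
    finally show ?thesis .
  qed
  also have "\<dots> \<le> cpow w a t" unfolding q_def by (rule cpow_mono) (use wM in auto)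
  finally have "exp (- (real a * (c + e))) \<le> cpow w a t" .
  moreover have "\<bar>real t / real a - v\<bar> < d"
  proof -
    have "real t / real a - v = (real t - real a * v) / real a" using a(3) by (simp add: field_simps)
    then have "\<bar>real t / real a - v\<bar> = \<bar>real t - real a * v\<bar> / real a" by simp
    also have "\<dots> < d'" using t(1) a(3) by (simp add: T3_def field_simps)
    finally show ?thesis using d' by simp
  qed
  ultimately show ?thesis using a(3) by blast
qed

text \<open>Here the support of \<open>w\<close> lies on one side of \<open>u\<close>; a finite rate then forces an atom at \<open>u\<close>.\<close>

lemma edge_weight_ge:
  fixes u c \<sigma> :: real
  assumes w: "\<And>k. 0 \<le> w k" and sw: "summable w" and k0: "0 < w k0" and u: "0 \<le> u"
    and \<sigma>: "\<bar>\<sigma>\<bar> = 1" "\<And>k. 0 < w k \<Longrightarrow> 0 \<le> \<sigma> * (u - real k)"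
    and c: "\<And>\<alpha>. summable (\<lambda>k. w k * exp \<alpha> ^ k) \<Longrightarrow> \<alpha> * u - ln (\<Sum>k. w k * exp \<alpha> ^ k) \<le> c"
  shows "\<exists>k. u = real k \<and> exp (- c) \<le> w k"
proof -
  define m where "m = nat \<lfloor>u\<rfloor>"
  have m: "real m \<le> u" "u < real m + 1" using u by (auto simp: m_def)
  define \<gamma> where "\<gamma> = (if u = real m then 1 else min (u - real m) (real m + 1 - u))"
  have \<gamma>: "0 < \<gamma>" using m by (auto simp: \<gamma>_def)
  have \<gamma>_le: "\<gamma> \<le> \<bar>u - real k\<bar>" if "real k \<noteq> u" for k
  proof (cases "k \<le> m")
    case True
    then show ?thesis using that m by (cases "k = m") (auto simp: \<gamma>_def)
  next
    case False
    then have "real m + 1 \<le> real k" by (simp add: Suc_le_eq flip: of_nat_Suc)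
    then show ?thesis using m by (auto simp: \<gamma>_def)
  qed
  define Wu where "Wu = (if u = real m then w m else 0)"
  \<comment> \<open>Tilting ever more strongly in the direction \<open>\<sigma>\<close>, on whose
    far side there is no support, leaves only the atom at \<open>u\<close>: every other term loses a
    factor of at least \<open>exp (- (s * \<gamma>))\<close>.\<close>
  have main: "exp (- c) \<le> Wu + exp (- (s * \<gamma>)) * suminf w" if s: "0 \<le> s" for s
  proof -
    define \<alpha> where "\<alpha> = \<sigma> * s"
    have term_le: "w k * exp \<alpha> ^ k \<le> exp (\<alpha> * u) * (w k * (if u = real k then 1 else exp (- (s * \<gamma>))))" for k
    proof (cases "w k = 0")
      case False
      then have wk: "0 < w k" using w[of k] by simp
      have "\<sigma> * (u - real k) = \<bar>u - real k\<bar>" using \<sigma>(1) \<sigma>(2)[OF wk] by (metis abs_mult abs_of_nonneg mult_1)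
      then have "s * (\<sigma> * (u - real k)) = s * \<bar>u - real k\<bar>" by simp
      then have "\<alpha> * real k = \<alpha> * u - s * \<bar>u - real k\<bar>" by (simp add: \<alpha>_def algebra_simps)
      moreover have "s * \<gamma> \<le> s * \<bar>u - real k\<bar>" if "u \<noteq> real k" using that \<gamma>_le[of k] s by (intro mult_left_mono) auto
      ultimately have "exp (\<alpha> * real k) \<le> exp (\<alpha> * u) * (if u = real k then 1 else exp (- (s * \<gamma>)))"
        by (cases "u = real k") (simp_all add: mult_exp_exp)
      then have "w k * exp (\<alpha> * real k) \<le> w k * (exp (\<alpha> * u) * (if u = real k then 1 else exp (- (s * \<gamma>))))"
        using wk by (intro mult_left_mono) auto
      then show ?thesis by (simp add: exp_of_nat2_mult mult_ac)
    qed simp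
    have term_le2: "w k * (if u = real k then 1 else exp (- (s * \<gamma>))) \<le> (if k = m then Wu else 0) + exp (- (s * \<gamma>)) * w k" for k
    proof (cases "u = real k")
      case True
      then have "k = m" by (simp add: m_def)
      then show ?thesis using True w[of k] by (simp add: Wu_def)
    next
      case False
      then show ?thesis using w[of m] by (auto simp: Wu_def)
    qed
    have sb: "summable (\<lambda>k. exp (\<alpha> * u) * ((if k = m then Wu else 0) + exp (- (s * \<gamma>)) * w k))"
      by (intro summable_mult summable_add sw) simp
    have le: "w k * exp \<alpha> ^ k \<le> exp (\<alpha> * u) * ((if k = m then Wu else 0) + exp (- (s * \<gamma>)) * w k)" for k
      by (rule order_trans[OF term_le]) (intro mult_left_mono term_le2, simp)
    have sf: "summable (\<lambda>k. w k * exp \<alpha> ^ k)"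
      by (rule summable_comparison_test'[OF sb, of 0]) (use w le in auto)
    have pos: "0 < (\<Sum>k. w k * exp \<alpha> ^ k)"
      by (rule suminf_pos2[OF sf, of k0]) (use w k0 in auto)
    have "(\<Sum>k. w k * exp \<alpha> ^ k) \<le> (\<Sum>k. exp (\<alpha> * u) * ((if k = m then Wu else 0) + exp (- (s * \<gamma>)) * w k))"
      by (rule suminf_le[OF le sf sb])
    also have "\<dots> = exp (\<alpha> * u) * (Wu + exp (- (s * \<gamma>)) * suminf w)"
    proof -
      have "(\<Sum>k. (if k = m then Wu else 0)) = Wu"
        using sums_single[of m "\<lambda>_. Wu"] by (simp add: sums_iff)
      then show ?thesis
        by (subst suminf_mult) (auto intro!: summable_add summable_mult sw simp: suminf_add[symmetric] suminf_mult sw)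
    qed
    finally have "(\<Sum>k. w k * exp \<alpha> ^ k) \<le> exp (\<alpha> * u) * (Wu + exp (- (s * \<gamma>)) * suminf w)" .
    moreover have "exp (\<alpha> * u - c) \<le> (\<Sum>k. w k * exp \<alpha> ^ k)"
      using c[OF sf] pos by (simp add: ln_ge_iff[symmetric])
    ultimately have "exp (\<alpha> * u) * exp (- c) \<le> exp (\<alpha> * u) * (Wu + exp (- (s * \<gamma>)) * suminf w)"
      by (simp add: exp_add[symmetric])
    then show ?thesis by simp
  qed
  have "exp (- c) \<le> Wu"
  proof (rule tendsto_lowerbound)
    have "((\<lambda>s. Wu + exp (- (s * \<gamma>)) * suminf w) \<longlongrightarrow> Wu + 0 * suminf w) at_top"
      by (intro tendsto_intros) (use \<gamma> in real_asymp)
    then show "((\<lambda>s. Wu + exp (- (s * \<gamma>)) * suminf w) \<longlongrightarrow> Wu) at_top" by simp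
    show "\<forall>\<^sub>F s in at_top. exp (- c) \<le> Wu + exp (- (s * \<gamma>)) * suminf w"
      by (rule eventually_mono[OF eventually_ge_at_top[of "0::real"] main])
  qed simp
  moreover have "0 < exp (- c)" by simp
  ultimately have "u = real m" "exp (- c) \<le> w m" by (auto simp: Wu_def split: if_splits)
  then show ?thesis by blast
qed

text \<open>The sign \<open>\<sigma>\<close> selects the side from which \<open>t / a\<close> approximates \<open>u\<close>.\<close>

lemma cpow_lower_bound:
  fixes u c \<sigma> :: real
  assumes w: "\<And>k. 0 \<le> w k" and sw: "summable w" and k0: "0 < w k0" and u: "0 \<le> u"
    and c: "\<And>\<alpha>. summable (\<lambda>k. w k * exp \<alpha> ^ k) \<Longrightarrow> \<alpha> * u - ln (\<Sum>k. w k * exp \<alpha> ^ k) \<le> c"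
    and e: "0 < e" and d: "0 < d" and \<sigma>: "\<bar>\<sigma>\<bar> = 1"
  shows "\<exists>a t. 1 \<le> a \<and> 0 \<le> \<sigma> * (real t / real a - u) \<and> \<sigma> * (real t / real a - u) < d \<and>
     exp (- (real a * (c + e))) \<le> cpow w a t"
proof (cases "(\<exists>k. 0 < w k \<and> real k < u) \<and> (\<exists>k. 0 < w k \<and> u < real k)")
  case True
  then obtain k1 k2 where k1: "real k1 < u" "0 < w k1" and k2: "u < real k2" "0 < w k2" by blast
  obtain M \<eta> where \<eta>: "0 < \<eta>" and M: "k1 \<le> M" "k2 \<le> M"
    and le: "\<And>v \<alpha>. \<bar>v - u\<bar> < \<eta> \<Longrightarrow> \<alpha> * v - ln (\<Sum>k\<le>M. w k * exp \<alpha> ^ k) \<le> c + e / 2"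
    using truncated_rate_le[OF w k1 k2 c, of "e / 2"] e by auto
  define x where "x = min (d / 2) (min (\<eta> / 2) (min ((u - k1) / 2) ((k2 - u) / 2)))"
  have x: "0 < x" "x \<le> d / 2" "x < \<eta>" "real k1 < u - x" "u + x < real k2"
    using d \<eta> k1 k2 by (auto simp: x_def min_def field_simps)
  \<comment> \<open>Aiming at distance \<open>x\<close> on the required side with error below
    \<open>x\<close> keeps \<open>t / a\<close> on that side and within \<open>2 x \<le> d\<close>
    of \<open>u\<close>.\<close>
  define v where "v = u + \<sigma> * x"
  have s2: "\<sigma> = 1 \<or> \<sigma> = -1" using \<sigma> by linarith
  have v: "\<bar>v - u\<bar> < \<eta>" "real k1 < v" "v < real k2" using s2 x by (auto simp: v_def)
  obtain a t where at: "1 \<le> a" "\<bar>real t / real a - v\<bar> < x" "exp (- (real a * (c + e / 2 + e / 2))) \<le> cpow w a t"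
    using cpow_ge_near_mean[OF w v(2) k1(2) v(3) k2(2) M le[OF v(1)], of "e / 2" x] e x by auto
  show ?thesis
    by (rule exI[of _ a], rule exI[of _ t]) (use at s2 x in \<open>auto simp: v_def abs_less_iff add.commute\<close>)
next
  case False
  have "\<exists>\<tau>::real. \<bar>\<tau>\<bar> = 1 \<and> (\<forall>k. 0 < w k \<longrightarrow> 0 \<le> \<tau> * (u - real k))"
  proof (cases "\<exists>k. 0 < w k \<and> u < real k")
    case True
    then have "\<forall>k. 0 < w k \<longrightarrow> u \<le> real k" using False by (meson not_less)
    then show ?thesis by (intro exI[of _ "-1"]) auto
  next
    case False
    then have "\<forall>k. 0 < w k \<longrightarrow> real k \<le> u" by (meson not_less)
    then show ?thesis by (intro exI[of _ 1]) auto
  qed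
  then obtain \<tau> :: real where \<tau>: "\<bar>\<tau>\<bar> = 1" "\<And>k. 0 < w k \<Longrightarrow> 0 \<le> \<tau> * (u - real k)" by blast
  obtain k where k: "u = real k" "exp (- c) \<le> w k" using edge_weight_ge[OF w sw k0 u \<tau> c] by blast
  have "exp (- (c + e)) \<le> exp (- c)" using e by simp
  also note k(2)
  finally show ?thesis using k(1) d by - (rule exI[of _ 1], rule exI[of _ k], auto simp: cpow_1)
qed

section \<open>Lower bounds for surjection weights in a cone of slopes\<close>

lemma exp_wt_sums: "(\<lambda>k. exp_wt k * x ^ k) sums (exp x - 1)"
proof -
  have "(\<lambda>k. x ^ k /\<^sub>R fact k - (if k = 0 then 1 else 0)) sums (exp x - 1)"
    using sums_single[of 0 "\<lambda>_. 1::real"] by (intro sums_diff exp_converges) auto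
  moreover have "(\<lambda>k. x ^ k /\<^sub>R fact k - (if k = 0 then 1 else 0)) = (\<lambda>k. exp_wt k * x ^ k)"
    by (auto simp: exp_wt_def field_simps)
  ultimately show ?thesis by simp
qed

lemma cpow_exp_wt_diag: "1 \<le> cpow exp_wt b b"
  using cpow_power_le[of exp_wt 1 1 b] by (simp add: exp_wt_nonneg cpow_1 del: One_nat_def) (simp add: cpow_1 exp_wt_def)

text \<open>Dropping the second summand in \<open>cpow_exp_wt_rec\<close> shows that raising
  \<open>m\<close> by one costs a factor of at least \<open>a / (m + 1)\<close>; \<open>x\<close> is
  a lower bound for all factors met on the way.\<close>

lemma cpow_exp_wt_add:
  assumes a: "1 \<le> a" and x: "0 < x" "\<And>i. i < j \<Longrightarrow> x * real (m + Suc i) \<le> real a"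
  shows "x ^ j * cpow exp_wt a m \<le> cpow exp_wt a (m + j)"
  using x(2)
proof (induction j)
  case (Suc j)
  obtain b where b: "a = Suc b" using a by (cases a) auto
  have nn: "0 \<le> cpow exp_wt a t" for a t by (rule cpow_nonneg) (rule exp_wt_nonneg)
  have "x ^ Suc j * cpow exp_wt a m \<le> x * cpow exp_wt a (m + j)"
    using Suc x by (simp add: mult.assoc mult_left_mono)
  also have "\<dots> \<le> real a / real (m + Suc j) * cpow exp_wt a (m + j)"
    using Suc.prems[of j] nn by (intro mult_right_mono) (auto simp: field_simps)
  also have "\<dots> \<le> real (Suc b) * (cpow exp_wt (Suc b) (m + j) + cpow exp_wt b (m + j)) / real (Suc (m + j))"
    using nn[of b "m + j"] by (simp add: b divide_right_mono mult_left_mono)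
  also have "\<dots> = cpow exp_wt a (m + Suc j)"
    unfolding cpow_exp_wt_rec[symmetric] by (simp add: b)
  finally show ?case .
qed simp

text \<open>A good pair \<open>(a0, m0)\<close> of slope at most \<open>u\<close> is repeated
  \<open>L = a div a0\<close> times, the remainder \<open>b\<close> is filled by the diagonal
  coefficient, and the missing \<open>j\<close> units of \<open>m\<close> are added one by one.
  Approximating \<open>u\<close> from below ensures \<open>L * m0 + b \<le> m\<close>; as both
  slopes are within \<open>d\<close> of \<open>u\<close>, \<open>j\<close> is at most
  \<open>2 d a\<close> plus a constant.\<close>

lemma cpow_exp_wt_lower_bound:
  fixes u c :: real
  assumes u: "1 \<le> u" and c: "\<And>\<alpha>. \<alpha> * u - ln (exp (exp \<alpha>) - 1) \<le> c" and e: "0 < e"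
  shows "\<exists>d A. 0 < d \<and> (\<forall>a m. A \<le> a \<longrightarrow> u * real a \<le> real m \<longrightarrow> real m < (u + d) * real a \<longrightarrow>
     exp (- (real a * (c + e))) \<le> cpow exp_wt a m)"
proof -
  \<comment> \<open>Each added unit costs a factor \<open>1 / (u + 1)\<close>, so about
    \<open>2 d a\<close> of them must stay within \<open>a e / 2\<close> in the exponent.\<close>
  define d where "d = min 1 (e / (4 * ln (u + 1)))"
  have lu: "0 < ln (u + 1)" using u by simp
  have d: "0 < d" "d \<le> 1" "d * ln (u + 1) \<le> e / 4"
    using lu e by (auto simp: d_def min_def field_simps)
  have "\<exists>a t. 1 \<le> a \<and> 0 \<le> (-1) * (real t / real a - u) \<and> (-1) * (real t / real a - u) < d \<and>
     exp (- (real a * (c + e / 4))) \<le> cpow exp_wt a t"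
  proof (rule cpow_lower_bound)
    show "summable exp_wt" using sums_summable[OF exp_wt_sums[of 1]] by simp
    show "0 < exp_wt 1" by (simp add: exp_wt_def)
    show "\<alpha> * u - ln (\<Sum>k. exp_wt k * exp \<alpha> ^ k) \<le> c" for \<alpha>
      using c[of \<alpha>] sums_unique[OF exp_wt_sums[of "exp \<alpha>"]] by simp
  qed (use u d e exp_wt_nonneg in auto)
  then obtain a0 m0 where a0: "1 \<le> a0" and lo: "real m0 / real a0 \<le> u" and hi: "u < real m0 / real a0 + d"
    and q: "exp (- (real a0 * (c + e / 4))) \<le> cpow exp_wt a0 m0" by auto
  have lo': "real m0 \<le> u * real a0" and hi': "u * real a0 \<le> real m0 + d * real a0" using lo hi a0 by (auto simp: field_simps)
  \<comment> \<open>Collects the costs of the remainder, which do not grow with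
    \<open>a\<close>.\<close>
  define K where "K = real a0 * \<bar>c + e / 4\<bar> + ln (u + 1) * (u * real a0)"
  have "\<forall>\<^sub>F a in sequentially. K \<le> real a * (e / 4)" using e by real_asymp
  then obtain A where A: "\<And>a. A \<le> a \<Longrightarrow> K \<le> real a * (e / 4)" by (auto simp: eventually_sequentially)
  have "exp (- (real a * (c + e))) \<le> cpow exp_wt a m"
    if a: "max A 1 \<le> a" and m: "u * real a \<le> real m" "real m < (u + d) * real a" for a m
  proof -
    define L b where "L = a div a0" and "b = a mod a0"
    have ab: "a = L * a0 + b" by (simp add: L_def b_def)
    have b: "b < a0" using a0 by (simp add: b_def)
    have rab: "real a = real L * real a0 + real b" by (simp add: ab)
    have "real (L * m0 + b) \<le> real L * (u * real a0) + u * real b"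
      using mult_left_mono[OF lo', of "real L"] mult_right_mono[OF u, of "real b"] by simp
    also have "\<dots> = u * real a" by (simp add: rab algebra_simps)
    also have "\<dots> \<le> real m" by (rule m)
    finally have mm: "L * m0 + b \<le> m" by linarith
    define j where "j = m - (L * m0 + b)"
    have mj: "m = L * m0 + b + j" using mm by (simp add: j_def)
    have nn: "0 \<le> cpow exp_wt a t" for a t by (rule cpow_nonneg) (rule exp_wt_nonneg)
    have "(1 / (u + 1)) ^ j * cpow exp_wt a (L * m0 + b) \<le> cpow exp_wt a m"
      unfolding mj
    proof (rule cpow_exp_wt_add)
      fix i assume "i < j"
      then have "real (L * m0 + b + Suc i) \<le> real m" unfolding mj by simp
      also have "\<dots> \<le> (u + 1) * real a" using m(2) d(2) mult_right_mono[of "u + d" "u + 1" "real a"] by simp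
      finally show "1 / (u + 1) * real (L * m0 + b + Suc i) \<le> real a" using u by (simp add: field_simps)
    qed (use a u in auto)
    moreover have "exp (- (real a0 * (c + e / 4))) ^ L \<le> cpow exp_wt a (L * m0 + b)"
    proof -
      have "exp (- (real a0 * (c + e / 4))) ^ L \<le> cpow exp_wt a0 m0 ^ L" by (intro power_mono q) simp
      also have "\<dots> \<le> cpow exp_wt (L * a0) (L * m0)" by (rule cpow_power_le) (rule exp_wt_nonneg)
      also have "\<dots> \<le> cpow exp_wt (L * a0) (L * m0) * cpow exp_wt b b"
        using mult_left_mono[OF cpow_exp_wt_diag nn] by simp
      also have "\<dots> \<le> cpow exp_wt a (L * m0 + b)" unfolding ab by (rule cpow_supermult) (rule exp_wt_nonneg)
      finally show ?thesis .
    qed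
    ultimately have lb: "(1 / (u + 1)) ^ j * exp (- (real a0 * (c + e / 4))) ^ L \<le> cpow exp_wt a m"
      using u by (smt (verit) divide_nonneg_nonneg mult_left_mono zero_le_power)
    have e1: "(1 / (u + 1)) ^ j = exp (- (real j * ln (u + 1)))"
      using u by (simp add: exp_minus exp_of_nat_mult power_one_over inverse_eq_divide)
    have e2: "exp (- (real a0 * (c + e / 4))) ^ L = exp (- ((real a - real b) * (c + e / 4)))"
      by (simp add: exp_of_nat_mult[symmetric] rab)
    have "real j \<le> (u + d) * real a - real L * (u * real a0 - d * real a0) - real b"
      using m(2) mult_left_mono[OF hi', of "real L"] by (simp add: mj algebra_simps)
    also have "\<dots> = 2 * d * real a + (u - d - 1) * real b" by (simp add: rab algebra_simps)
    also have "\<dots> \<le> 2 * d * real a + u * real a0"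
    proof -
      have "(u - d - 1) * real b \<le> u * real b" using d by (intro mult_right_mono) auto
      also have "\<dots> \<le> u * real a0" using b u by (intro mult_left_mono) auto
      finally show ?thesis by simp
    qed
    finally have "real j * ln (u + 1) \<le> (2 * d * real a + u * real a0) * ln (u + 1)" using lu by (intro mult_right_mono) auto
    also have "\<dots> = 2 * (d * ln (u + 1)) * real a + ln (u + 1) * (u * real a0)" by (simp add: algebra_simps)
    also have "\<dots> \<le> 2 * (e / 4) * real a + ln (u + 1) * (u * real a0)"
      using d(3) by (intro add_right_mono mult_right_mono mult_left_mono) auto
    finally have jl: "real j * ln (u + 1) \<le> real a * (e / 2) + ln (u + 1) * (u * real a0)" by (simp add: mult.commute)
    have "(real a - real b) * (c + e / 4) \<le> real a * (c + e / 4) + real a0 * \<bar>c + e / 4\<bar>"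
    proof -
      have "- (real b * (c + e / 4)) \<le> real b * \<bar>c + e / 4\<bar>"
        by (metis abs_ge_minus_self abs_mult abs_of_nat)
      also have "\<dots> \<le> real a0 * \<bar>c + e / 4\<bar>" using b by (intro mult_right_mono) auto
      finally show ?thesis by (simp add: algebra_simps)
    qed
    then have "real j * ln (u + 1) + (real a - real b) * (c + e / 4) \<le> real a * (c + e)"
    proof -
      have "real a * (e / 2) + real a * (c + e / 4) + real a * (e / 4) = real a * (c + e)"
        by (simp add: algebra_simps)
      moreover have "K \<le> real a * (e / 4)" using A[of a] a by simp
      ultimately show ?thesis
        if "(real a - real b) * (c + e / 4) \<le> real a * (c + e / 4) + real a0 * \<bar>c + e / 4\<bar>"
        using jl that unfolding K_def by linarith
    qed
    then have "exp (- (real a * (c + e))) \<le> exp (- (real j * ln (u + 1)) + - ((real a - real b) * (c + e / 4)))" by simp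
    also have "\<dots> = (1 / (u + 1)) ^ j * exp (- (real a0 * (c + e / 4))) ^ L" by (simp only: exp_add e1 e2)
    finally show ?thesis using lb by simp
  qed
  then show ?thesis using d(1) by (intro exI[of _ d] exI[of _ "max A 1"]) auto
qed

section \<open>The rate function\<close>

definition xlnx :: "real \<Rightarrow> real" where
  "xlnx x = x * ln x"

lemma xlnx_0_1 [simp]: "xlnx 0 = 0" "xlnx 1 = 0"
  by (simp_all add: xlnx_def)

lemma continuous_on_xlnx: "continuous_on {0..} xlnx"
proof (rule continuous_on_eq_continuous_within[THEN iffD2], rule ballI)
  fix x :: real assume x: "x \<in> {0..}"
  show "continuous (at x within {0..}) xlnx"
  proof (cases "x = 0")
    case True
    have "((\<lambda>x::real. x * ln x) \<longlongrightarrow> 0) (at_right 0)" by real_asymp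
    then show ?thesis by (simp add: True continuous_within at_within_Ici_at_right xlnx_def[abs_def])
  next
    case False
    then have "isCont xlnx x" unfolding xlnx_def[abs_def] by (intro continuous_intros) auto
    then show ?thesis by (rule continuous_at_imp_continuous_within)
  qed
qed

text \<open>Per unit of \<open>n\<close>, minus the logarithm of the Chernoff bound (exp y - 1)^a /
  y^m for a coefficient of the \<open>a\<close>-th power of exp z - 1, with a = r n and m = t
  n.\<close>

definition surj_potential :: "real \<Rightarrow> real \<Rightarrow> real \<Rightarrow> real" where
  "surj_potential t r y = t * ln y - r * ln (exp y - 1)"

text \<open>The maximum with 0 only serves continuity on the whole quadrant; the rate is infinite for \<open>r > 1\<close>.\<close>

definition entropy_part :: "real \<Rightarrow> real \<Rightarrow> real" where
  "entropy_part r t = xlnx r + xlnx (max 0 (1 - r)) - xlnx t + t"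

section \<open>The critical point of the word exponent and the function \<open>J\<close>\<close>

text \<open>With y = t \<rho> the equation that defines \<open>rho r t\<close> becomes
  \<open>slope y = r / t\<close>, which is also the critical point equation of
  \<open>surj_potential t r\<close>.\<close>

definition slope :: "real \<Rightarrow> real" where
  "slope y = (1 - exp (- y)) / y"

lemma slope_strict_antimono:
  assumes "0 < x" "x < y"
  shows "slope y < slope x"
proof (rule DERIV_neg_imp_decreasing[OF assms(2)])
  fix z assume "x \<le> z" "z \<le> y"
  then have z: "0 < z" using assms by simp
  have "exp (ln (1 + z)) < exp z" using ln_add_one_self_less_self[OF z] by simp
  then have "1 + z < exp z" using z by simp
  then have "exp (- z) * (1 + z) < exp (- z) * exp z" by (intro mult_strict_left_mono) auto
  then have "exp (- z) * (1 + z) < 1" by (simp add: exp_minus)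
  then have "(exp (- z) * z - (1 - exp (- z))) / (z * z) < 0"
    using z by (simp add: divide_less_0_iff algebra_simps)
  moreover have "(slope has_real_derivative (exp (- z) * z - (1 - exp (- z))) / (z * z)) (at z)"
    unfolding slope_def[abs_def] using z by (auto intro!: derivative_eq_intros simp: field_simps)
  ultimately show "\<exists>l. (slope has_real_derivative l) (at z) \<and> l < 0" by blast
qed

lemma slope_surj:
  assumes s: "0 < s" "s < 1"
  shows "\<exists>y>0. slope y = s"
proof -
  \<comment> \<open>The bracket comes from the elementary bounds
    \<open>exp (- a) \<le> slope a\<close> and \<open>slope b \<le> 1 / b\<close>.\<close>
  define a b where "a = - ln s" and "b = 1 / s"
  have a: "0 < a" using s by (simp add: a_def)
  have b: "0 < b" using s by (simp add: b_def)
  have "a \<le> b" using ln_le_minus_one[of b] b s by (simp add: a_def b_def ln_div)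
  have "1 * exp (- a) \<le> exp (- a) * exp a - a * exp (- a)"
    using exp_ge_add_one_self[of a] mult_left_mono[of "1 + a" "exp a" "exp (- a)"] by (simp add: algebra_simps)
  then have "a * exp (- a) \<le> 1 - exp (- a)" by (simp add: exp_minus)
  then have "exp (- a) \<le> slope a" using a by (simp add: slope_def field_simps)
  then have 1: "s \<le> slope a" using s by (simp add: a_def)
  have 2: "slope b \<le> s" using s by (simp add: slope_def b_def mult_left_le)
  have "continuous_on {a..b} slope" unfolding slope_def[abs_def] using a by (intro continuous_intros) auto
  from IVT2'[OF 2 1 \<open>a \<le> b\<close> this] obtain y where "a \<le> y" "y \<le> b" "slope y = s" by blast
  then show ?thesis using a by (intro exI[of _ y]) auto
qed

lemma exp_minus_one_pos: "0 < y \<Longrightarrow> 0 < exp y - (1::real)" by simp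

text \<open>The derivative at \<open>y\<close> is \<open>(t - r / slope y) / y\<close>. As
  \<open>slope\<close> decreases, the potential increases up to \<open>z\<close> and decreases from
  there on.\<close>

lemma surj_potential_le_max:
  assumes r: "0 < r" and t: "0 < t" and z: "0 < z" "slope z = r / t" and y: "0 < y"
  shows "surj_potential t r y \<le> surj_potential t r z"
proof -
  have der: "(surj_potential t r has_real_derivative (t - r / slope x) / x) (at x)" if x: "0 < x" for x
  proof -
    have 1: "(surj_potential t r has_real_derivative (t / x - r * (exp x / (exp x - 1)))) (at x)"
      unfolding surj_potential_def[abs_def] using x exp_minus_one_pos[OF x]
      by (auto intro!: derivative_eq_intros simp: field_simps)
    have "exp x / (exp x - 1) = 1 / (1 - exp (- x))"
      using x by (simp add: exp_minus field_simps)
    then have "t / x - r * (exp x / (exp x - 1)) = (t - r / slope x) / x"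
    proof -
      have "r / slope x / x = r * (1 / (1 - exp (- x)))" unfolding slope_def using x by simp
      moreover assume "exp x / (exp x - 1) = 1 / (1 - exp (- x))"
      ultimately show ?thesis by (simp only: diff_divide_distrib)
    qed
    then show ?thesis using 1 by simp
  qed
  have pos: "0 < slope x" if "0 < x" for x using that by (simp add: slope_def)
  show ?thesis
  proof (cases "y \<le> z")
    case True
    show ?thesis
    proof (rule DERIV_nonneg_imp_nondecreasing[OF True])
      fix x assume x: "y \<le> x" "x \<le> z"
      then have "slope z \<le> slope x" using slope_strict_antimono[of x z] y by (cases "x = z") auto
      then have "r \<le> t * slope x" using z t by (simp add: field_simps)
      then have "0 \<le> (t - r / slope x) / x" using pos[of x] x y by (simp add: field_simps)
      then show "\<exists>d. (surj_potential t r has_real_derivative d) (at x) \<and> 0 \<le> d" using der[of x] x y by auto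
    qed
  next
    case False
    then have zy: "z \<le> y" by simp
    show ?thesis
    proof (rule DERIV_nonpos_imp_nonincreasing[OF zy])
      fix x assume x: "z \<le> x" "x \<le> y"
      then have "slope x \<le> slope z" using slope_strict_antimono[of z x] z by (cases "x = z") auto
      then have "t * slope x \<le> r" using z t by (simp add: field_simps)
      then have "(t - r / slope x) / x \<le> 0" using pos[of x] x z by (simp add: field_simps)
      then show "\<exists>d. (surj_potential t r has_real_derivative d) (at x) \<and> d \<le> 0" using der[of x] x z by auto
    qed
  qed
qed

lemma exists_max_surj_potential:
  assumes "0 < r" "r < t"
  shows "\<exists>z>0. slope z = r / t \<and> (\<forall>y>0. surj_potential t r y \<le> surj_potential t r z)"
  using slope_surj[of "r / t"] surj_potential_le_max[of r t] assms by fastforce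

text \<open>For \<open>r < t\<close> the maximum bounds the potential. At \<open>r = t\<close> there
  is no critical point, and \<open>y \<le> exp y - 1\<close> gives the bound 0.\<close>

lemma bdd_surj_potential:
  assumes r: "0 < r" "r \<le> t"
  shows "bdd_above (surj_potential t r ` {0<..})"
proof (cases "r = t")
  case True
  show ?thesis
  proof (rule bdd_aboveI2)
    fix y :: real assume "y \<in> {0<..}"
    then have y: "0 < y" by simp
    have "y \<le> exp y - 1" using exp_ge_add_one_self[of y] by linarith
    then have "ln y \<le> ln (exp y - 1)" using y by (intro ln_mono) auto
    then show "surj_potential t r y \<le> 0" using r True by (simp add: surj_potential_def mult_left_mono)
  qed
next
  case False
  then obtain z where "\<forall>y>0. surj_potential t r y \<le> surj_potential t r z" using exists_max_surj_potential[of r t] r by auto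
  then show ?thesis by (intro bdd_aboveI2[of _ _ "surj_potential t r z"]) auto
qed

text \<open>A real-valued supremum is legitimate for \<open>0 < r \<le> t\<close> by
  \<open>bdd_surj_potential\<close>; for \<open>r > t\<close> the potential is unbounded as
  \<open>y\<close> tends to 0.\<close>

definition surj_rate :: "real \<Rightarrow> real \<Rightarrow> real" where
  "surj_rate t r = (SUP y\<in>{0<..}. surj_potential t r y)"

lemma surj_rate_upper: "0 < r \<Longrightarrow> r \<le> t \<Longrightarrow> 0 < y \<Longrightarrow> surj_potential t r y \<le> surj_rate t r"
  unfolding surj_rate_def by (rule cSUP_upper) (auto intro: bdd_surj_potential)

lemma less_surj_rate: "0 < r \<Longrightarrow> r \<le> t \<Longrightarrow> c < surj_rate t r \<Longrightarrow> \<exists>y>0. c < surj_potential t r y"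
  unfolding surj_rate_def by (subst (asm) less_cSUP_iff) (auto intro: bdd_surj_potential)

text \<open>At the critical point z = t \<rho> one has exp z - 1 = exp z * r \<rho>. Taking
  logarithms, the terms in ln r and ln t cancel against the entropy part, and the remaining t - r z
  equals t exp (- t \<rho>).\<close>

lemma J_formula_eq:
  assumes r: "0 < r" "r < min t 1"
  shows "J_formula t r = entropy_part r t + surj_rate t r"
proof -
  have t: "0 < t" using r by simp
  obtain z where z: "0 < z" "slope z = r / t" "\<forall>y>0. surj_potential t r y \<le> surj_potential t r z"
    using exists_max_surj_potential[of r t] r by auto
  define \<rho> where "\<rho> = z / t"
  have rho0: "0 < \<rho>" using z t by (simp add: \<rho>_def)
  have zt: "z = t * \<rho>" using t by (simp add: \<rho>_def)
  have eq: "(1 - exp (- t * x)) / x = t * slope (t * x)" if "0 < x" for x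
    using that t by (simp add: slope_def)
  have rho: "rho r t = \<rho>"
    unfolding rho_def
  proof (rule the_equality)
    show "0 < \<rho> \<and> (1 - exp (- t * \<rho>)) / \<rho> = r"
      using rho0 z t by (simp only: eq[OF rho0]) (simp add: zt[symmetric])
    fix x assume x: "0 < x \<and> (1 - exp (- t * x)) / x = r"
    then have "t * slope (t * x) = r" using eq by metis
    moreover have "t * slope z = r" using z t by simp
    ultimately have "slope (t * x) = slope z" using t by (metis less_irrefl mult_cancel_left)
    then have "t * x = z" using slope_strict_antimono[of "t * x" z] slope_strict_antimono[of z "t * x"] x z t
      by (metis less_irrefl linorder_neqE_linordered_idom mult_pos_pos)
    then show "x = \<rho>" using t by (simp add: \<rho>_def field_simps)
  qed
  have sr: "surj_rate t r = surj_potential t r z"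
    unfolding surj_rate_def by (rule cSup_eq_maximum) (use z in auto)
  have e1: "1 - exp (- z) = r * \<rho>" using z t by (simp add: slope_def \<rho>_def field_simps)
  have "exp z - 1 = exp z * (1 - exp (- z))" by (simp add: exp_minus algebra_simps)
  then have "ln (exp z - 1) = z + ln r + ln \<rho>"
    unfolding e1 using r rho0 by (simp add: ln_mult)
  moreover have "ln z = ln t + ln \<rho>" using t rho0 by (simp add: zt ln_mult)
  moreover have "t * exp (- t * \<rho>) = t - t * (r * \<rho>)"
  proof -
    have "exp (- t * \<rho>) = 1 - r * \<rho>" using e1 by (simp add: zt)
    then show ?thesis by (simp only:) (simp add: right_diff_distrib)
  qed
  ultimately show ?thesis
    using r by (simp add: J_formula_def rho sr surj_potential_def entropy_part_def xlnx_def zt algebra_simps)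
qed

text \<open>
  As a function of \<open>r\<close> the rate is a supremum of affine functions, hence lower semicontinuous and convex;
  together these give continuity at the end point of an interval on which it is finite.
\<close>

lemma surj_rate_tendsto_left:
  assumes r: "0 < r" "r \<le> t"
  shows "(surj_rate t \<longlongrightarrow> surj_rate t r) (at_left r)"
proof (rule order_tendstoI)
  fix c assume "c < surj_rate t r"
  then obtain y where y: "0 < y" "c < surj_potential t r y" using less_surj_rate r by blast
  have "((\<lambda>x. surj_potential t x y) \<longlongrightarrow> surj_potential t r y) (at_left r)"
    unfolding surj_potential_def by (intro tendsto_intros)
  from order_tendstoD(1)[OF this y(2)]
  have "\<forall>\<^sub>F x in at_left r. c < surj_potential t x y" .
  moreover have "\<forall>\<^sub>F x in at_left r. 0 < x \<and> x < r"
    using r eventually_at_left_real[of 0 r] by (auto elim: eventually_mono)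
  ultimately show "\<forall>\<^sub>F x in at_left r. c < surj_rate t x"
  proof eventually_elim
    case (elim x)
    then show ?case using surj_rate_upper[of x t y] y r by simp
  qed
next
  fix c assume c: "surj_rate t r < c"
  define r0 where "r0 = r / 2"
  have r0: "0 < r0" "r0 < r" using r by (auto simp: r0_def)
  \<comment> \<open>The chord of the rate between \<open>r0\<close> and \<open>r\<close>; convexity
    puts the rate below it.\<close>
  define f where "f x = (r - x) / (r - r0) * surj_rate t r0 + (x - r0) / (r - r0) * surj_rate t r" for x
  have "(f \<longlongrightarrow> f r) (at_left r)"
    unfolding f_def using r0 by (intro tendsto_intros) auto
  moreover have "f r < c" using r0 c by (simp add: f_def)
  ultimately have "\<forall>\<^sub>F x in at_left r. f x < c" by (rule order_tendstoD)
  moreover have "\<forall>\<^sub>F x in at_left r. r0 < x \<and> x < r"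
    using r0 eventually_at_left_real[of r0 r] by (auto elim: eventually_mono)
  ultimately show "\<forall>\<^sub>F x in at_left r. surj_rate t x < c"
  proof eventually_elim
    case (elim x)
    have "surj_rate t x \<le> f x"
      unfolding surj_rate_def[of t x]
    proof (rule cSUP_least)
      fix y :: real assume "y \<in> {0<..}"
      then have y: "0 < y" by simp
      have "x = (r - x) / (r - r0) * r0 + (x - r0) / (r - r0) * r"
        using r0 by (simp add: divide_simps) (simp add: algebra_simps)
      moreover have "(r - x) / (r - r0) + (x - r0) / (r - r0) = 1"
        using r0 by (simp add: add_divide_distrib[symmetric])
      ultimately have "surj_potential t x y =
         (r - x) / (r - r0) * surj_potential t r0 y + (x - r0) / (r - r0) * surj_potential t r y"
        unfolding surj_potential_def
      proof -
        fix a b :: real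
        assume 1: "x = a * r0 + b * r" and 2: "a + b = 1"
        have "t * ln y - x * ln (exp y - 1) = (a + b) * (t * ln y) - (a * r0 + b * r) * ln (exp y - 1)"
          using 1 2 by simp
        then show "t * ln y - x * ln (exp y - 1) = a * (t * ln y - r0 * ln (exp y - 1)) + b * (t * ln y - r * ln (exp y - 1))"
          by (simp add: algebra_simps)
      qed
      also have "\<dots> \<le> f x"
        unfolding f_def using surj_rate_upper[of r0 t y] surj_rate_upper[of r t y] r r0 y elim
        by (intro add_mono mult_left_mono) auto
      finally show "surj_potential t x y \<le> f x" .
    qed auto
    then show ?case using elim by simp
  qed
qed

text \<open>At the end point \<open>r = min t 1\<close> the limit in the definition of
  \<open>J\<close> is evaluated by left continuity of both summands.\<close>

lemma J_eq:
  assumes r: "0 < r" "r \<le> min t 1"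
  shows "J t r = ereal (entropy_part r t + surj_rate t r)"
proof (cases "r < min t 1")
  case True
  then show ?thesis using r by (simp add: J_def J_formula_eq)
next
  case False
  then have req: "r = min t 1" using r(2) by linarith
  have rt: "r \<le> t" "r \<le> 1" using r by auto
  have "((\<lambda>x. entropy_part x t + surj_rate t x) \<longlongrightarrow> entropy_part r t + surj_rate t r) (at_left r)"
  proof (intro tendsto_intros surj_rate_tendsto_left r rt)
    have l: "((\<lambda>x. max 0 (1 - x)) \<longlongrightarrow> max 0 (1 - r)) (at_left r)" by (intro tendsto_intros)
    have 1: "((\<lambda>x. xlnx (max 0 (1 - x))) \<longlongrightarrow> xlnx (max 0 (1 - r))) (at_left r)"
      by (rule continuous_on_tendsto_compose[OF continuous_on_xlnx l]) auto
    have 2: "(xlnx \<longlongrightarrow> xlnx r) (at_left r)"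
      using r unfolding xlnx_def[abs_def] by (intro tendsto_intros) auto
    show "((\<lambda>x. entropy_part x t) \<longlongrightarrow> entropy_part r t) (at_left r)"
      unfolding entropy_part_def by (intro tendsto_intros 1 2)
  qed
  moreover have "\<forall>\<^sub>F x in at_left r. entropy_part x t + surj_rate t x = J_formula t x"
    using eventually_at_left_real[OF r(1)] by eventually_elim (use req in \<open>simp add: J_formula_eq\<close>)
  ultimately have "(J_formula t \<longlongrightarrow> entropy_part r t + surj_rate t r) (at_left r)"
    by (rule Lim_transform_eventually)
  then have "Lim (at_left r) (J_formula t) = entropy_part r t + surj_rate t r"
    by (intro tendsto_Lim) auto
  then show ?thesis using req r by (simp add: J_def)
qed

lemma J_eq_infinity: "\<not> (0 < r \<and> r \<le> min t 1) \<Longrightarrow> J t r = \<infinity>"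
  by (auto simp: J_def)

lemma surj_potential_le_J:
  assumes "0 < r" "0 < y"
  shows "ereal (entropy_part r t + surj_potential t r y) \<le> J t r"
proof (cases "r \<le> min t 1")
  case True
  then show ?thesis using assms surj_rate_upper[of r t y] by (simp add: J_eq)
qed (simp add: J_eq_infinity)

text \<open>For \<open>r \<le> t\<close> this is the supremum property of \<open>surj_rate\<close>.
  For \<open>r > t\<close> the rate is infinite, and the potential has to be shown
  unbounded.\<close>

lemma less_J_imp:
  assumes r: "0 < r" "r \<le> 1" and t: "0 \<le> t" and c: "ereal c < J t r"
  shows "\<exists>y>0. c < entropy_part r t + surj_potential t r y"
proof (cases "r \<le> t")
  case True
  then have "c - entropy_part r t < surj_rate t r" using c r by (simp add: J_eq)
  then obtain y where "0 < y" "c - entropy_part r t < surj_potential t r y" using less_surj_rate r True by blast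
  then show ?thesis by (intro exI[of _ y]) auto
next
  case False
  \<comment> \<open>Along \<open>y = exp (- s)\<close> the potential is at least
    \<open>(r - t) * s - r * ln 2\<close>; \<open>s\<close> is solved from this so as to overshoot
    the target by \<open>r - t\<close>.\<close>
  define s where "s = max 0 ((c - entropy_part r t + r * ln 2) / (r - t) + 1)"
  define y where "y = exp (- s)"
  have y: "0 < y" "y \<le> 1" by (auto simp: y_def s_def)
  have "y * y \<le> y" using y by (intro mult_left_le) auto
  moreover have "exp y \<le> 1 + y + y * y" using exp_bound[of y] y by (simp add: power2_eq_square)
  ultimately have "exp y - 1 \<le> 2 * y" by linarith
  then have "ln (exp y - 1) \<le> ln (2 * y)" using y by (intro ln_mono) auto
  also have "\<dots> = ln 2 - s" by (simp add: ln_mult y_def)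
  finally have "r * ln (exp y - 1) \<le> r * (ln 2 - s)" using r by (intro mult_left_mono) auto
  moreover have "ln y = - s" by (simp add: y_def)
  ultimately have "(r - t) * s - r * ln 2 \<le> surj_potential t r y" by (simp add: surj_potential_def algebra_simps)
  moreover have "(r - t) * ((c - entropy_part r t + r * ln 2) / (r - t) + 1) \<le> (r - t) * s"
    using False by (intro mult_left_mono) (auto simp: s_def)
  moreover have "(r - t) * ((c - entropy_part r t + r * ln 2) / (r - t) + 1) = c - entropy_part r t + r * ln 2 + (r - t)"
  proof -
    have "d * (X / d + 1) = X + d" if "d \<noteq> 0" for d X :: real using that by (simp add: distrib_left)
    then show ?thesis using False by simp
  qed
  ultimately have "c < entropy_part r t + surj_potential t r y" using False by simp
  then show ?thesis using y by blast
qed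

section \<open>The Cramer rate through the generating function\<close>

definition pgf :: "nat pmf \<Rightarrow> real \<Rightarrow> real" where
  "pgf \<mu> z = (\<Sum>k. pmf \<mu> k * z ^ k)"

lemma mgf_eq_suminf: "mgf \<mu> \<alpha> = (\<Sum>k. ennreal (pmf \<mu> k * exp \<alpha> ^ k))"
proof -
  have "mgf \<mu> \<alpha> = (\<integral>\<^sup>+k. ennreal (pmf \<mu> k) * ennreal (exp (\<alpha> * real k)) \<partial>count_space UNIV)"
    unfolding mgf_def by (rule nn_integral_measure_pmf)
  also have "\<dots> = (\<Sum>k. ennreal (pmf \<mu> k) * ennreal (exp (\<alpha> * real k)))"
    by (rule nn_integral_count_space_nat)
  also have "\<dots> = (\<Sum>k. ennreal (pmf \<mu> k * exp \<alpha> ^ k))"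
    by (intro suminf_cong) (simp add: ennreal_mult' exp_of_nat2_mult)
  finally show ?thesis .
qed

lemma mgf_eq_pgf:
  assumes "summable (\<lambda>k. pmf \<mu> k * exp \<alpha> ^ k)"
  shows "mgf \<mu> \<alpha> = ennreal (pgf \<mu> (exp \<alpha>))"
  unfolding mgf_eq_suminf pgf_def by (rule suminf_ennreal2) (use assms in auto)

lemma mgf_eq_top:
  assumes "\<not> summable (\<lambda>k. pmf \<mu> k * exp \<alpha> ^ k)"
  shows "mgf \<mu> \<alpha> = \<infinity>"
proof (rule ccontr)
  assume "mgf \<mu> \<alpha> \<noteq> \<infinity>"
  then have "(\<Sum>k. ennreal (pmf \<mu> k * exp \<alpha> ^ k)) \<noteq> \<top>" by (simp only: mgf_eq_suminf infinity_ennreal_def not_False_eq_True)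
  then have "summable (\<lambda>k. pmf \<mu> k * exp \<alpha> ^ k)" by (rule summable_suminf_not_top[rotated]) simp
  then show False using assms by blast
qed

lemma summable_pmf_nat: "summable (pmf \<mu>)" for \<mu> :: "nat pmf"
proof (rule summable_suminf_not_top)
  have "mgf \<mu> 0 = 1" by (simp add: mgf_def)
  then show "(\<Sum>k. ennreal (pmf \<mu> k)) \<noteq> \<top>" by (simp add: mgf_eq_suminf)
qed simp

lemma pgf_pos:
  assumes "0 < z" "summable (\<lambda>k. pmf \<mu> k * z ^ k)"
  shows "0 < pgf \<mu> z"
proof -
  obtain k where "k \<in> set_pmf \<mu>" using set_pmf_not_empty[of \<mu>] by blast
  then have "0 < pmf \<mu> k" by (rule pmf_positive)
  then show ?thesis unfolding pgf_def using assms by (intro suminf_pos2[of _ k]) auto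
qed

text \<open>A parameter with divergent series contributes minus infinity, so only convergent ones
  matter. Strict lower bounds turn extended-real suprema into existence statements about
  reals.\<close>

lemma less_cramer_rate_iff:
  assumes r: "0 < r"
  shows "ereal c < ereal r * cramer_rate \<mu> (t / r) \<longleftrightarrow>
    (\<exists>\<alpha>. summable (\<lambda>k. pmf \<mu> k * exp \<alpha> ^ k) \<and> c < \<alpha> * t - r * ln (pgf \<mu> (exp \<alpha>)))"
proof -
  have "ereal c < ereal r * X \<longleftrightarrow> ereal (c / r) < X" for X
    using r by (cases X) (auto simp: field_simps)
  then have "ereal c < ereal r * cramer_rate \<mu> (t / r) \<longleftrightarrow>
     (\<exists>\<alpha>. ereal (c / r) < ereal (\<alpha> * (t / r)) - ln_ennreal (mgf \<mu> \<alpha>))"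
    by (simp add: cramer_rate_def less_SUP_iff)
  also have "\<dots> \<longleftrightarrow> (\<exists>\<alpha>. summable (\<lambda>k. pmf \<mu> k * exp \<alpha> ^ k) \<and> c < \<alpha> * t - r * ln (pgf \<mu> (exp \<alpha>)))"
  proof (intro ex_cong1)
    fix \<alpha>
    show "ereal (c / r) < ereal (\<alpha> * (t / r)) - ln_ennreal (mgf \<mu> \<alpha>) \<longleftrightarrow>
      summable (\<lambda>k. pmf \<mu> k * exp \<alpha> ^ k) \<and> c < \<alpha> * t - r * ln (pgf \<mu> (exp \<alpha>))"
    proof (cases "summable (\<lambda>k. pmf \<mu> k * exp \<alpha> ^ k)")
      case True
      have p: "0 < pgf \<mu> (exp \<alpha>)" by (rule pgf_pos[OF _ True]) simp
      then have "ln_ennreal (mgf \<mu> \<alpha>) = ereal (ln (pgf \<mu> (exp \<alpha>)))"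
        unfolding mgf_eq_pgf[OF True] by (simp add: ln_ennreal_def)
      then show ?thesis using True r by (simp add: field_simps)
    next
      case False
      then show ?thesis by (simp add: mgf_eq_top ln_ennreal_def)
    qed
  qed
  finally show ?thesis .
qed

section \<open>The rate as a supremum of continuous functions\<close>

text \<open>The total exponent for fixed tilts: \<open>y\<close> for the words,
  \<open>\<alpha>\<close> for the values of \<open>K\<close>.\<close>

definition rate_potential :: "nat pmf \<Rightarrow> real \<Rightarrow> real \<Rightarrow> real \<times> real \<Rightarrow> real" where
  "rate_potential \<mu> y \<alpha> = (\<lambda>(r, t).
     entropy_part r t + surj_potential t r y + (\<alpha> * t - r * ln (pgf \<mu> (exp \<alpha>))))"

lemma cramer_rate_nonneg: "0 < r \<Longrightarrow> 0 \<le> ereal r * cramer_rate \<mu> (t / r)"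
proof -
  assume r: "0 < r"
  have "ereal (0 * (t / r)) - ln_ennreal (mgf \<mu> 0) \<le> cramer_rate \<mu> (t / r)"
    unfolding cramer_rate_def by (rule SUP_upper) simp
  moreover have "ln_ennreal (mgf \<mu> 0) = 0"
  proof -
    have "mgf \<mu> 0 = 1" by (simp add: mgf_def)
    then show ?thesis by (simp add: ln_ennreal_def)
  qed
  ultimately have "0 \<le> cramer_rate \<mu> (t / r)" by (simp add: zero_ereal_def[symmetric])
  then show ?thesis using r by (cases "cramer_rate \<mu> (t / r)") auto
qed

text \<open>Testing with \<open>y = t\<close> turns the exponent into the relative entropy of
  Bernoulli(r) with respect to Bernoulli(1 - exp (- t)), the latter parameter being the typical
  fraction of letters seen after t n draws. Its nonnegativity follows from ln x \<le> x - 1.\<close>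

lemma J_nonneg: "0 \<le> J t r"
proof (cases "0 < r \<and> r \<le> min t 1")
  case True
  define p q where "p = 1 - exp (- t)" and "q = exp (- t)"
  have t: "0 < t" using True by auto
  have p: "0 < p" "0 < q" "p + q = 1" using t by (auto simp: p_def q_def)
  have "exp t - 1 = p / q" by (simp add: p_def q_def exp_minus field_simps)
  then have l: "ln (exp t - 1) = ln p - ln q" using p by (simp add: ln_div)
  have lq: "ln q = - t" by (simp add: q_def)
  have "r * (ln p - ln r) \<le> p - r"
  proof -
    have "r * ln (p / r) \<le> r * (p / r - 1)" using True p by (intro mult_left_mono ln_le_minus_one) auto
    then show ?thesis using True p by (simp add: ln_div algebra_simps)
  qed
  moreover have "(1 - r) * (ln q - ln (1 - r)) \<le> q - (1 - r)"
  proof (cases "r = 1")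
    case False
    then have "(1 - r) * ln (q / (1 - r)) \<le> (1 - r) * (q / (1 - r) - 1)"
      using True p by (intro mult_left_mono ln_le_minus_one) auto
    moreover have "(1 - r) * (q / (1 - r) - 1) = q - (1 - r)" using False by (simp add: right_diff_distrib)
    moreover have "ln (q / (1 - r)) = ln q - ln (1 - r)" using True p False by (simp add: ln_div)
    ultimately show ?thesis by simp
  qed (use p in simp)
  ultimately have "0 \<le> entropy_part r t + surj_potential t r t"
    using p True by (simp add: entropy_part_def surj_potential_def xlnx_def l lq algebra_simps)
  then show ?thesis using surj_potential_le_J[of r t t] True t by (meson ereal_less_eq(5) order_trans)
qed (simp add: J_eq_infinity)

lemma chain_rate_nonneg: "0 \<le> chain_rate \<mu> x"
  by (cases x) (auto simp: chain_rate_def intro!: add_nonneg_nonneg cramer_rate_nonneg J_nonneg)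

text \<open>The two summands are suprema over independent parameters, so their sum is the supremum
  over pairs. On the axis \<open>r = 0\<close> the potential is unbounded in \<open>y\<close> if
  \<open>t > 0\<close> and vanishes identically if \<open>t = 0\<close>.\<close>

lemma less_chain_rate_iff:
  assumes r: "0 \<le> r" "r \<le> 1" and t: "0 \<le> t"
  shows "ereal c < chain_rate \<mu> (r, t) \<longleftrightarrow>
     (\<exists>y>0. \<exists>\<alpha>. summable (\<lambda>k. pmf \<mu> k * exp \<alpha> ^ k) \<and> c < rate_potential \<mu> y \<alpha> (r, t))"
proof (cases "r = 0")
  case True
  show ?thesis
  proof (cases "t = 0")
    case True
    have "summable (\<lambda>k. pmf \<mu> k * exp 0 ^ k)" by (simp add: summable_pmf_nat)
    moreover have "rate_potential \<mu> y \<alpha> (r, t) = 0" for y \<alpha>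
      using True \<open>r = 0\<close> by (simp add: rate_potential_def entropy_part_def surj_potential_def)
    moreover have "chain_rate \<mu> (r, t) = 0" using True \<open>r = 0\<close> by (simp add: chain_rate_def)
    moreover have "ereal c < 0 \<longleftrightarrow> c < 0" by (simp add: zero_ereal_def)
    moreover have "\<exists>y::real>0. \<exists>\<alpha>. summable (\<lambda>k. pmf \<mu> k * exp \<alpha> ^ k)"
      using calculation(1) by (intro exI[of _ 1] conjI exI[of _ 0]) auto
    ultimately show ?thesis by auto
  next
    case False
    then have t0: "0 < t" using t by simp
    \<comment> \<open>Solved from \<open>t * ln y - xlnx t = c\<close>; the term \<open>+ t\<close>
      of the entropy part makes the inequality strict.\<close>
    define y where "y = exp ((c + xlnx t) / t)"
    have "rate_potential \<mu> y 0 (r, t) = c + t"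
      using t0 True by (simp add: y_def rate_potential_def entropy_part_def surj_potential_def)
    moreover have "summable (\<lambda>k. pmf \<mu> k * exp 0 ^ k)" by (simp add: summable_pmf_nat)
    moreover have "0 < y" by (simp add: y_def)
    ultimately have "\<exists>y>0. \<exists>\<alpha>. summable (\<lambda>k. pmf \<mu> k * exp \<alpha> ^ k) \<and> c < rate_potential \<mu> y \<alpha> (r, t)"
      using t0 by (intro exI[of _ y] conjI exI[of _ 0]) auto
    then show ?thesis using t0 True by (simp add: chain_rate_def)
  qed
next
  case False
  then have r0: "0 < r" using r by simp
  let ?C = "ereal r * cramer_rate \<mu> (t / r)"
  have cr: "chain_rate \<mu> (r, t) = ?C + J t r" using r0 by (simp add: chain_rate_def)
  show ?thesis
  proof
    assume "ereal c < chain_rate \<mu> (r, t)"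
    then have c: "ereal c < ?C + J t r" by (simp only: cr)
    \<comment> \<open>When \<open>J\<close> is infinite, the Cramer part only needs some level below
      it; -1 works because that part is nonnegative.\<close>
    have "\<exists>c1 c2. c = c1 + c2 \<and> ereal c1 < ?C \<and> ereal c2 < J t r"
    proof (cases "J t r")
      case (real j)
      then have "ereal (c - j) < ?C" using c by (cases ?C) auto
      then obtain d where d: "ereal (c - j) < ereal d" "ereal d < ?C" using ereal_dense2 by blast
      then show ?thesis by (intro exI[of _ d] exI[of _ "c - d"]) (auto simp: real)
    next
      case PInf
      have "ereal (-1) < 0" by simp
      also have "0 \<le> ?C" by (rule cramer_rate_nonneg[OF r0])
      finally have "ereal (-1) < ?C" .
      then show ?thesis using PInf by (intro exI[of _ "-1"] exI[of _ "c + 1"]) auto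
    next
      case MInf
      then show ?thesis using J_nonneg[of t r] by simp
    qed
    then obtain c1 c2 where c12: "c = c1 + c2" "ereal c1 < ?C" "ereal c2 < J t r" by blast
    obtain \<alpha> where "summable (\<lambda>k. pmf \<mu> k * exp \<alpha> ^ k)" "c1 < \<alpha> * t - r * ln (pgf \<mu> (exp \<alpha>))"
      using c12(2) less_cramer_rate_iff[OF r0] by blast
    moreover obtain y where "0 < y" "c2 < entropy_part r t + surj_potential t r y"
      using less_J_imp[OF r0 r(2) t c12(3)] by blast
    ultimately show "\<exists>y>0. \<exists>\<alpha>. summable (\<lambda>k. pmf \<mu> k * exp \<alpha> ^ k) \<and> c < rate_potential \<mu> y \<alpha> (r, t)"
      by (intro exI[of _ y] conjI exI[of _ \<alpha>]) (auto simp: rate_potential_def c12(1))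
  next
    assume "\<exists>y>0. \<exists>\<alpha>. summable (\<lambda>k. pmf \<mu> k * exp \<alpha> ^ k) \<and> c < rate_potential \<mu> y \<alpha> (r, t)"
    then obtain y \<alpha> where y: "0 < y" and s: "summable (\<lambda>k. pmf \<mu> k * exp \<alpha> ^ k)" and c: "c < rate_potential \<mu> y \<alpha> (r, t)"
      by blast
    have 1: "ereal (entropy_part r t + surj_potential t r y) \<le> J t r" by (rule surj_potential_le_J[OF r0 y])
    have "c - (entropy_part r t + surj_potential t r y) < \<alpha> * t - r * ln (pgf \<mu> (exp \<alpha>))"
      using c by (simp add: rate_potential_def)
    then have 2: "ereal (c - (entropy_part r t + surj_potential t r y)) < ?C"
      using s less_cramer_rate_iff[OF r0] by blast
    show "ereal c < chain_rate \<mu> (r, t)"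
      unfolding cr using 1 2 by (cases ?C; cases "J t r") auto
  qed
qed

lemma continuous_on_rate_potential:
  "continuous_on ({0..} \<times> {0..}) (rate_potential \<mu> y \<alpha>)"
proof -
  have 1: "continuous_on ({0..} \<times> {0..}) (\<lambda>x. xlnx (f x))"
    if "continuous_on ({0..} \<times> {0..}) f" "\<And>x. x \<in> {0..} \<times> {0..} \<Longrightarrow> 0 \<le> f x" for f :: "real \<times> real \<Rightarrow> real"
    by (rule continuous_on_compose2[OF continuous_on_xlnx that(1)]) (use that(2) in auto)
  show ?thesis
    unfolding rate_potential_def entropy_part_def surj_potential_def case_prod_unfold
    by (intro continuous_intros 1) auto
qed

lemma chain_rate_eq_infinity: "1 < r \<Longrightarrow> chain_rate \<mu> (r, t) = \<infinity>"
proof -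
  assume r: "1 < r"
  then have "J t r = \<infinity>" by (intro J_eq_infinity) auto
  moreover have "0 \<le> ereal r * cramer_rate \<mu> (t / r)" using r by (intro cramer_rate_nonneg) simp
  ultimately show ?thesis using r by (auto simp: chain_rate_def)
qed

lemma openin_rate_potential: "openin (top_of_set ({0..} \<times> {0..})) {x \<in> {0..} \<times> {0..}. c < rate_potential \<mu> y \<alpha> x}"
proof -
  have "openin (top_of_set ({0..} \<times> {0..})) (({0..} \<times> {0..}) \<inter> rate_potential \<mu> y \<alpha> -` {c<..})"
    by (rule continuous_openin_preimage_gen[OF continuous_on_rate_potential]) simp
  moreover have "({0..} \<times> {0..}) \<inter> rate_potential \<mu> y \<alpha> -` {c<..} = {x \<in> {0..} \<times> {0..}. c < rate_potential \<mu> y \<alpha> x}"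
    by auto
  ultimately show ?thesis by simp
qed

text \<open>For real \<open>c\<close> the superlevel set is a union of relatively open superlevel
  sets of \<open>rate_potential\<close>, together with the region \<open>r > 1\<close>, where the
  rate is infinite.\<close>

lemma chain_rate_lsc:
  "openin (top_of_set ({0..} \<times> {0..})) {x \<in> {0..} \<times> {0..}. c < chain_rate \<mu> x}"
proof (cases c)
  case (real c')
  let ?X = "{0..} \<times> {0..} :: (real \<times> real) set"
  let ?P = "{(y, \<alpha>). 0 < y \<and> summable (\<lambda>k. pmf \<mu> k * exp \<alpha> ^ k)}"
  have "{x \<in> ?X. c < chain_rate \<mu> x} =
     {x \<in> ?X. 1 < fst x} \<union> (\<Union>(y, \<alpha>)\<in>?P. {x \<in> ?X. c' < rate_potential \<mu> y \<alpha> x})"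
  proof (intro set_eqI)
    fix x :: "real \<times> real"
    obtain r t where x: "x = (r, t)" by (cases x)
    show "x \<in> {x \<in> ?X. c < chain_rate \<mu> x} \<longleftrightarrow>
       x \<in> {x \<in> ?X. 1 < fst x} \<union> (\<Union>(y, \<alpha>)\<in>?P. {x \<in> ?X. c' < rate_potential \<mu> y \<alpha> x})"
    proof (cases "1 < r")
      case True
      then show ?thesis by (auto simp: x chain_rate_eq_infinity real)
    next
      case False
      then show ?thesis using less_chain_rate_iff[of r t c' \<mu>] by (auto simp: x real)
    qed
  qed
  moreover have "openin (top_of_set ?X) {x \<in> ?X. 1 < fst x}"
  proof -
    have "openin (top_of_set ?X) (?X \<inter> {x. 1 < fst x})"
      by (intro openin_open_Int open_Collect_less continuous_intros)
    then show ?thesis by (simp add: Int_def)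
  qed
  ultimately show ?thesis
    by (auto intro!: openin_Un openin_Union openin_rate_potential)
next
  case PInf
  then show ?thesis by simp
next
  case MInf
  have "c < chain_rate \<mu> x" for x
    using chain_rate_nonneg[of \<mu> x] MInf by (cases "chain_rate \<mu> x") auto
  then have "{x \<in> {0..} \<times> {0..}. c < chain_rate \<mu> x} = {0..} \<times> {0..}" by auto
  then show ?thesis by (simp only: openin_subtopology_refl) simp
qed

section \<open>The large deviation principle\<close>

lemma ln_fact_ge: "xlnx (real k) - real k \<le> ln (fact k)"
proof (induction k)
  case (Suc k)
  show ?case
  proof (cases "k = 0")
    case False
    then have k: "0 < real k" by simp
    have "real k * ln (1 + 1 / real k) \<le> real k * (1 / real k)"
      using k by (intro mult_left_mono ln_add_one_self_le_self) auto
    moreover have "1 + 1 / real k = (1 + real k) / real k" using k by (simp add: field_simps)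
    ultimately have "real k * (ln (1 + real k) - ln (real k)) \<le> 1" using k by (simp add: ln_div)
    moreover have "ln (fact (Suc k)) = ln (1 + real k) + ln (fact k)" by (simp add: ln_mult)
    ultimately show ?thesis using Suc by (simp add: xlnx_def algebra_simps)
  qed (simp add: xlnx_def)
qed (simp add: xlnx_def)

lemma ln_fact_le: "ln (fact k) \<le> xlnx (real k) - real k + ln (real k + 1) + 1"
proof (cases "k = 0")
  case False
  have "ln (fact k) \<le> xlnx (real k) - real k + ln (real k) + 1"
    using False
  proof (induction k)
    case (Suc k)
    show ?case
    proof (cases "k = 0")
      case False
      then have k: "0 < real k" by simp
      have "ln (real k / (1 + real k)) \<le> real k / (1 + real k) - 1" using k by (intro ln_le_minus_one) auto
      then have "(1 + real k) * (ln (real k) - ln (1 + real k)) \<le> (1 + real k) * (real k / (1 + real k) - 1)"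
        using k by (intro mult_left_mono) (auto simp: ln_div)
      also have "\<dots> = -1" using k by (simp add: right_diff_distrib)
      finally have "(1 + real k) * (ln (real k) - ln (1 + real k)) \<le> -1" .
      moreover have "ln (fact (Suc k)) = ln (1 + real k) + ln (fact k)" by (simp add: ln_mult)
      ultimately show ?thesis using Suc.IH[OF False] by (simp add: xlnx_def algebra_simps)
    qed (simp add: xlnx_def)
  qed simp
  moreover have "ln (real k) \<le> ln (real k + 1)" using False by (intro ln_mono) auto
  ultimately show ?thesis by simp
qed (simp add: xlnx_def)

lemma xlnx_scaled:
  assumes "0 < n" "0 \<le> a"
  shows "n * xlnx (a / n) = xlnx a - a * ln n"
  using assms by (cases "a = 0") (auto simp: xlnx_def ln_div algebra_simps)

lemma entropy_part_scaled:
  assumes n: "n \<ge> 1" and a: "a \<le> n"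
  shows "real n * entropy_part (real a / real n) (real t / real n) =
    xlnx (real a) + xlnx (real (n - a)) - xlnx (real t) + real t + real t * ln (real n) - xlnx (real n)"
proof -
  have n0: "0 < real n" using n by simp
  have m: "max 0 (1 - real a / real n) = real (n - a) / real n" using n a by (simp add: of_nat_diff field_simps)
  have "real n * entropy_part (real a / real n) (real t / real n) =
    real n * xlnx (real a / real n) + real n * xlnx (real (n - a) / real n) - real n * xlnx (real t / real n) + real t"
    unfolding entropy_part_def m using n0 by (simp add: distrib_left right_diff_distrib)
  also have "\<dots> = (xlnx (real a) - real a * ln (real n)) + (xlnx (real (n - a)) - real (n - a) * ln (real n))
     - (xlnx (real t) - real t * ln (real n)) + real t"
    using n0 by (simp only: xlnx_scaled of_nat_0_le_iff)
  also have "real (n - a) * ln (real n) = xlnx (real n) - real a * ln (real n)"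
    using a by (simp add: of_nat_diff xlnx_def algebra_simps)
  finally show ?thesis by simp
qed

text \<open>The origin of \<open>entropy_part\<close>: by Stirling's bounds it is the exponential
  rate of the explicit factor in the word count, what remains being the coefficient of a power of
  exp z - 1.\<close>

lemma ln_binomial_fact:
  assumes n: "n \<ge> 1" and a: "a \<le> n"
  shows "ln (real (n choose a) * fact t / real n ^ t) \<le>
      ln (real n + 1) + ln (real t + 1) + 2 - real n * entropy_part (real a / real n) (real t / real n)"
    and "- real n * entropy_part (real a / real n) (real t / real n) - 2 * ln (real n + 1) - 2 \<le>
      ln (real (n choose a) * fact t / real n ^ t)"
proof -
  have ch: "real (n choose a) = fact n / (fact a * fact (n - a))"
    using a by (rule binomial_fact)
  have eq: "ln (real (n choose a) * fact t / real n ^ t) = ln (fact n) - ln (fact a) - ln (fact (n - a)) + ln (fact t) - real t * ln (real n)"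
    unfolding ch using n by (simp add: ln_mult ln_div ln_realpow)
  have na: "real (n - a) = real n - real a" using a by (simp add: of_nat_diff)
  show "ln (real (n choose a) * fact t / real n ^ t) \<le>
      ln (real n + 1) + ln (real t + 1) + 2 - real n * entropy_part (real a / real n) (real t / real n)"
    using ln_fact_le[of n] ln_fact_le[of t] ln_fact_ge[of a] ln_fact_ge[of "n - a"]
    unfolding eq entropy_part_scaled[OF n a] na by linarith
  have "ln (real a + 1) \<le> ln (real n + 1)" "ln (real (n - a) + 1) \<le> ln (real n + 1)"
    using a by (auto intro!: ln_mono)
  then show "- real n * entropy_part (real a / real n) (real t / real n) - 2 * ln (real n + 1) - 2 \<le>
      ln (real (n choose a) * fact t / real n ^ t)"
    using ln_fact_ge[of n] ln_fact_ge[of t] ln_fact_le[of a] ln_fact_le[of "n - a"] entropy_part_scaled[OF n a, of t]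
    unfolding eq na by linarith
qed

text \<open>The word has \<open>t + 1\<close> letters while the exponent is taken at
  \<open>t\<close>: the extra letter yields a factor \<open>(t + 1) / n\<close> and a
  \<open>1 / y\<close>. The rest of the prefactor comes from Stirling's bounds.\<close>

lemma prob_absorbed_at_le_exp:
  assumes n: "n \<ge> 1" and a: "a \<le> n" and y: "0 < y" and s: "summable (\<lambda>k. pmf \<mu> k * exp \<alpha> ^ k)"
  shows "model_prob \<mu> n t (absorbed_at t a) \<le>
    2 * exp 2 * (real t + 1) ^ 2 / y * exp (- real n * rate_potential \<mu> y \<alpha> (real a / real n, real t / real n))"
proof -
  let ?r = "real a / real n" and ?x = "real t / real n"
  have n0: "0 < real n" using n by simp
  have c1: "cpow exp_wt a (Suc t) \<le> (exp y - 1) ^ a / y ^ Suc t"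
  proof -
    have "cpow exp_wt a (Suc t) * y ^ Suc t \<le> (\<Sum>k. exp_wt k * y ^ k) ^ a"
      by (rule cpow_chernoff) (use y exp_wt_nonneg sums_summable[OF exp_wt_sums] in auto)
    then show ?thesis using y sums_unique[OF exp_wt_sums[of y]] by (simp add: pos_le_divide_eq del: power_Suc)
  qed
  have c2: "cpow (pmf \<mu>) a t \<le> pgf \<mu> (exp \<alpha>) ^ a / exp \<alpha> ^ t"
  proof -
    have "cpow (pmf \<mu>) a t * exp \<alpha> ^ t \<le> pgf \<mu> (exp \<alpha>) ^ a"
      unfolding pgf_def by (rule cpow_chernoff) (use s in auto)
    then show ?thesis by (simp add: pos_le_divide_eq)
  qed
  have pg: "0 < pgf \<mu> (exp \<alpha>)" by (rule pgf_pos[OF _ s]) simp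
  have ey: "0 < exp y - 1" using y by simp
  have B: "real (n choose a) * fact t / real n ^ t \<le> exp (ln (real n + 1) + ln (real t + 1) + 2 - real n * entropy_part ?r ?x)"
  proof -
    have p: "0 < real (n choose a) * fact t / real n ^ t" using n0 a by simp
    then have "real (n choose a) * fact t / real n ^ t = exp (ln (real (n choose a) * fact t / real n ^ t))" by simp
    also have "\<dots> \<le> exp (ln (real n + 1) + ln (real t + 1) + 2 - real n * entropy_part ?r ?x)"
      using ln_binomial_fact(1)[OF n a, of t] by (simp only: exp_le_cancel_iff)
    finally show ?thesis .
  qed
  have "model_prob \<mu> n t (absorbed_at t a) \<le>
    real (card (words n (Suc t) a)) / real n ^ Suc t * cpow (pmf \<mu>) a t" by (rule prob_absorbed_at_le[OF n])
  also have "\<dots> = (real (n choose a) * fact t / real n ^ t) * ((real t + 1) / real n) * cpow exp_wt a (Suc t) * cpow (pmf \<mu>) a t"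
    unfolding card_words using n0 by (simp add: field_simps)
  also have "\<dots> \<le> exp (ln (real n + 1) + ln (real t + 1) + 2 - real n * entropy_part ?r ?x) * ((real t + 1) / real n)
      * ((exp y - 1) ^ a / y ^ Suc t) * (pgf \<mu> (exp \<alpha>) ^ a / exp \<alpha> ^ t)"
    using n0 ey y pg
    by (intro mult_mono B c1 c2 mult_nonneg_nonneg divide_nonneg_nonneg cpow_nonneg exp_wt_nonneg) auto
  also have "\<dots> = ((real n + 1) / real n) * ((real t + 1) * (real t + 1) * exp 2 / y) *
     (exp (- (real n * entropy_part ?r ?x)) * (((exp y - 1) ^ a / y ^ t) * (pgf \<mu> (exp \<alpha>) ^ a / exp \<alpha> ^ t)))"
    using n0 y by (simp add: exp_add exp_diff exp_minus field_simps)
  also have "exp (- (real n * entropy_part ?r ?x)) * (((exp y - 1) ^ a / y ^ t) * (pgf \<mu> (exp \<alpha>) ^ a / exp \<alpha> ^ t))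
      = exp (- real n * rate_potential \<mu> y \<alpha> (?r, ?x))"
  proof -
    have e1: "(exp y - 1) ^ a = exp (real a * ln (exp y - 1))" using ey by (simp add: exp_of_nat_mult)
    have e2: "y ^ t = exp (real t * ln y)" using y by (simp add: exp_of_nat_mult)
    have e3: "pgf \<mu> (exp \<alpha>) ^ a = exp (real a * ln (pgf \<mu> (exp \<alpha>)))" using pg by (simp add: exp_of_nat_mult)
    have e4: "exp \<alpha> ^ t = exp (real t * \<alpha>)" by (simp add: exp_of_nat_mult)
    have "real n * rate_potential \<mu> y \<alpha> (?r, ?x) = real n * entropy_part ?r ?x +
       (real t * ln y - real a * ln (exp y - 1)) + (real t * \<alpha> - real a * ln (pgf \<mu> (exp \<alpha>)))"
      using n0 by (simp add: rate_potential_def surj_potential_def distrib_left right_diff_distrib)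
    then show ?thesis unfolding e1 e2 e3 e4 by (simp add: exp_add[symmetric] exp_diff[symmetric])
  qed
  also have "((real n + 1) / real n) * ((real t + 1) * (real t + 1) * exp 2 / y) * exp (- real n * rate_potential \<mu> y \<alpha> (?r, ?x))
     \<le> 2 * ((real t + 1) * (real t + 1) * exp 2 / y) * exp (- real n * rate_potential \<mu> y \<alpha> (?r, ?x))"
    using n y by (intro mult_right_mono) (auto simp: field_simps)
  finally show ?thesis by (simp add: power2_eq_square mult_ac)
qed

lemma prob_absorbed_at_ge_exp:
  assumes n: "n \<ge> 1" and a: "1 \<le> a" "a \<le> n"
  shows "exp (- real n * entropy_part (real a / real n) (real t / real n) - 2 * ln (real n + 1) - 2)
     * cpow exp_wt a t * cpow (pmf \<mu>) a t / (real n * real a * (real t + 1))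
     \<le> model_prob \<mu> n t (absorbed_at t a)"
proof -
  have n0: "0 < real n" using n by simp
  have cn: "0 \<le> cpow exp_wt a t" "0 \<le> cpow (pmf \<mu>) a t" by (auto intro: cpow_nonneg exp_wt_nonneg)
  \<comment> \<open>The word count involves the coefficient at \<open>t + 1\<close>; the recursion
    bounds it below by the one at \<open>t\<close>, where slopes are measured.\<close>
  have "real (Suc t) * cpow exp_wt a (Suc t) \<ge> cpow exp_wt a t"
  proof -
    obtain b where b: "a = Suc b" using a by (cases a) auto
    have nn: "0 \<le> cpow exp_wt b t" by (rule cpow_nonneg) (rule exp_wt_nonneg)
    have "cpow exp_wt a t \<le> real (Suc b) * cpow exp_wt a t" using cn by (simp add: algebra_simps)
    also have "\<dots> \<le> real (Suc b) * (cpow exp_wt a t + cpow exp_wt b t)" using nn by (intro mult_left_mono) auto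
    also have "\<dots> = real (Suc t) * cpow exp_wt a (Suc t)" unfolding b cpow_exp_wt_rec ..
    finally show ?thesis .
  qed
  then have w: "real (n choose a) * fact t / real n ^ t * cpow exp_wt a t / real n \<le> real (card (words n (Suc t) a)) / real n ^ Suc t"
  proof -
    assume le: "cpow exp_wt a t \<le> real (Suc t) * cpow exp_wt a (Suc t)"
    have "real (n choose a) * fact t / real n ^ t * cpow exp_wt a t / real n \<le>
       real (n choose a) * fact t / real n ^ t * (real (Suc t) * cpow exp_wt a (Suc t)) / real n"
      using n0 by (intro divide_right_mono mult_left_mono le) auto
    also have "\<dots> = real (card (words n (Suc t) a)) / real n ^ Suc t"
      unfolding card_words using n0 by (simp add: field_simps)
    finally show ?thesis .
  qed
  have p: "0 < real (n choose a) * fact t / real n ^ t" using n0 a by simp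
  have "exp (- real n * entropy_part (real a / real n) (real t / real n) - 2 * ln (real n + 1) - 2) \<le> real (n choose a) * fact t / real n ^ t"
    using ln_binomial_fact(2)[OF n a(2), of t] p by (subst ln_ge_iff[symmetric]) auto
  then have "exp (- real n * entropy_part (real a / real n) (real t / real n) - 2 * ln (real n + 1) - 2)
     * cpow exp_wt a t * cpow (pmf \<mu>) a t / (real n * real a * (real t + 1)) \<le>
     real (n choose a) * fact t / real n ^ t * cpow exp_wt a t * cpow (pmf \<mu>) a t / (real n * real a * (real t + 1))"
    using cn by (intro divide_right_mono mult_right_mono) auto
  also have "\<dots> = real (n choose a) * fact t / real n ^ t * cpow exp_wt a t / real n * cpow (pmf \<mu>) a t / (real a * real (Suc t))"
    by (simp add: mult_ac)
  also have "\<dots> \<le> real (card (words n (Suc t) a)) / real n ^ Suc t * cpow (pmf \<mu>) a t / (real a * real (Suc t))"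
    using cn by (intro divide_right_mono mult_right_mono w) auto
  also have "\<dots> \<le> model_prob \<mu> n t (absorbed_at t a)"
    by (rule prob_absorbed_at_ge[OF n a(1)])
  finally show ?thesis .
qed

lemma prob_absorbed_at_one_ge:
  assumes n: "n \<ge> 1"
  shows "pmf \<mu> k / (real n ^ k * (real k + 1)) \<le> model_prob \<mu> n k (absorbed_at k 1)"
proof -
  have "real (card (words n (Suc k) 1)) = real n"
    unfolding card_words by (simp add: cpow_1 exp_wt_def)
  then have "pmf \<mu> k / (real n ^ k * (real k + 1)) = real (card (words n (Suc k) 1)) / real n ^ Suc k * cpow (pmf \<mu>) 1 k / (real (1::nat) * real (Suc k))"
    using n by (simp add: cpow_1 field_simps)
  also have "\<dots> \<le> model_prob \<mu> n k (absorbed_at k 1)"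
    by (rule prob_absorbed_at_ge[OF n]) simp
  finally show ?thesis .
qed

section \<open>Absorption points of the chain\<close>

definition absorption_point :: "nat \<Rightarrow> (nat \<Rightarrow> 'w \<Rightarrow> nat) \<Rightarrow> (nat \<Rightarrow> 'w \<Rightarrow> nat) \<Rightarrow> 'w \<Rightarrow> real \<times> real" where
  "absorption_point n N S \<omega> = (real (N (absorption_time S \<omega>) \<omega>) / real n, real (absorption_time S \<omega>) / real n)"

abbreviation hits :: "nat \<Rightarrow> 'w measure \<Rightarrow> (nat \<Rightarrow> 'w \<Rightarrow> nat) \<Rightarrow> (nat \<Rightarrow> 'w \<Rightarrow> nat) \<Rightarrow> (real \<times> real) set \<Rightarrow> 'w set" where
  "hits n M N S F \<equiv> {\<omega> \<in> space M. absorption_point n N S \<omega> \<in> F}"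

lemma absorption_time_eq:
  assumes "S t \<omega> = 0" "\<And>i. i < t \<Longrightarrow> 0 < S i \<omega>"
  shows "absorption_time S \<omega> = t"
  unfolding absorption_time_def using assms by (intro Least_equality) (auto simp: not_less[symmetric] dest: gr_implies_not0)

lemma absorption_point_measurable:
  fixes N S :: "nat \<Rightarrow> 'w \<Rightarrow> nat"
  assumes "is_chain \<mu> n M N S"
  shows "absorption_point n N S \<in> M \<rightarrow>\<^sub>M restrict_space borel ({0..} \<times> {0..})"
proof (rule measurable_restrict_space2)
  have [measurable]: "\<And>t. N t \<in> M \<rightarrow>\<^sub>M count_space UNIV" "\<And>t. S t \<in> M \<rightarrow>\<^sub>M count_space UNIV"
    using assms by (auto simp: is_chain_def)
  have t: "absorption_time S \<in> M \<rightarrow>\<^sub>M count_space UNIV"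
    unfolding absorption_time_def[abs_def] by measurable
  have "(\<lambda>\<omega>. (real (N t \<omega>) / real n, real t / real n)) \<in> M \<rightarrow>\<^sub>M borel" for t by measurable
  from measurable_compose_countable[OF this t]
  show "absorption_point n N S \<in> M \<rightarrow>\<^sub>M borel" unfolding absorption_point_def[abs_def] .
qed (auto simp: absorption_point_def)

lemma chain_absorbed_prob:
  fixes N S :: "nat \<Rightarrow> 'w \<Rightarrow> nat"
  assumes ch: "is_chain \<mu> n M N S" and n: "n \<ge> 1"
  shows "measure M {\<omega> \<in> space M. N t \<omega> = a \<and> S t \<omega> = 0 \<and> (\<forall>i<t. 0 < S i \<omega>)} =
     model_prob \<mu> n t (absorbed_at t a)"
proof -
  have "measure M {\<omega> \<in> space M. chain_path N S t \<omega> ! t = (a, 0) \<and> (\<forall>i<t. 0 < snd (chain_path N S t \<omega> ! i))} =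
    model_prob \<mu> n t {\<omega>. model_path t \<omega> ! t = (a, 0) \<and> (\<forall>i<t. 0 < snd (model_path t \<omega> ! i))}"
    by (rule chain_prob_eq_model[OF ch n])
  moreover have "chain_path N S t \<omega> ! i = (N i \<omega>, S i \<omega>)" "model_path t \<omega>' ! i = chain_state i \<omega>'" if "i \<le> t" for i \<omega> \<omega>'
    using that by (simp_all add: chain_path_def model_path_def nth_append del: upt_Suc)
  ultimately show ?thesis by (simp add: absorbed_at_def)
qed

lemma prob_absorption_point_ge:
  fixes N S :: "nat \<Rightarrow> 'w \<Rightarrow> nat"
  assumes ch: "is_chain \<mu> n M N S" and n: "n \<ge> 1"
    and U: "openin (top_of_set ({0..} \<times> {0..})) U" and at: "(real a / real n, real t / real n) \<in> U"
  shows "ennreal (model_prob \<mu> n t (absorbed_at t a)) \<le>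
     emeasure M (hits n M N S U)"
proof -
  interpret prob_space M using ch by (simp add: is_chain_def)
  obtain V where V: "open V" "U = ({0..} \<times> {0..}) \<inter> V" using U by (auto simp: openin_open)
  have "U \<in> sets (restrict_space borel ({0..} \<times> {0..}))" using V by (auto simp: sets_restrict_space)
  then have meas: "(hits n M N S U) \<in> sets M"
    using measurable_sets[OF absorption_point_measurable[OF ch]] by (simp add: vimage_def Int_def conj_commute)
  have "{\<omega> \<in> space M. N t \<omega> = a \<and> S t \<omega> = 0 \<and> (\<forall>i<t. 0 < S i \<omega>)} \<subseteq> (hits n M N S U)"
    using at by (auto simp: absorption_point_def absorption_time_eq)
  then have "measure M {\<omega> \<in> space M. N t \<omega> = a \<and> S t \<omega> = 0 \<and> (\<forall>i<t. 0 < S i \<omega>)} \<le> measure M (hits n M N S U)"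
    using meas by (intro finite_measure_mono)
  then show ?thesis unfolding chain_absorbed_prob[OF ch n] emeasure_eq_measure by (rule ennreal_leI)
qed

text \<open>
  The event \<open>0 < S T\<close> also contains all paths that are never absorbed, where \<open>absorption_time\<close> is junk.
\<close>

lemma prob_absorption_point_le:
  fixes N S :: "nat \<Rightarrow> 'w \<Rightarrow> nat"
  assumes ch: "is_chain \<mu> n M N S" and n: "n \<ge> 1"
    and b: "\<And>a t. a \<le> n \<Longrightarrow> t \<le> T \<Longrightarrow> (real a / real n, real t / real n) \<in> F \<Longrightarrow>
       model_prob \<mu> n t (absorbed_at t a) \<le> B"
    and B: "0 \<le> B"
  shows "emeasure M (hits n M N S F) \<le>
     ennreal (model_prob \<mu> n T {\<omega>. 0 < snd (chain_state T \<omega>)} + (real n + 1) * (real T + 1) * B)"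
proof -
  interpret prob_space M using ch by (simp add: is_chain_def)
  have [measurable]: "\<And>t. N t \<in> M \<rightarrow>\<^sub>M count_space UNIV" "\<And>t. S t \<in> M \<rightarrow>\<^sub>M count_space UNIV"
    using ch by (auto simp: is_chain_def)
  have pth: "chain_path N S t \<omega> ! i = (N i \<omega>, S i \<omega>)" "model_path t \<omega>' ! i = chain_state i \<omega>'" if "i \<le> t" for i t \<omega> \<omega>'
    using that by (simp_all add: chain_path_def model_path_def nth_append del: upt_Suc)
  define E where "E t = {\<omega> \<in> space M. S t \<omega> = 0 \<and> (\<forall>i<t. 0 < S i \<omega>) \<and> (real (N t \<omega>) / real n, real t / real n) \<in> F}" for t
  define G where "G = {\<omega> \<in> space M. 0 < S T \<omega>}"
  have E_meas: "E t \<in> sets M" for t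
  proof -
    have "E t = (\<Union>a\<in>{a. (real a / real n, real t / real n) \<in> F}. {\<omega> \<in> space M. N t \<omega> = a \<and> S t \<omega> = 0 \<and> (\<forall>i<t. 0 < S i \<omega>)})"
      by (auto simp: E_def)
    also have "\<dots> \<in> sets M" by (rule sets.countable_UN') auto
    finally show ?thesis .
  qed
  have G_meas: "G \<in> sets M" unfolding G_def by measurable
  have sub: "(hits n M N S F) \<subseteq> G \<union> (\<Union>t\<le>T. E t)"
  proof
    fix \<omega> assume w: "\<omega> \<in> (hits n M N S F)"
    show "\<omega> \<in> G \<union> (\<Union>t\<le>T. E t)"
    proof (cases "0 < S T \<omega>")
      case True
      then show ?thesis using w by (simp add: G_def)
    next
      case False
      then have ST: "S T \<omega> = 0" by simp
      define t where "t = absorption_time S \<omega>"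
      have "S t \<omega> = 0" unfolding t_def absorption_time_def using ST by (rule LeastI)
      moreover have "t \<le> T" unfolding t_def absorption_time_def using ST by (rule Least_le)
      moreover have "0 < S i \<omega>" if "i < t" for i
        using that not_less_Least[of i "\<lambda>t. S t \<omega> = 0"] by (auto simp: t_def absorption_time_def)
      ultimately show ?thesis using w by (auto simp: E_def absorption_point_def t_def[symmetric])
    qed
  qed
  have G_prob: "prob G = model_prob \<mu> n T {\<omega>. 0 < snd (chain_state T \<omega>)}"
    using chain_prob_eq_model[OF ch n, where t = T and P = "\<lambda>p. 0 < snd (p ! T)"] by (simp add: G_def pth)
  have E_prob: "prob (E t) \<le> (real n + 1) * B" if t: "t \<le> T" for t
  proof -
    let ?D = "model_prob \<mu> n t"
    have "prob (E t) = measure M {\<omega> \<in> space M. snd (chain_path N S t \<omega> ! t) = 0 \<and> (\<forall>i<t. 0 < snd (chain_path N S t \<omega> ! i)) \<and> (real (fst (chain_path N S t \<omega> ! t)) / real n, real t / real n) \<in> F}"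
      by (simp add: E_def pth)
    also have "\<dots> = ?D {\<omega>. snd (model_path t \<omega> ! t) = 0 \<and> (\<forall>i<t. 0 < snd (model_path t \<omega> ! i)) \<and> (real (fst (model_path t \<omega> ! t)) / real n, real t / real n) \<in> F}"
      by (rule chain_prob_eq_model[OF ch n])
    also have "\<dots> = ?D ({\<omega>. snd (chain_state t \<omega>) = 0 \<and> (\<forall>i<t. 0 < snd (chain_state i \<omega>)) \<and> (real (fst (chain_state t \<omega>)) / real n, real t / real n) \<in> F} \<inter> set_pmf (model \<mu> n (Suc t)))"
      unfolding measure_Int_set_pmf by (simp add: pth)
    also have "\<dots> \<le> ?D (\<Union>a\<in>{a. a \<le> n \<and> (real a / real n, real t / real n) \<in> F}. absorbed_at t a)"
    proof (intro measure_pmf.finite_measure_mono subsetI)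
      fix \<omega> assume "\<omega> \<in> {\<omega>. snd (chain_state t \<omega>) = 0 \<and> (\<forall>i<t. 0 < snd (chain_state i \<omega>)) \<and> (real (fst (chain_state t \<omega>)) / real n, real t / real n) \<in> F} \<inter> set_pmf (model \<mu> n (Suc t))"
      then have w: "snd (chain_state t \<omega>) = 0" "\<forall>i<t. 0 < snd (chain_state i \<omega>)" "(real (fst (chain_state t \<omega>)) / real n, real t / real n) \<in> F"
        and s: "\<omega> \<in> set_pmf (model \<mu> n (Suc t))" by auto
      from set_pmf_model[OF n s] have l: "length (fst \<omega>) = Suc t" "set (fst \<omega>) \<subseteq> {..<n}" "length (snd \<omega>) = card (set (fst \<omega>))" by auto
      have "\<forall>j<t. j < supplied \<omega> j" using w(2) chain_state_pos_iff[OF l(3)] l(1) by auto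
      then have "fst (chain_state t \<omega>) = ndist (fst \<omega>) t" using chain_state_alive[OF l(3), of t] l(1) by auto
      also have "\<dots> \<le> card (set (fst \<omega>))" by (rule ndist_le)
      also have "\<dots> \<le> n" using card_mono[OF _ l(2)] by simp
      finally have "fst (chain_state t \<omega>) \<le> n" .
      moreover have "\<omega> \<in> absorbed_at t (fst (chain_state t \<omega>))"
        using w by (simp add: absorbed_at_def prod_eq_iff)
      ultimately show "\<omega> \<in> (\<Union>a\<in>{a. a \<le> n \<and> (real a / real n, real t / real n) \<in> F}. absorbed_at t a)" using w(3) by blast
    qed auto
    also have "\<dots> \<le> (\<Sum>a\<in>{a. a \<le> n \<and> (real a / real n, real t / real n) \<in> F}. ?D (absorbed_at t a))"
      by (intro measure_pmf.finite_measure_subadditive_finite) auto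
    also have "\<dots> \<le> (\<Sum>a\<in>{a. a \<le> n \<and> (real a / real n, real t / real n) \<in> F}. B)"
      using b t by (intro sum_mono) auto
    also have "\<dots> = real (card {a. a \<le> n \<and> (real a / real n, real t / real n) \<in> F}) * B" by simp
    also have "\<dots> \<le> (real n + 1) * B"
    proof (intro mult_right_mono B)
      have "card {a. a \<le> n \<and> (real a / real n, real t / real n) \<in> F} \<le> card {..n}" by (intro card_mono) auto
      then show "real (card {a. a \<le> n \<and> (real a / real n, real t / real n) \<in> F}) \<le> real n + 1" by simp
    qed
    finally show ?thesis .
  qed
  have "emeasure M (hits n M N S F) \<le> emeasure M (G \<union> (\<Union>t\<le>T. E t))"
    using E_meas G_meas by (intro emeasure_mono sub sets.Un sets.finite_UN) auto
  also have "\<dots> = ennreal (prob (G \<union> (\<Union>t\<le>T. E t)))" by (rule emeasure_eq_measure)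
  also have "\<dots> \<le> ennreal (prob G + (real n + 1) * (real T + 1) * B)"
  proof (rule ennreal_leI)
    have "prob (G \<union> (\<Union>t\<le>T. E t)) \<le> prob G + prob (\<Union>t\<le>T. E t)"
      using E_meas G_meas by (intro measure_Un_le sets.finite_UN) auto
    also have "prob (\<Union>t\<le>T. E t) \<le> (\<Sum>t\<le>T. prob (E t))"
      using E_meas by (intro finite_measure_subadditive_finite) auto
    also have "\<dots> \<le> (\<Sum>t\<le>T. (real n + 1) * B)" using E_prob by (intro sum_mono) auto
    also have "\<dots> = (real n + 1) * (real T + 1) * B" by (simp add: algebra_simps)
    finally show "prob (G \<union> (\<Union>t\<le>T. E t)) \<le> prob G + (real n + 1) * (real T + 1) * B" by simp
  qed
  finally show ?thesis unfolding G_prob .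
qed

lemma ln_ennreal_mono: "x \<le> y \<Longrightarrow> ln_ennreal x \<le> ln_ennreal y"
proof -
  assume le: "x \<le> y"
  show ?thesis
  proof (cases "x = 0 \<or> y = \<infinity>")
    case False
    then have "0 < x" "x < \<infinity>" "y < \<infinity>" using le by (auto simp: less_top top_unique zero_less_iff_neq_zero)
    then have "0 < enn2real x" "enn2real x \<le> enn2real y"
      using le by (auto simp: enn2real_positive_iff intro!: enn2real_mono)
    then show ?thesis using False le by (auto simp: ln_ennreal_def intro!: ln_mono)
  qed (use le in \<open>auto simp: ln_ennreal_def\<close>)
qed

lemma ln_ennreal_ennreal: "0 < x \<Longrightarrow> ln_ennreal (ennreal x) = ereal (ln x)"
  by (simp add: ln_ennreal_def)

section \<open>Upper bound for closed sets\<close>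

text \<open>Finitely many tilts witness the level \<open>c\<close> on all of \<open>K\<close>, which
  makes the prefactors of the point estimates uniform.\<close>

lemma chain_rate_compact_cover:
  assumes K: "compact K" "K \<subseteq> {0..1} \<times> {0..}" and c: "\<And>x. x \<in> K \<Longrightarrow> ereal c < chain_rate \<mu> x"
  shows "\<exists>D. finite D \<and> (\<forall>(y, \<alpha>)\<in>D. 0 < y \<and> summable (\<lambda>k. pmf \<mu> k * exp \<alpha> ^ k)) \<and>
     (\<forall>x\<in>K. \<exists>(y, \<alpha>)\<in>D. c < rate_potential \<mu> y \<alpha> x)"
proof -
  let ?P = "{(y, \<alpha>). 0 < y \<and> summable (\<lambda>k. pmf \<mu> k * exp \<alpha> ^ k)}"
  define W where "W p = K \<inter> (case p of (y, \<alpha>) \<Rightarrow> rate_potential \<mu> y \<alpha>) -` {c<..}" for p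
  have "\<forall>U\<in>W ` ?P. openin (top_of_set K) U"
  proof
    fix U assume "U \<in> W ` ?P"
    then obtain y \<alpha> where U: "U = K \<inter> rate_potential \<mu> y \<alpha> -` {c<..}" by (auto simp: W_def)
    have "continuous_on K (rate_potential \<mu> y \<alpha>)"
      by (rule continuous_on_subset[OF continuous_on_rate_potential]) (use K in auto)
    then show "openin (top_of_set K) U" unfolding U by (rule continuous_openin_preimage_gen) simp
  qed
  moreover have "K \<subseteq> \<Union> (W ` ?P)"
  proof
    fix x assume x: "x \<in> K"
    obtain r t where rt: "x = (r, t)" by (cases x)
    have "0 \<le> r" "r \<le> 1" "0 \<le> t" using x K rt by auto
    from less_chain_rate_iff[OF this, of c \<mu>] c[OF x] obtain y \<alpha> where
      "0 < y" "summable (\<lambda>k. pmf \<mu> k * exp \<alpha> ^ k)" "c < rate_potential \<mu> y \<alpha> x" unfolding rt by blast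
    then show "x \<in> \<Union> (W ` ?P)" using x by (auto simp: W_def)
  qed
  ultimately obtain \<D> where D: "\<D> \<subseteq> W ` ?P" "finite \<D>" "K \<subseteq> \<Union>\<D>"
    using K(1) unfolding compact_eq_openin_cover by meson
  from finite_subset_image[OF D(2,1)] obtain D where "D \<subseteq> ?P" "finite D" "\<D> = W ` D" by blast
  then show ?thesis using D(3) by (intro exI[of _ D]) (fastforce simp: W_def)
qed

lemma absorption_point_ldp_upper:
  fixes M :: "nat \<Rightarrow> 'w measure" and N S :: "nat \<Rightarrow> nat \<Rightarrow> 'w \<Rightarrow> nat"
  assumes ch: "\<And>n. n \<ge> 1 \<Longrightarrow> is_chain \<mu> n (M n) (N n) (S n)"
    and a0: "0 < a0" "mgf \<mu> a0 < \<infinity>"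
    and F: "closedin (top_of_set ({0..} \<times> {0..})) F" and c: "ereal c < (INF x\<in>F. chain_rate \<mu> x)"
  shows "limsup (\<lambda>n. ereal (1 / real n) * ln_ennreal (emeasure (M n)
     (hits n (M n) (N n) (S n) F))) \<le> ereal (- c)"
proof -
  have s0: "summable (\<lambda>k. pmf \<mu> k * exp a0 ^ k)" using mgf_eq_top a0(2) by fastforce
  define M0 where "M0 = pgf \<mu> (exp a0)"
  have M0: "0 < M0" unfolding M0_def by (rule pgf_pos[OF _ s0]) simp
  have nnM0: "(\<integral>\<^sup>+k. ennreal (exp a0 ^ k) \<partial>measure_pmf \<mu>) = ennreal M0"
    using mgf_eq_pgf[OF s0] by (simp add: mgf_def M0_def exp_of_nat2_mult)
  \<comment> \<open>Chosen so that survival up to time \<open>C n\<close> has probability at most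
    M0^n exp (- a0 C n) \<le> exp (- c n).\<close>
  obtain C0 :: nat where C0: "(ln M0 + c) / a0 \<le> real C0" using real_arch_simple by blast
  define C where "C = max 1 C0"
  have C: "0 < real C" "ln M0 - real C * a0 \<le> - c"
  proof -
    show "0 < real C" by (simp add: C_def)
    have "ln M0 + c \<le> real C0 * a0" using C0 a0 by (simp add: field_simps)
    also have "\<dots> \<le> real C * a0" using a0 by (intro mult_right_mono) (auto simp: C_def)
    finally show "ln M0 - real C * a0 \<le> - c" by simp
  qed
  have Fsub: "F \<subseteq> {0..} \<times> {0..}" using closedin_imp_subset[OF F] by simp
  have "closed F" by (rule closedin_closed_trans[OF F]) (intro closed_Times closed_atLeast)
  then have K: "compact (F \<inter> ({0..1} \<times> {0..real C}))"
    by (intro closed_Int_compact compact_Times compact_Icc)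
  have cK: "ereal c < chain_rate \<mu> x" if "x \<in> F \<inter> ({0..1} \<times> {0..real C})" for x
    using c that by (auto simp: less_INF_D)
  obtain D where D: "finite D" "\<And>y \<alpha>. (y, \<alpha>) \<in> D \<Longrightarrow> 0 < y \<and> summable (\<lambda>k. pmf \<mu> k * exp \<alpha> ^ k)"
    and cov: "\<And>x. x \<in> F \<inter> ({0..1} \<times> {0..real C}) \<Longrightarrow> \<exists>(y, \<alpha>)\<in>D. c < rate_potential \<mu> y \<alpha> x"
    using chain_rate_compact_cover[OF K _ cK] by fastforce
  \<comment> \<open>Bounds the prefactors \<open>1 / y\<close> over the finite cover; the element 1
    keeps the minimum meaningful if \<open>D\<close> is empty.\<close>
  define m where "m = Min (insert 1 (fst ` D))"
  have m: "0 < m" "\<And>y \<alpha>. (y, \<alpha>) \<in> D \<Longrightarrow> m \<le> y"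
    using D by (auto simp: m_def intro!: Min_le rev_image_eqI)
  define Q where "Q = 2 * exp 2 / m"
  have Q: "0 < Q" using m by (simp add: Q_def)
  \<comment> \<open>The summand 1 pays for survival; the product counts heights and times and
    includes the prefactor. All of it is polynomial in \<open>n\<close>.\<close>
  define B where "B n = 1 + (real n + 1) * (real C * real n + 1) * (Q * (real C * real n + 1) ^ 2)" for n :: nat
  have B: "0 < B n" for n unfolding B_def using Q by (intro add_pos_nonneg mult_nonneg_nonneg) auto
  have bound: "ereal (1 / real n) * ln_ennreal (emeasure (M n)
     (hits n (M n) (N n) (S n) F)) \<le> ereal (ln (B n) / real n - c)" if n: "n \<ge> 1" for n
  proof -
    have n0: "0 < real n" using n by simp
    have "emeasure (M n) (hits n (M n) (N n) (S n) F) \<le>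
      ennreal (model_prob \<mu> n (C * n) {\<omega>. 0 < snd (chain_state (C * n) \<omega>)}
        + (real n + 1) * (real (C * n) + 1) * (Q * (real C * real n + 1) ^ 2 * exp (- real n * c)))"
    proof (rule prob_absorption_point_le[OF ch[OF n] n])
      fix a t assume a: "a \<le> n" and t: "t \<le> C * n" and inF: "(real a / real n, real t / real n) \<in> F"
      have "real t \<le> real C * real n" using t by (metis of_nat_le_iff of_nat_mult)
      then have tn: "real t / real n \<le> real C" using n0 by (simp add: field_simps)
      have "(real a / real n, real t / real n) \<in> F \<inter> ({0..1} \<times> {0..real C})" using a n0 inF tn by auto
      from cov[OF this] obtain y \<alpha> where D': "(y, \<alpha>) \<in> D" and G: "c < rate_potential \<mu> y \<alpha> (real a / real n, real t / real n)" by auto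
      have y: "0 < y" and s: "summable (\<lambda>k. pmf \<mu> k * exp \<alpha> ^ k)" using D(2)[OF D'] by auto
      have "model_prob \<mu> n t (absorbed_at t a) \<le>
        2 * exp 2 * (real t + 1) ^ 2 / y * exp (- real n * rate_potential \<mu> y \<alpha> (real a / real n, real t / real n))"
        by (rule prob_absorbed_at_le_exp[OF n a y s])
      also have "\<dots> \<le> 2 * exp 2 * (real C * real n + 1) ^ 2 / m * exp (- real n * c)"
        using G m(1) m(2)[OF D'] y n0 \<open>real t \<le> real C * real n\<close>
        by (intro mult_mono frac_le power_mono) auto
      finally show "model_prob \<mu> n t (absorbed_at t a) \<le> Q * (real C * real n + 1) ^ 2 * exp (- real n * c)"
        by (simp add: Q_def)
    qed (use Q in simp)
    also have "\<dots> \<le> ennreal (exp (- real n * c) * B n)"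
    proof (rule ennreal_leI)
      have "model_prob \<mu> n (C * n) {\<omega>. 0 < snd (chain_state (C * n) \<omega>)} \<le> M0 ^ n / exp a0 ^ (C * n)"
        by (rule prob_alive_le[OF n _ nnM0]) (use a0 in simp)
      also have "\<dots> = exp (real n * (ln M0 - real C * a0))"
        using M0 by (simp add: right_diff_distrib exp_diff exp_of_nat_mult exp_of_nat2_mult power_mult[symmetric] mult_ac) (simp add: exp_of_nat_mult[symmetric] mult_ac)
      also have "\<dots> \<le> exp (real n * (- c))" unfolding exp_le_cancel_iff using n0 by (intro mult_left_mono C(2)) auto
      finally show "model_prob \<mu> n (C * n) {\<omega>. 0 < snd (chain_state (C * n) \<omega>)}
        + (real n + 1) * (real (C * n) + 1) * (Q * (real C * real n + 1) ^ 2 * exp (- real n * c)) \<le> exp (- real n * c) * B n"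
        by (simp add: B_def distrib_left mult_ac)
    qed
    finally have "ln_ennreal (emeasure (M n) (hits n (M n) (N n) (S n) F)) \<le> ln_ennreal (ennreal (exp (- real n * c) * B n))"
      by (rule ln_ennreal_mono)
    also have "\<dots> = ereal (ln (B n) - real n * c)"
      using B[of n] by (simp add: ln_ennreal_ennreal ln_mult)
    finally have "ereal (1 / real n) * ln_ennreal (emeasure (M n) (hits n (M n) (N n) (S n) F))
       \<le> ereal (1 / real n) * ereal (ln (B n) - real n * c)" by (rule ereal_mult_left_mono) (use n0 in simp)
    also have "\<dots> = ereal (ln (B n) / real n - c)" using n0 by (simp add: field_simps)
    finally show ?thesis .
  qed
  have "(\<lambda>n. ln (B n) / real n - c) \<longlonglongrightarrow> 0 - c"
  proof (intro tendsto_diff tendsto_const)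
    show "(\<lambda>n. ln (B n) / real n) \<longlonglongrightarrow> 0" unfolding B_def using C(1) Q by real_asymp
  qed
  then have lim: "(\<lambda>n. ereal (ln (B n) / real n - c)) \<longlonglongrightarrow> ereal (- c)" by simp
  have "limsup (\<lambda>n. ereal (1 / real n) * ln_ennreal (emeasure (M n)
     (hits n (M n) (N n) (S n) F))) \<le> limsup (\<lambda>n. ereal (ln (B n) / real n - c))"
    by (intro Limsup_mono eventually_sequentiallyI[of 1] bound)
  also have "\<dots> = ereal (- c)" by (rule lim_imp_Limsup[OF _ lim]) simp
  finally show ?thesis .
qed

section \<open>Lower bound for open sets\<close>

lemma liminf_ln_ennreal_ge:
  fixes p :: "nat \<Rightarrow> ennreal" and q :: "nat \<Rightarrow> real"
  assumes "\<forall>\<^sub>F n in sequentially. 0 < q n \<and> ennreal (q n) \<le> p n"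
    and lim: "(\<lambda>n. ln (q n) / real n) \<longlonglongrightarrow> l"
  shows "ereal l \<le> liminf (\<lambda>n. ereal (1 / real n) * ln_ennreal (p n))"
proof -
  have "ereal l = liminf (\<lambda>n. ereal (ln (q n) / real n))"
    by (rule lim_imp_Liminf[symmetric]) (use lim in auto)
  also have "\<dots> \<le> liminf (\<lambda>n. ereal (1 / real n) * ln_ennreal (p n))"
  proof (rule Liminf_mono)
    show "\<forall>\<^sub>F n in sequentially. ereal (ln (q n) / real n) \<le> ereal (1 / real n) * ln_ennreal (p n)"
      using assms(1)
    proof eventually_elim
      case (elim n)
      then have "ln_ennreal (ennreal (q n)) \<le> ln_ennreal (p n)" by (intro ln_ennreal_mono) auto
      then have "ereal (1 / real n) * ereal (ln (q n)) \<le> ereal (1 / real n) * ln_ennreal (p n)"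
        using elim by (intro ereal_mult_left_mono) (auto simp: ln_ennreal_ennreal)
      then show ?case by simp
    qed
  qed
  finally show ?thesis .
qed

text \<open>Fix an atom \<open>k\<close> of \<mu>. Absorption at time \<open>k\<close> with one
  letter has only polynomially small probability, and the points (1/n, k/n) tend to the
  origin.\<close>

lemma absorption_point_ldp_lower_origin:
  fixes M :: "nat \<Rightarrow> 'w measure" and N S :: "nat \<Rightarrow> nat \<Rightarrow> 'w \<Rightarrow> nat"
  assumes ch: "\<And>n. n \<ge> 1 \<Longrightarrow> is_chain \<mu> n (M n) (N n) (S n)"
    and U: "openin (top_of_set ({0..} \<times> {0..})) U" and x: "(0, 0) \<in> U"
  shows "0 \<le> liminf (\<lambda>n. ereal (1 / real n) * ln_ennreal (emeasure (M n)
     (hits n (M n) (N n) (S n) U)))"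
proof -
  obtain k where "k \<in> set_pmf \<mu>" using set_pmf_not_empty[of \<mu>] by blast
  then have k: "0 < pmf \<mu> k" by (rule pmf_positive)
  obtain V where V: "open V" "U = ({0..} \<times> {0..}) \<inter> V" using U by (auto simp: openin_open)
  have "(\<lambda>n. (real 1 / real n, real k / real n)) \<longlonglongrightarrow> (0, 0)"
    by (intro tendsto_Pair) real_asymp+
  from topological_tendstoD[OF this V(1)] x V(2)
  have "\<forall>\<^sub>F n in sequentially. (real 1 / real n, real k / real n) \<in> V" by auto
  then have ev: "\<forall>\<^sub>F n in sequentially. (real 1 / real n, real k / real n) \<in> U"
    by eventually_elim (simp add: V(2))
  have "ereal 0 \<le> liminf (\<lambda>n. ereal (1 / real n) * ln_ennreal (emeasure (M n)
     (hits n (M n) (N n) (S n) U)))"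
  proof (rule liminf_ln_ennreal_ge)
    show "\<forall>\<^sub>F n in sequentially. 0 < pmf \<mu> k / (real n ^ k * (real k + 1)) \<and>
       ennreal (pmf \<mu> k / (real n ^ k * (real k + 1))) \<le> emeasure (M n) (hits n (M n) (N n) (S n) U)"
      using ev eventually_ge_at_top[of "1::nat"]
    proof eventually_elim
      case (elim n)
      have "ennreal (pmf \<mu> k / (real n ^ k * (real k + 1))) \<le> ennreal (model_prob \<mu> n k (absorbed_at k 1))"
        using elim by (intro ennreal_leI prob_absorbed_at_one_ge)
      also have "\<dots> \<le> emeasure (M n) (hits n (M n) (N n) (S n) U)"
        using elim by (intro prob_absorption_point_ge[OF ch _ U]) auto
      finally show ?case using k elim by simp
    qed
    have "(\<lambda>n. (ln (pmf \<mu> k) - (real k * ln (real n) + ln (real k + 1))) / real n) \<longlonglongrightarrow> 0" by real_asymp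
    moreover have "\<forall>\<^sub>F n in sequentially. (ln (pmf \<mu> k) - (real k * ln (real n) + ln (real k + 1))) / real n = ln (pmf \<mu> k / (real n ^ k * (real k + 1))) / real n"
      using eventually_ge_at_top[of "1::nat"]
      by eventually_elim (use k in \<open>simp add: ln_div ln_mult ln_realpow\<close>)
    ultimately show "(\<lambda>n. ln (pmf \<mu> k / (real n ^ k * (real k + 1))) / real n) \<longlonglongrightarrow> 0"
      by (rule Lim_transform_eventually)
  qed
  then show ?thesis by (simp add: zero_ereal_def)
qed

lemma absorption_point_ldp_lower:
  fixes M :: "nat \<Rightarrow> 'w measure" and N S :: "nat \<Rightarrow> nat \<Rightarrow> 'w \<Rightarrow> nat"
  assumes ch: "\<And>n. n \<ge> 1 \<Longrightarrow> is_chain \<mu> n (M n) (N n) (S n)"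
    and U: "openin (top_of_set ({0..} \<times> {0..})) U" and x: "(r, t) \<in> U" and r: "0 < r"
    and f: "chain_rate \<mu> (r, t) = ereal f" and e: "0 < e"
  shows "ereal (- f - e) \<le> liminf (\<lambda>n. ereal (1 / real n) * ln_ennreal (emeasure (M n)
     (hits n (M n) (N n) (S n) U)))"
proof -
  have cr: "chain_rate \<mu> (r, t) = ereal r * cramer_rate \<mu> (t / r) + J t r" using r by (simp add: chain_rate_def)
  have Jfin: "J t r \<noteq> \<infinity>" using f cramer_rate_nonneg[OF r, of \<mu> t] unfolding cr by auto
  then have rt: "r \<le> min t 1" using J_eq_infinity[of r t] by blast
  then have rt': "r \<le> t" "r \<le> 1" "0 < t" using r by auto
  define A where "A = f - (entropy_part r t + surj_rate t r)"
  have A: "ereal r * cramer_rate \<mu> (t / r) = ereal A"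
    using f unfolding cr J_eq[OF r rt] A_def by (cases "ereal r * cramer_rate \<mu> (t / r)") auto
  define u where "u = t / r"
  have u: "1 \<le> u" "t = r * u" using r rt' by (auto simp: u_def)
  have c1: "\<alpha> * u - ln (\<Sum>k. pmf \<mu> k * exp \<alpha> ^ k) \<le> A / r" if s: "summable (\<lambda>k. pmf \<mu> k * exp \<alpha> ^ k)" for \<alpha>
  proof -
    have "\<not> (A < \<alpha> * t - r * ln (pgf \<mu> (exp \<alpha>)))"
      using less_cramer_rate_iff[OF r, of A \<mu> t] s unfolding A by auto
    then have "r * (\<alpha> * u - ln (pgf \<mu> (exp \<alpha>))) \<le> A" by (simp add: u(2) algebra_simps)
    then show ?thesis using r by (simp add: pgf_def field_simps)
  qed
  have c2: "\<alpha> * u - ln (exp (exp \<alpha>) - 1) \<le> surj_rate t r / r" for \<alpha>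
  proof -
    have "r * (\<alpha> * u - ln (exp (exp \<alpha>) - 1)) \<le> surj_rate t r"
      using surj_rate_upper[OF r rt'(1), of "exp \<alpha>"] by (simp add: surj_potential_def u(2) algebra_simps)
    then show ?thesis using r by (simp add: field_simps)
  qed
  \<comment> \<open>The error budget: \<open>e'\<close> for moving the slope in the entropy part,
    and \<open>r e'\<close> for each of the two coefficient bounds.\<close>
  define e' where "e' = e / (1 + 2 * r)"
  have e': "0 < e'" "e' + r * (2 * e') = e"
  proof -
    have "e' + r * (2 * e') = e' * (1 + 2 * r)" by (simp add: algebra_simps)
    then show "0 < e'" "e' + r * (2 * e') = e" using e r by (auto simp: e'_def)
  qed
  obtain d1 A0 where d1: "0 < d1" and W: "\<And>a m. A0 \<le> a \<Longrightarrow> u * real a \<le> real m \<Longrightarrow> real m < (u + d1) * real a \<Longrightarrow>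
     exp (- (real a * (surj_rate t r / r + e'))) \<le> cpow exp_wt a m"
    using cpow_exp_wt_lower_bound[OF u(1) c2 e'(1)] by blast
  obtain V where V: "open V" "U = ({0..} \<times> {0..}) \<inter> V" using U by (auto simp: openin_open)
  \<comment> \<open>The target is perturbed with \<open>r\<close> fixed: only its slope moves, from
    \<open>u\<close> to \<open>v\<close>.\<close>
  have cont: "((\<lambda>v. entropy_part r (r * v)) \<longlongrightarrow> entropy_part r (r * u)) (at u)"
    unfolding entropy_part_def xlnx_def using r u by (intro tendsto_intros) auto
  have "((\<lambda>v. (r, r * v)) \<longlongrightarrow> (r, r * u)) (at u)" by (intro tendsto_intros)
  then have evV: "\<forall>\<^sub>F v in at u. (r, r * v) \<in> V"
    by (rule topological_tendstoD[OF _ V(1)]) (use x V(2) u(2) in auto)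
  have "\<forall>\<^sub>F v in at u. (r, r * v) \<in> V \<and> entropy_part r (r * v) < entropy_part r (r * u) + e'"
    by (intro eventually_conj evV order_tendstoD(2)[OF cont]) (use e' in simp)
  then obtain d2 where d2: "0 < d2" and near: "\<And>v. v \<noteq> u \<Longrightarrow> dist v u < d2 \<Longrightarrow> (r, r * v) \<in> V \<and> entropy_part r (r * v) < entropy_part r (r * u) + e'"
    unfolding eventually_at by auto
  have near': "(r, r * v) \<in> V \<and> entropy_part r (r * v) < entropy_part r t + e'" if "\<bar>v - u\<bar> < d2" for v
    using near[of v] that x V(2) e' by (cases "v = u") (auto simp: dist_real_def u(2))
  have u0: "0 \<le> u" using u by simp
  obtain k where "k \<in> set_pmf \<mu>" using set_pmf_not_empty[of \<mu>] by blast
  then have k: "0 < pmf \<mu> k" by (rule pmf_positive)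
  \<comment> \<open>The approximation is from above because \<open>W\<close> requires slopes of at
    least \<open>u\<close>; \<open>d1\<close> keeps the slope in the cone of \<open>W\<close>,
    \<open>d2\<close> keeps the point in \<open>U\<close> and its entropy part close.\<close>
  obtain a' t' where a': "1 \<le> a'" and lo: "u \<le> real t' / real a'" and hi: "real t' / real a' < u + min d1 d2"
    and q: "exp (- (real a' * (A / r + e'))) \<le> cpow (pmf \<mu>) a' t'"
    using cpow_lower_bound[OF _ summable_pmf_nat k u0 c1 e'(1), of "min d1 d2" 1] d1 d2 by force
  define v where "v = real t' / real a'"
  have a'0: "0 < real a'" using a' by simp
  have uv: "u \<le> v" using lo by (simp add: v_def)
  have v: "t' = v * a'" "u \<le> v" "v < u + d1" "\<bar>v - u\<bar> < d2" "1 \<le> v"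
    using hi a'0 uv order_trans[OF u(1) uv] by (simp_all add: v_def)
  \<comment> \<open>\<open>a n\<close> is the largest multiple of \<open>a'\<close> not exceeding
    \<open>r n\<close>, so \<open>(a n, \<tau> n)\<close> consists of equal multiples of
    \<open>a'\<close> and \<open>t'\<close> and, divided by \<open>n\<close>, tends to
    \<open>(r, r v)\<close>.\<close>
  define L where "L n = nat \<lfloor>r * real n / real a'\<rfloor>" for n :: nat
  define a where "a n = L n * a'" for n
  define \<tau> where "\<tau> n = L n * t'" for n
  have \<tau>a: "real (\<tau> n) = v * real (a n)" for n by (simp add: \<tau>_def a_def v(1))
  have Lub: "real (L n) \<le> r * real n / real a'" for n unfolding L_def using r by simp
  have Llb: "r * real n / real a' - 1 \<le> real (L n)" for n unfolding L_def by linarith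
  have aub: "real (a n) \<le> r * real n" for n
    using Lub[of n] a'0 by (simp add: a_def field_simps)
  have alb: "r * real n - real a' \<le> real (a n)" for n
    using mult_right_mono[OF Llb[of n], of "real a'"] a'0 by (simp add: a_def left_diff_distrib)
  have an: "a n \<le> n" for n
  proof -
    have "real (a n) \<le> 1 * real n" using aub[of n] rt'(2) by (meson mult_right_mono of_nat_0_le_iff order_trans)
    then show ?thesis by simp
  qed
  have lima: "(\<lambda>n. real (a n) / real n) \<longlonglongrightarrow> r"
  proof (rule tendsto_sandwich)
    show "\<forall>\<^sub>F n in sequentially. r - real a' / real n \<le> real (a n) / real n"
      using eventually_ge_at_top[of "1::nat"]
    proof eventually_elim
      case (elim n)
      then have "(r * real n - real a') / real n \<le> real (a n) / real n" by (intro divide_right_mono alb) auto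
      then show ?case using elim by (simp add: diff_divide_distrib)
    qed
    show "\<forall>\<^sub>F n in sequentially. real (a n) / real n \<le> r"
      using eventually_ge_at_top[of "1::nat"] by eventually_elim (use aub in \<open>simp add: divide_le_eq\<close>)
    show "(\<lambda>n. r - real a' / real n) \<longlonglongrightarrow> r" by real_asymp
  qed simp
  have lim\<tau>: "(\<lambda>n. real (\<tau> n) / real n) \<longlonglongrightarrow> r * v"
    using tendsto_mult_left[OF lima, of v] by (simp add: \<tau>a mult.commute)
  have rv: "0 < r * v" using r v by simp
  have limE: "(\<lambda>n. entropy_part (real (a n) / real n) (real (\<tau> n) / real n)) \<longlonglongrightarrow> entropy_part r (r * v)"
  proof -
    have "(\<lambda>n. max 0 (1 - real (a n) / real n)) \<longlonglongrightarrow> max 0 (1 - r)" by (intro tendsto_intros lima)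
    then have 1: "(\<lambda>n. xlnx (max 0 (1 - real (a n) / real n))) \<longlonglongrightarrow> xlnx (max 0 (1 - r))"
      by (rule continuous_on_tendsto_compose[OF continuous_on_xlnx]) auto
    have 2: "(\<lambda>n. xlnx (real (a n) / real n)) \<longlonglongrightarrow> xlnx r"
      by (rule continuous_on_tendsto_compose[OF continuous_on_xlnx lima]) (use r in auto)
    have 3: "(\<lambda>n. xlnx (real (\<tau> n) / real n)) \<longlonglongrightarrow> xlnx (r * v)"
      by (rule continuous_on_tendsto_compose[OF continuous_on_xlnx lim\<tau>]) (use rv in auto)
    show ?thesis unfolding entropy_part_def by (intro tendsto_intros 1 2 3 lim\<tau>)
  qed
  have evU: "\<forall>\<^sub>F n in sequentially. (real (a n) / real n, real (\<tau> n) / real n) \<in> U"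
    using topological_tendstoD[OF tendsto_Pair[OF lima lim\<tau>] V(1)] near'[OF v(4)]
    by (auto simp: V(2) elim: eventually_mono)
  have eva: "\<forall>\<^sub>F n in sequentially. max A0 1 \<le> a n"
  proof -
    have "\<forall>\<^sub>F n in sequentially. real (max A0 1) \<le> r * real n - real a'" using r by real_asymp
    then show ?thesis
    proof eventually_elim
      case (elim n)
      then have "real (max A0 1) \<le> real (a n)" using alb[of n] by linarith
      then show ?case by (simp only: of_nat_le_iff)
    qed
  qed
  define E where "E n = entropy_part (real (a n) / real n) (real (\<tau> n) / real n)" for n
  define c where "c = A / r + e' + (surj_rate t r / r + e')"
  define q where "q n = exp (- real n * E n - 2 * ln (real n + 1) - 2 - real (a n) * c) / (real n * real (a n) * (real (\<tau> n) + 1))" for n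
  have "ereal (- entropy_part r (r * v) - r * c) \<le> liminf (\<lambda>n. ereal (1 / real n) * ln_ennreal (emeasure (M n)
     (hits n (M n) (N n) (S n) U)))"
  proof (rule liminf_ln_ennreal_ge)
    show "\<forall>\<^sub>F n in sequentially. 0 < q n \<and> ennreal (q n) \<le> emeasure (M n) (hits n (M n) (N n) (S n) U)"
      using evU eva eventually_ge_at_top[of "1::nat"]
    proof eventually_elim
      case (elim n)
      have a1: "1 \<le> a n" "0 < real (a n)" using elim by auto
      have "exp (- (real (a n) * (A / r + e'))) = exp (- (real a' * (A / r + e'))) ^ L n"
        by (simp add: exp_of_nat_mult[symmetric] a_def mult_ac)
      also have "\<dots> \<le> cpow (pmf \<mu>) a' t' ^ L n" by (intro power_mono q) simp
      also have "\<dots> \<le> cpow (pmf \<mu>) (a n) (\<tau> n)" unfolding a_def \<tau>_def by (rule cpow_power_le) simp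
      finally have q1: "exp (- (real (a n) * (A / r + e'))) \<le> cpow (pmf \<mu>) (a n) (\<tau> n)" .
      have q2: "exp (- (real (a n) * (surj_rate t r / r + e'))) \<le> cpow exp_wt (a n) (\<tau> n)"
        using elim a1 v by (intro W) (auto simp: \<tau>a)
      have "q n = exp (- real n * E n - 2 * ln (real n + 1) - 2) * exp (- (real (a n) * (surj_rate t r / r + e'))) *
          exp (- (real (a n) * (A / r + e'))) / (real n * real (a n) * (real (\<tau> n) + 1))"
        unfolding q_def c_def mult_exp_exp by (simp add: algebra_simps)
      also have "\<dots> \<le> exp (- real n * E n - 2 * ln (real n + 1) - 2) * cpow exp_wt (a n) (\<tau> n) *
          cpow (pmf \<mu>) (a n) (\<tau> n) / (real n * real (a n) * (real (\<tau> n) + 1))"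
        by (intro divide_right_mono mult_mono q1 q2 mult_nonneg_nonneg cpow_nonneg exp_wt_nonneg) auto
      also have "\<dots> \<le> model_prob \<mu> n (\<tau> n) (absorbed_at (\<tau> n) (a n))"
        unfolding E_def using elim a1 by (intro prob_absorbed_at_ge_exp an) auto
      finally have "ennreal (q n) \<le> ennreal (model_prob \<mu> n (\<tau> n) (absorbed_at (\<tau> n) (a n)))"
        by (rule ennreal_leI)
      also have "\<dots> \<le> emeasure (M n) (hits n (M n) (N n) (S n) U)"
        using elim by (intro prob_absorption_point_ge[OF ch _ U]) auto
      finally show ?case using elim a1 by (simp add: q_def add_nonneg_pos)
    qed
    have eq: "ln (q n) / real n = - E n - (real (a n) / real n) * c - (2 * ln (real n + 1) + 2) / real n - ln (real n) / real n - ln (real (a n)) / real n - ln (real (\<tau> n) + 1) / real n"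
      if "1 \<le> n" "1 \<le> a n" for n
    proof -
      have "ln (q n) = - real n * E n - 2 * ln (real n + 1) - 2 - real (a n) * c - (ln (real n) + ln (real (a n)) + ln (real (\<tau> n) + 1))"
        unfolding q_def using that by (simp add: ln_div ln_mult add_nonneg_pos)
      then show ?thesis using that by (simp add: diff_divide_distrib add_divide_distrib)
    qed
    have l1: "(\<lambda>n. ln (real n) / real n) \<longlonglongrightarrow> 0" by real_asymp
    have l2: "(\<lambda>n. (2 * ln (real n + 1) + 2) / real n) \<longlonglongrightarrow> 0" by real_asymp
    have l3: "(\<lambda>n. ln (real (a n)) / real n) \<longlonglongrightarrow> 0"
    proof (rule tendsto_sandwich[OF _ _ tendsto_const l1])
      show "\<forall>\<^sub>F n in sequentially. 0 \<le> ln (real (a n)) / real n" using eva by eventually_elim simp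
      show "\<forall>\<^sub>F n in sequentially. ln (real (a n)) / real n \<le> ln (real n) / real n"
        using eva by eventually_elim (use an in \<open>auto intro!: divide_right_mono ln_mono\<close>)
    qed
    have l4: "(\<lambda>n. ln (real (\<tau> n) + 1) / real n) \<longlonglongrightarrow> 0"
    proof (rule tendsto_sandwich[OF _ _ tendsto_const])
      show "\<forall>\<^sub>F n in sequentially. 0 \<le> ln (real (\<tau> n) + 1) / real n" by simp
      show "\<forall>\<^sub>F n in sequentially. ln (real (\<tau> n) + 1) / real n \<le> ln (v * real n + 1) / real n"
        using v an by (intro always_eventually allI divide_right_mono ln_mono) (auto simp: \<tau>a intro!: mult_left_mono add_nonneg_pos)
      show "(\<lambda>n. ln (v * real n + 1) / real n) \<longlonglongrightarrow> 0" using v(5) by real_asymp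
    qed
    have "(\<lambda>n. - E n - (real (a n) / real n) * c - (2 * ln (real n + 1) + 2) / real n - ln (real n) / real n - ln (real (a n)) / real n - ln (real (\<tau> n) + 1) / real n)
      \<longlonglongrightarrow> - entropy_part r (r * v) - r * c - 0 - 0 - 0 - 0"
      unfolding E_def by (intro tendsto_diff tendsto_minus tendsto_mult tendsto_const limE lima l1 l2 l3 l4)
    moreover have "\<forall>\<^sub>F n in sequentially. - E n - (real (a n) / real n) * c - (2 * ln (real n + 1) + 2) / real n - ln (real n) / real n - ln (real (a n)) / real n - ln (real (\<tau> n) + 1) / real n
       = ln (q n) / real n"
      using eva eventually_ge_at_top[of "1::nat"] by eventually_elim (rule eq[symmetric], auto)
    ultimately show "(\<lambda>n. ln (q n) / real n) \<longlonglongrightarrow> - entropy_part r (r * v) - r * c"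
      by (simp add: Lim_transform_eventually)
  qed
  moreover have "- f - e \<le> - entropy_part r (r * v) - r * c"
  proof -
    have "r * c = A + surj_rate t r + r * (2 * e')" using r by (simp add: c_def field_simps)
    then show ?thesis using near'[OF v(4)] e'(2) by (simp add: A_def)
  qed
  ultimately show ?thesis by (meson ereal_less_eq(3) order_trans)
qed

theorem theorem2p7:
  fixes \<mu> :: "nat pmf"
    and M :: "nat \<Rightarrow> 'w measure"
    and N S :: "nat \<Rightarrow> nat \<Rightarrow> 'w \<Rightarrow> nat"
  assumes "pmf \<mu> 0 < 1"
    and "pmf \<mu> 1 < 1"
    and "\<exists>a0>0. mgf \<mu> a0 < \<infinity>"
    and "\<And>n. n \<ge> 1 \<Longrightarrow> is_chain \<mu> n (M n) (N n) (S n)"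
  shows "large_deviation_principle ({0..} \<times> {0..}) M
           (\<lambda>n \<omega>. let \<tau> = absorption_time (S n) \<omega>
                   in (real (N n \<tau> \<omega>) / real n, real \<tau> / real n))
           (chain_rate \<mu>)"
proof -
  note ch = assms(4)
  obtain a0 where a0: "0 < a0" "mgf \<mu> a0 < \<infinity>" using assms(3) by blast
  have Z: "(\<lambda>n \<omega>. let \<tau> = absorption_time (S n) \<omega> in (real (N n \<tau> \<omega>) / real n, real \<tau> / real n))
    = (\<lambda>n. absorption_point n (N n) (S n))"
    by (simp add: fun_eq_iff absorption_point_def Let_def)
  show ?thesis
    unfolding large_deviation_principle_def Z
  proof (intro conjI allI impI ballI)
    fix n :: nat assume "1 \<le> n"
    then show "absorption_point n (N n) (S n) \<in> M n \<rightarrow>\<^sub>M restrict_space borel ({0..} \<times> {0..})"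
      by (rule absorption_point_measurable[OF ch])
  next
    fix F :: "(real \<times> real) set" assume F: "closedin (top_of_set ({0..} \<times> {0..})) F"
    let ?L = "limsup (\<lambda>n. ereal (1 / real n) * ln_ennreal (emeasure (M n)
      (hits n (M n) (N n) (S n) F)))"
    have "(INF x\<in>F. chain_rate \<mu> x) \<le> - ?L"
    proof (rule ccontr)
      assume "\<not> ?thesis"
      then have "- ?L < (INF x\<in>F. chain_rate \<mu> x)" by simp
      then obtain c where c: "- ?L < ereal c" "ereal c < (INF x\<in>F. chain_rate \<mu> x)" using ereal_dense2 by blast
      have "?L \<le> ereal (- c)" by (rule absorption_point_ldp_upper[OF ch a0 F c(2)])
      then have "- ereal (- c) \<le> - ?L" by (simp only: ereal_minus_le_minus)
      then have "ereal c \<le> - ?L" by simp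
      then show False using c(1) by simp
    qed
    then have "- (- ?L) \<le> - (INF x\<in>F. chain_rate \<mu> x)" by (simp only: ereal_minus_le_minus)
    then show "?L \<le> - (INF x\<in>F. chain_rate \<mu> x)" by simp
  next
    fix U :: "(real \<times> real) set" assume U: "openin (top_of_set ({0..} \<times> {0..})) U"
    let ?L = "liminf (\<lambda>n. ereal (1 / real n) * ln_ennreal (emeasure (M n)
      (hits n (M n) (N n) (S n) U)))"
    have Usub: "U \<subseteq> {0..} \<times> {0..}" using openin_imp_subset[OF U] by simp
    have "- ?L \<le> (INF x\<in>U. chain_rate \<mu> x)"
    proof (rule INF_greatest)
      fix x assume x: "x \<in> U"
      obtain r t where rt: "x = (r, t)" by (cases x)
      have nn: "0 \<le> r" "0 \<le> t" using x Usub rt by auto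
      show "- ?L \<le> chain_rate \<mu> x"
      proof (cases "r = 0")
        case True
        show ?thesis
        proof (cases "t = 0")
          case True
          have "0 \<le> ?L" by (rule absorption_point_ldp_lower_origin[OF ch U]) (use x rt True \<open>r = 0\<close> in auto)
          then have "- ?L \<le> 0" by simp
          also have "0 \<le> chain_rate \<mu> x" by (rule chain_rate_nonneg)
          finally show ?thesis .
        next
          case False
          then show ?thesis using True nn by (simp add: rt chain_rate_def)
        qed
      next
        case False
        then have r: "0 < r" using nn by simp
        show ?thesis
        proof (cases "chain_rate \<mu> x")
          case (real f)
          have "- ?L \<le> ereal f + ereal e" if "0 < e" for e
          proof -
            have "ereal (- f - e) \<le> ?L"
              by (rule absorption_point_ldp_lower[OF ch U _ r _ that]) (use x real rt in auto)
            then have "- ?L \<le> - ereal (- f - e)" by (simp only: ereal_minus_le_minus)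
            then show ?thesis by (simp add: add.commute)
          qed
          then show ?thesis unfolding real by (rule ereal_le_epsilon2)
        next
          case MInf
          then show ?thesis using chain_rate_nonneg[of \<mu> x] by simp
        qed simp
      qed
    qed
    then show "- (INF x\<in>U. chain_rate \<mu> x) \<le> ?L" by (simp add: ereal_uminus_le_reorder)
  qed (auto intro: chain_rate_nonneg chain_rate_lsc)
qed

end
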